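(* Let $k\ge 3$ and $\nu\ge 0$ be fixed integers. There exist two constants $c_1,c_2$, depending only on $k$ and $\nu$, satisfying \[ \max\left\{(k-1)\,ex\left(\nu,P_{2}^{3}\right),\;2(k-1)\left\lfloor\frac{\nu}{2}\right\rfloor \right\}\le c_1\le c_2\le \frac{k}{3}\binom{\nu}{2}+(k-1)\nu , \] and a constant $M_3$, depending only on $k$ and $\nu$, with $M_3\le f(k\nu,k,3,\nu-1)$, such that \[ f(n,k,3,\nu)\ge \binom{n-k\nu-1}{k-1}+\left\lfloor\frac{\nu}{2}\right\rfloor\binom{n-k\nu-1}{k-3}+c_1\binom{n-k\nu-1}{k-4}+\nu \] holds for all $n$ (with $n\ge k(\nu+1)$), and \[ f(n,k,3,\nu)\le\binom{n-k\nu-1}{k-1}+\left\lfloor\frac{\nu}{2}\right\rfloor\binom{n-k\nu-1}{k-3}+(c_2+o(1))\binom{n-k\nu-1}{k-4}+M_3 \] holds for all sufficiently large $n$, where $o(1)$ denotes a quantity tending to $0$ as $n\to\infty$ with $k,\nu$ fixed.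
   Context: $[n]=\{1,\dots,n\}$, and $\binom{V}{k}$ is the collection of all $k$-element subsets of a set $V$. For integers $m\ge 0$ and $j<0$, $\binom{m}{j}=0$. A $d$-cluster of $k$-sets is a collection of $d$ different $k$-sets $A_1,\dots,A_d$ with $|A_1\cup\dots\cup A_d|\le 2k$ and $A_1\cap\dots\cap A_d=\emptyset$. A family $\mathcal{F}\subset\binom{[n]}{k}$ is $d$-cluster-free if it contains no $d$-cluster. The matching number $\nu(\mathcal{F})$ is the maximum number of pairwise disjoint sets in $\mathcal{F}$. For $n\ge k(\nu+1)$, $f(n,k,d,\nu)$ is the maximum size of a $d$-cluster-free family $\mathcal{F}\subset\binom{[n]}{k}$ with $\nu(\mathcal{F})\ge\nu+1$. (In the degenerate case $\nu=0$, the expression $f(k\nu,k,3,\nu-1)=f(0,k,3,-1)$ is read as $0$.) An $r$-graph is an $r$-uniform hypergraph without multiple edges. The tight $\ell$-path $P_{\ell}^{r}$ is the $r$-graph with edge set $\{v_iv_{i+1}\dots v_{i+r-1}:1\le i\le\ell\}$ (with $v_1,\dots,v_{\ell+r-1}$ distinct); so $P_2^3$ consists of two $3$-sets sharing exactly two vertices. $ex(n,P_{\ell}^{r})$ is the maximum number of edges in an $n$-vertex $r$-graph containing no copy of $P_{\ell}^{r}$ as a subgraph. *)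

theory Defs
  imports Complex_Main "HOL-Library.Ramsey"
begin

text \<open>The collection of \<open>k\<close>-element subsets of \<open>V\<close> is the library's \<^term>\<open>nsets V k\<close>.\<close>

definition is_cluster :: "nat \<Rightarrow> nat \<Rightarrow> 'a set set \<Rightarrow> bool" where
  "is_cluster d k \<C> \<longleftrightarrow>
     finite \<C> \<and> card \<C> = d \<and> (\<forall>A\<in>\<C>. finite A \<and> card A = k) \<and>
     card (\<Union>\<C>) \<le> 2 * k \<and> \<Inter>\<C> = {}"

definition cluster_free :: "nat \<Rightarrow> nat \<Rightarrow> 'a set set \<Rightarrow> bool" where
  "cluster_free d k \<F> \<longleftrightarrow> \<not> (\<exists>\<C>\<subseteq>\<F>. is_cluster d k \<C>)"

definition matching_number :: "'a set set \<Rightarrow> nat" where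
  "matching_number \<F> = Max {card M | M. M \<subseteq> \<F> \<and> pairwise disjnt M}"

text \<open>
  The parameter \<open>\<nu>\<close> is an integer so that \<open>\<nu> = -1\<close> is a legitimate value. If
  \<open>n < k * (\<nu> + 1)\<close> (with \<open>k \<ge> 1\<close>), no family qualifies and the value is unspecified.
\<close>

definition max_cluster_free :: "nat \<Rightarrow> nat \<Rightarrow> nat \<Rightarrow> int \<Rightarrow> nat" where
  "max_cluster_free n k d \<nu> =
     Max {card \<F> | \<F>. \<F> \<subseteq> nsets {1..n} k \<and> cluster_free d k \<F> \<and>
                        int (matching_number \<F>) \<ge> \<nu> + 1}"

lemma max_cluster_free_degenerate:
  assumes "k \<ge> 1" "d \<ge> 1"
  shows "max_cluster_free 0 k d (-1) = 0"
proof -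
  have "nsets {1..0::nat} k = {}"
    using assms by (auto simp: nsets_def)
  moreover have "cluster_free d k ({} :: nat set set)"
    using assms by (auto simp: cluster_free_def is_cluster_def)
  ultimately have "{card \<F> | \<F>. \<F> \<subseteq> nsets {1..0::nat} k \<and> cluster_free d k \<F> \<and>
                        int (matching_number \<F>) \<ge> -1 + 1} = {0}"
    by auto
  then show ?thesis
    by (simp only: max_cluster_free_def Max_singleton)
qed

text \<open>A hypergraph without isolated vertices is represented by its set of edges.\<close>

definition tight_path :: "nat \<Rightarrow> nat \<Rightarrow> nat set set" where
  "tight_path r l = {{i..<i + r} | i. 1 \<le> i \<and> i \<le> l}"

definition contains_copy :: "'a set set \<Rightarrow> 'b set set \<Rightarrow> bool" where
  "contains_copy E H \<longleftrightarrow> (\<exists>\<phi>. inj_on \<phi> (\<Union>H) \<and> (\<forall>e\<in>H. \<phi> ` e \<in> E))"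

definition turan_number :: "nat \<Rightarrow> nat \<Rightarrow> 'b set set \<Rightarrow> nat" where
  "turan_number r n H = Max {card E | E. E \<subseteq> nsets {1..n} r \<and> \<not> contains_copy E H}"

text \<open>Binomial coefficient with the convention that a negative lower index gives \<open>0\<close>.\<close>

definition binom :: "nat \<Rightarrow> int \<Rightarrow> nat" where
  "binom m j = (if j < 0 then 0 else m choose nat j)"

end

theory Submission
  imports Defs
begin

text \<open>
  Upper bound. If a \<open>(k - 1)\<close>-subset \<open>A - {a}\<close> of an edge \<open>A\<close> lies in a second edge, then every edge
  through \<open>a\<close> meets \<open>A - {a}\<close>: each such \<open>a\<close> gets at most \<open>k - 1\<close> successors, and an edge without a
  \<open>(k - 1)\<close>-subset of its own has a successor inside it for each of its points. There are only
  \<open>O(n^(k-2))\<close> such edges. Hence if \<open>|F|\<close> is close to the size of a star, nearly every \<open>(k - 1)\<close>-set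
  \<open>D\<close> lies in exactly one edge \<open>D \<union> {x}\<close>, and exchanging one point of \<open>D\<close> does not change \<open>x\<close>.
  Therefore \<open>F\<close> is a star with some centre \<open>x\<close> up to \<open>O(n^(k-2))\<close> sets.

  Take \<open>\<nu>\<close> disjoint edges (blocks) avoiding \<open>x\<close>, with union \<open>U\<close>, and let \<open>W\<close> be the rest. An edge
  through \<open>x\<close> whose trace on \<open>U\<close> lies in one block rules out many sets of the star on \<open>W\<close>; for a
  fixed set outside \<open>U\<close> the remaining traces of size 2 touch pairwise disjoint pairs of blocks, and
  those of size 3 number at most the stated \<open>c\<^sub>2\<close>. An edge avoiding \<open>x\<close> but not contained in \<open>U\<close>
  costs at least a constant fraction of \<open>n^(k-2)\<close> sets of the star, while there are only boundedly
  many edges avoiding \<open>x\<close>.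

  Lower bound. Add to the blocks all \<open>k\<close>-sets through \<open>x\<close> whose trace on \<open>U\<close> lies in a suitable
  family: the empty set, one pair across each of \<open>\<nu> div 2\<close> disjoint pairs of blocks, and either all
  triples extending these pairs within their two blocks, or \<open>k - 1\<close> disjoint transversals over each
  triple of an extremal \<open>P\<^sub>2\<^sup>3\<close>-free system. Thus \<open>c\<^sub>1\<close> is the stated maximum, and
  \<open>c\<^sub>2\<close> and \<open>M\<^sub>3\<close> are their stated bounds.
\<close>

section \<open>Families and their transfer to initial segments\<close>

lemma cluster_free_3D:
  assumes "cluster_free 3 k F" "F \<subseteq> nsets V k" "A \<in> F" "B \<in> F" "C \<in> F"
    and "A \<noteq> B" "A \<noteq> C" "B \<noteq> C" and "card (A \<union> B \<union> C) \<le> 2 * k"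
  shows "A \<inter> B \<inter> C \<noteq> {}"
proof
  assume "A \<inter> B \<inter> C = {}"
  moreover have "card {A, B, C} = 3" using assms(6-8) by simp
  ultimately have "is_cluster 3 k {A, B, C}"
    using assms by (auto simp: is_cluster_def nsets_def Un_assoc Int_assoc)
  moreover have "{A, B, C} \<subseteq> F" using assms(3-5) by simp
  ultimately show False
    using assms(1) unfolding cluster_free_def by metis
qed

lemma matching_number_ge_iff:
  assumes "finite F"
  shows "q \<le> matching_number F \<longleftrightarrow> (\<exists>M\<subseteq>F. pairwise disjnt M \<and> q \<le> card M)"
proof -
  let ?S = "{card M | M. M \<subseteq> F \<and> pairwise disjnt M}"
  have "?S \<subseteq> card ` Pow F" by auto
  then have "finite ?S" using assms by (auto intro: finite_subset)
  moreover have "card {} \<in> ?S" by (intro CollectI exI[of _ "{}"]) auto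
  ultimately show ?thesis
    unfolding matching_number_def by (subst Max_ge_iff) auto
qed

text \<open>A bijection from \<open>V\<close> onto \<open>{1..card V}\<close> preserves sizes,
  unions and disjointness. Constructions and restrictions may therefore use any convenient finite
  ground set, although \<open>max_cluster_free\<close> is tied to initial segments.\<close>

lemma cluster_free_transfer:
  fixes F :: "'a set set" and V :: "'a set"
  assumes V: "finite V" and F: "F \<subseteq> nsets V k" "cluster_free 3 k F"
    and M: "M \<subseteq> F" "pairwise disjnt M"
  obtains G M' where "G \<subseteq> nsets {1..card V} k" "cluster_free 3 k G" "M' \<subseteq> G"
    "pairwise disjnt M'" "card M' = card M" "card G = card F"
proof -
  let ?n = "card V"
  obtain h where h: "bij_betw h V {1..?n}"
    using V by (metis card_atLeastAtMost diff_Suc_1 finite_atLeastAtMost finite_same_card_bij)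
  have inj: "inj_on h V" and im: "h ` V = {1..?n}" using h by (auto simp: bij_betw_def)
  define F' where "F' = (`) h ` F"
  have FP: "F \<subseteq> Pow V" using F(1) by (auto simp: nsets_def)
  have injF: "inj_on ((`) h) (Pow V)" using inj by (simp add: inj_on_image_Pow)
  have card1: "card (h ` A) = card A" if "A \<subseteq> V" for A
    using that inj by (meson card_image inj_on_subset)
  have F': "F' \<subseteq> nsets {1..?n} k"
  proof
    fix B assume "B \<in> F'"
    then obtain A where A: "A \<in> F" "B = h ` A" by (auto simp: F'_def)
    then have "A \<subseteq> V" "finite A" "card A = k" using F(1) by (auto simp: nsets_def)
    then show "B \<in> nsets {1..?n} k" using A card1[of A] im by (auto simp: nsets_def)
  qed
  have cardF: "card F' = card F"
    unfolding F'_def using injF FP by (meson card_image inj_on_subset)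
  have cf: "cluster_free 3 k F'"
    unfolding cluster_free_def
  proof (intro notI, elim exE conjE)
    fix \<C> assume C: "\<C> \<subseteq> F'" "is_cluster 3 k \<C>"
    then obtain \<D> where D: "\<D> \<subseteq> F" "\<C> = (`) h ` \<D>" unfolding F'_def by (meson subset_imageE)
    have DP: "\<D> \<subseteq> Pow V" using D FP by blast
    have UD: "\<Union>\<D> \<subseteq> V" using DP by blast
    have cD: "card \<D> = 3"
      using C(2) D(2) card_image[OF inj_on_subset[OF injF DP]] by (simp add: is_cluster_def)
    have U: "\<Union>\<C> = h ` \<Union>\<D>" unfolding D(2) by blast
    \<comment> \<open>One inclusion suffices: an empty intersection of the images forces an empty
      intersection of the preimages.\<close>
    have I: "h ` \<Inter>\<D> \<subseteq> \<Inter>\<C>" unfolding D(2) by blast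
    have "is_cluster 3 k \<D>"
      unfolding is_cluster_def
    proof (intro conjI)
      show "finite \<D>" using cD by (simp add: card_ge_0_finite)
      show "card \<D> = 3" by (rule cD)
      show "\<forall>A\<in>\<D>. finite A \<and> card A = k" using D(1) F(1) by (auto simp: nsets_def)
      show "card (\<Union>\<D>) \<le> 2 * k" using C(2) U card1[OF UD] by (simp add: is_cluster_def)
      show "\<Inter>\<D> = {}" using I C(2) by (auto simp: is_cluster_def)
    qed
    then show False using F(2) D(1) by (auto simp: cluster_free_def)
  qed
  have pd: "pairwise disjnt ((`) h ` M)"
  proof (rule pairwise_imageI)
    fix A B assume "A \<in> M" "B \<in> M" "A \<noteq> B"
    then have "A \<inter> B = {}" "A \<subseteq> V" "B \<subseteq> V"
      using M FP by (auto simp: pairwise_def disjnt_def)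
    then show "disjnt (h ` A) (h ` B)"
      using inj_on_image_Int[OF inj, of A B] by (auto simp: disjnt_def)
  qed
  have cM: "card ((`) h ` M) = card M"
    using M(1) FP injF by (meson card_image inj_on_subset subset_trans)
  have MF: "(`) h ` M \<subseteq> F'" using M(1) by (auto simp: F'_def)
  show thesis by (rule that[OF F' cf MF pd cM cardF])
qed

lemma finite_family_sizes:
  "finite {card \<F> | \<F>. \<F> \<subseteq> nsets {1..n::nat} k \<and> cluster_free d k \<F> \<and> P \<F>}"
proof (rule finite_subset)
  show "{card \<F> | \<F>. \<F> \<subseteq> nsets {1..n} k \<and> cluster_free d k \<F> \<and> P \<F>} \<subseteq> card ` Pow (nsets {1..n} k)"
    by auto
qed (simp add: finite_imp_finite_nsets)

lemma max_cluster_free_ge: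
  assumes "finite V" "F \<subseteq> nsets V k" "cluster_free 3 k F"
    and "M \<subseteq> F" "pairwise disjnt M" "\<nu> + 1 \<le> int (card M)"
  shows "card F \<le> max_cluster_free (card V) k 3 \<nu>"
proof -
  obtain G M' where G: "G \<subseteq> nsets {1..card V} k" "cluster_free 3 k G" "M' \<subseteq> G"
    "pairwise disjnt M'" "card M' = card M" "card G = card F"
    using cluster_free_transfer[OF assms(1-5)] by metis
  have "finite G" using G(1) finite_imp_finite_nsets finite_subset by blast
  then have "card M' \<le> matching_number G"
    using matching_number_ge_iff[of G "card M'"] G by blast
  then have "card F \<in> {card \<F> | \<F>. \<F> \<subseteq> nsets {1..card V} k \<and> cluster_free 3 k \<F> \<and>
                        int (matching_number \<F>) \<ge> \<nu> + 1}"
    using G assms(6) by (intro CollectI exI[of _ G]) auto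
  then show ?thesis unfolding max_cluster_free_def by (rule Max_ge[OF finite_family_sizes])
qed

text \<open>\<open>Max\<close> of an empty set is unspecified, so one admissible family must be
  supplied before the extremal value can be attributed to an actual family.\<close>

lemma max_cluster_free_attained:
  assumes "finite V" "F \<subseteq> nsets V k" "cluster_free 3 k F"
    and "M \<subseteq> F" "pairwise disjnt M" "\<nu> + 1 \<le> card M"
  obtains G M' where "G \<subseteq> nsets {1..card V} k" "cluster_free 3 k G" "M' \<subseteq> G"
    "pairwise disjnt M'" "\<nu> + 1 \<le> card M'" "card G = max_cluster_free (card V) k 3 (int \<nu>)"
proof -
  let ?S = "{card \<F> | \<F>. \<F> \<subseteq> nsets {1..card V} k \<and> cluster_free 3 k \<F> \<and>
                        int (matching_number \<F>) \<ge> int \<nu> + 1}"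
  obtain G M' where G: "G \<subseteq> nsets {1..card V} k" "cluster_free 3 k G" "M' \<subseteq> G"
    "pairwise disjnt M'" "card M' = card M" "card G = card F"
    using cluster_free_transfer[OF assms(1-5)] by metis
  have fin: "finite H" if "H \<subseteq> nsets {1..card V} k" for H
    using that finite_imp_finite_nsets finite_subset by blast
  have "card M' \<le> matching_number G"
    using matching_number_ge_iff[OF fin[OF G(1)], of "card M'"] G by blast
  then have "card G \<in> ?S"
    using G assms(6) by (intro CollectI exI[of _ G]) auto
  then have "Max ?S \<in> ?S" by (intro Max_in[OF finite_family_sizes]) blast
  then obtain H where H: "H \<subseteq> nsets {1..card V} k" "cluster_free 3 k H"
    "\<nu> + 1 \<le> matching_number H" "card H = Max ?S" by force
  moreover obtain M'' where "M'' \<subseteq> H" "pairwise disjnt M''" "\<nu> + 1 \<le> card M''"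
    using H(3) matching_number_ge_iff[OF fin[OF H(1)]] by blast
  ultimately show thesis using that unfolding max_cluster_free_def by blast
qed

section \<open>Labellings of the Johnson graph\<close>

lemma card_nsets_superset_le:
  assumes "finite V" "card P \<le> k" "finite P"
  shows "card {A \<in> nsets V k. P \<subseteq> A} \<le> card V ^ (k - card P)"
proof -
  have "inj_on (\<lambda>A. A - P) {A \<in> nsets V k. P \<subseteq> A}" by (auto simp: inj_on_def)
  moreover have "(\<lambda>A. A - P) ` {A \<in> nsets V k. P \<subseteq> A} \<subseteq> nsets V (k - card P)"
    using assms by (auto simp: nsets_def card_Diff_subset)
  ultimately have "card {A \<in> nsets V k. P \<subseteq> A} \<le> card (nsets V (k - card P))"
    using assms(1) by (intro card_inj_on_le) (simp_all add: finite_imp_finite_nsets)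
  also have "\<dots> = card V choose (k - card P)" by (simp add: card_nsets)
  also have "\<dots> \<le> card V ^ (k - card P)"
    by (metis binomial_eq_0_iff binomial_le_pow not_le zero_le)
  finally show ?thesis .
qed

text \<open>Induction on \<open>r\<close>: an \<open>r\<close>-set inherits the label of its
  unexceptional extensions and becomes exceptional itself when a quarter or more of the ground set
  extends it into \<open>NN\<close>. This threshold saves a factor of order \<open>card V\<close> in
  the number of exceptional sets, which pays for the factor lost on returning from
  \<open>r\<close>-sets to sets of size \<open>Suc r\<close>; hence the bound stays linear in
  \<open>card NN\<close>.\<close>

lemma johnson_label:
  "\<exists>K::nat. \<forall>(V::'a set) NN (l::'a set \<Rightarrow> 'b).
     finite V \<and> 2 * r + 4 \<le> card V \<and> NN \<subseteq> nsets V r \<and>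
     (\<forall>R z z'. z \<notin> R \<and> z' \<notin> R \<and> insert z R \<in> nsets V r - NN \<and> insert z' R \<in> nsets V r - NN
        \<longrightarrow> l (insert z R) = l (insert z' R))
     \<longrightarrow> (\<exists>x. card {D \<in> nsets V r - NN. l D \<noteq> x} \<le> K * card NN)"
proof (induction r)
  case 0
  show ?case
  proof (intro exI[of _ 0] allI impI)
    fix V :: "'a set" and NN and l :: "'a set \<Rightarrow> 'b"
    have "{D \<in> nsets V 0 - NN. l D \<noteq> l {}} = {}" by (auto simp: nsets_def)
    then show "\<exists>x. card {D \<in> nsets V 0 - NN. l D \<noteq> x} \<le> 0 * card NN" by (metis card.empty le0)
  qed
next
  case (Suc r)
  then obtain K :: nat where K0: "\<forall>(V::'a set) NN (l::'a set \<Rightarrow> 'b).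
     finite V \<and> 2 * r + 4 \<le> card V \<and> NN \<subseteq> nsets V r \<and>
     (\<forall>R z z'. z \<notin> R \<and> z' \<notin> R \<and> insert z R \<in> nsets V r - NN \<and> insert z' R \<in> nsets V r - NN
        \<longrightarrow> l (insert z R) = l (insert z' R))
     \<longrightarrow> (\<exists>x. card {D \<in> nsets V r - NN. l D \<noteq> x} \<le> K * card NN)"
    by (rule exE)
  show ?case
  proof (intro exI[of _ "(1 + K) * 4 * Suc r"] allI impI, elim conjE)
    fix V :: "'a set" and NN and l :: "'a set \<Rightarrow> 'b"
    assume V: "finite V" "2 * Suc r + 4 \<le> card V" and NN: "NN \<subseteq> nsets V (Suc r)"
      and l0: "\<forall>R z z'. z \<notin> R \<and> z' \<notin> R \<and> insert z R \<in> nsets V (Suc r) - NN \<and>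
         insert z' R \<in> nsets V (Suc r) - NN \<longrightarrow> l (insert z R) = l (insert z' R)"
    let ?n = "card V"
    define ex where "ex R = {z \<in> V - R. insert z R \<in> NN}" for R
    define N' where "N' = {R \<in> nsets V r. ?n \<le> 4 * card (ex R)}"
    define l' where "l' R = l (insert (SOME z. z \<in> V - R \<and> insert z R \<notin> NN) R)" for R
    have finNN: "finite NN" using NN V by (meson finite_imp_finite_nsets finite_subset)
    have finR: "finite R" "card R = r" if "R \<in> nsets V r" for R using that by (auto simp: nsets_def)
    have fex: "finite (ex R)" for R using V by (auto simp: ex_def)
    have ins: "insert z R \<in> nsets V (Suc r)" if "R \<in> nsets V r" "z \<in> V - R" for z R
      using that by (auto simp: nsets_def)
    have finN': "finite N'" using V by (auto simp: N'_def finite_imp_finite_nsets)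
    \<comment> \<open>Double counting of pairs of a set in \<open>NN\<close> and a point deleted
      from it: each member of \<open>N'\<close> accounts for at least a quarter of \<open>?n\<close>
      such pairs.\<close>
    have cN': "card N' * ?n \<le> 4 * (Suc r * card NN)"
    proof -
      have "card N' * ?n = (\<Sum>R\<in>N'. ?n)" by simp
      also have "\<dots> \<le> (\<Sum>R\<in>N'. 4 * card (ex R))" by (rule sum_mono) (auto simp: N'_def)
      also have "\<dots> = 4 * card (SIGMA R:N'. ex R)"
        using finN' fex by (simp add: card_SigmaI sum_distrib_left)
      also have "card (SIGMA R:N'. ex R) \<le> card (SIGMA D:NN. D)"
      proof (rule card_inj_on_le)
        show "inj_on (\<lambda>(R,z). (insert z R, z)) (SIGMA R:N'. ex R)"
          by (auto simp: inj_on_def ex_def dest: insert_ident[THEN iffD1, rotated 2])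
        show "(\<lambda>(R,z). (insert z R, z)) ` (SIGMA R:N'. ex R) \<subseteq> (SIGMA D:NN. D)"
          by (auto simp: ex_def)
        show "finite (SIGMA D:NN. D)" using finNN NN by (auto simp: nsets_def)
      qed
      also have "card (SIGMA D:NN. D) = (\<Sum>D\<in>NN. card D)"
        using finNN NN by (subst card_SigmaI) (auto simp: nsets_def)
      also have "\<dots> = Suc r * card NN" using NN by (subst sum.cong[where h="\<lambda>_. Suc r"]) (auto simp: nsets_def)
      finally show ?thesis by simp
    qed
    \<comment> \<open>Each of \<open>R\<close> and \<open>R'\<close> loses fewer than a quarter of
      the points to extensions in \<open>NN\<close>, and \<open>Suc r\<close> is less than half of
      \<open>?n\<close>; so a common good \<open>w\<close> is left. Here the lower bound on
      \<open>card V\<close> enters.\<close>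
    have good: "\<exists>w. w \<in> V - R - R' \<and> insert w R \<notin> NN \<and> insert w R' \<notin> NN"
      if R: "R \<in> nsets V r - N'" "R' \<in> nsets V r - N'" "card (R \<union> R') \<le> Suc r" for R R'
    proof -
      have "4 * card (ex R) < ?n" "4 * card (ex R') < ?n" using R by (auto simp: N'_def)
      moreover have "card ((R \<union> R') \<union> (ex R \<union> ex R')) \<le> Suc r + (card (ex R) + card (ex R'))"
        using card_Un_le[of "R \<union> R'" "ex R \<union> ex R'"] card_Un_le[of "ex R" "ex R'"] R(3) by linarith
      moreover have "2 * r + 6 \<le> ?n" using V(2) by simp
      ultimately have "card ((R \<union> R') \<union> (ex R \<union> ex R')) < ?n" by auto
      moreover have "finite ((R \<union> R') \<union> (ex R \<union> ex R'))" using R fex by (auto simp: nsets_def)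
      ultimately have "\<not> V \<subseteq> (R \<union> R') \<union> (ex R \<union> ex R')" using card_mono by (metis not_le)
      then show ?thesis unfolding ex_def by blast
    qed
    have l': "l' R = l (insert w R)" if "R \<in> nsets V r - N'" "w \<in> V - R" "insert w R \<notin> NN" for R w
    proof -
      let ?z = "SOME z. z \<in> V - R \<and> insert z R \<notin> NN"
      have "?z \<in> V - R \<and> insert ?z R \<notin> NN"
        using that by (intro someI[of "\<lambda>z. z \<in> V - R \<and> insert z R \<notin> NN" w]) auto
      then have "?z \<notin> R" "insert ?z R \<in> nsets V (Suc r) - NN" using ins[of R ?z] that(1) by blast+
      moreover have "w \<notin> R" "insert w R \<in> nsets V (Suc r) - NN" using ins[of R w] that by blast+
      ultimately show ?thesis unfolding l'_def using l0 by blast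
    qed
    have "\<exists>x. card {D \<in> nsets V r - N'. l' D \<noteq> x} \<le> K * card N'"
    proof (rule K0[rule_format], intro conjI allI impI, goal_cases)
      case (4 R z z')
      note a = 4[THEN conjunct1] 4[THEN conjunct2, THEN conjunct1]
        4[THEN conjunct2, THEN conjunct2, THEN conjunct1] 4[THEN conjunct2, THEN conjunct2, THEN conjunct2]
      have fR: "finite R" "R \<subseteq> V" "z \<in> V" "z' \<in> V" "Suc (card R) = r" using a by (auto simp: nsets_def)
      have "insert z R \<union> insert z' R = insert z' (insert z R)" by blast
      then have "card (insert z R \<union> insert z' R) \<le> Suc r"
        using finR[of "insert z R"] a by (simp add: card_insert_if)
      from good[OF a(3,4) this] obtain w where w: "w \<in> V - insert z R - insert z' R"
        "insert w (insert z R) \<notin> NN" "insert w (insert z' R) \<notin> NN" by blast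
      \<comment> \<open>Both sets are lifted by the same \<open>w\<close>; one exchange among sets
        of size \<open>Suc r\<close> then turns \<open>z\<close> into \<open>z'\<close>.\<close>
      have "l' (insert z R) = l (insert w (insert z R))" using w a by (intro l') auto
      also have "\<dots> = l (insert z (insert w R))" by (simp add: insert_commute)
      also have "\<dots> = l (insert z' (insert w R))"
      proof -
        have "z \<notin> insert w R" "z' \<notin> insert w R" using a w by auto
        moreover have "insert z (insert w R) \<in> nsets V (Suc r) - NN"
          using ins[of "insert z R" w] a w by (simp add: insert_commute)
        moreover have "insert z' (insert w R) \<in> nsets V (Suc r) - NN"
          using ins[of "insert z' R" w] a w by (simp add: insert_commute)
        ultimately show ?thesis by (intro l0[rule_format] conjI)
      qed
      also have "\<dots> = l (insert w (insert z' R))" by (simp add: insert_commute)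
      also have "\<dots> = l' (insert z' R)" using w a by (intro l'[symmetric]) auto
      finally show ?case .
    qed (use V in \<open>auto simp: N'_def\<close>)
    then obtain x where x: "card {D \<in> nsets V r - N'. l' D \<noteq> x} \<le> K * card N'" by blast
    let ?Y = "{D \<in> nsets V r - N'. l' D \<noteq> x}"
    have finY: "finite ?Y" using V by (simp add: finite_imp_finite_nsets)
    \<comment> \<open>Deleting any point from a set whose label is not \<open>x\<close> leaves a set
      that is exceptional or wrongly labelled one level lower.\<close>
    have "{D \<in> nsets V (Suc r) - NN. l D \<noteq> x} \<subseteq> (\<lambda>(R,z). insert z R) ` ((N' \<union> ?Y) \<times> V)"
    proof
      fix D assume D: "D \<in> {D \<in> nsets V (Suc r) - NN. l D \<noteq> x}"
      then obtain d where d: "d \<in> D" by (fastforce simp: nsets_def)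
      let ?R = "D - {d}"
      have R: "?R \<in> nsets V r" "insert d ?R = D" "d \<in> V - ?R" using D d by (auto simp: nsets_def)
      have "?R \<in> N' \<union> ?Y"
        using l'[of ?R d] R D by (cases "?R \<in> N'") auto
      then show "D \<in> (\<lambda>(R,z). insert z R) ` ((N' \<union> ?Y) \<times> V)"
        using R by (intro image_eqI[of _ _ "(?R, d)"]) auto
    qed
    then have "card {D \<in> nsets V (Suc r) - NN. l D \<noteq> x} \<le> card ((N' \<union> ?Y) \<times> V)"
      using finN' finY V by (meson finite_SigmaI finite_UnI surj_card_le)
    also have "\<dots> = card (N' \<union> ?Y) * ?n" by (simp add: card_cartesian_product)
    also have "\<dots> \<le> (card N' + card ?Y) * ?n" by (intro mult_right_mono card_Un_le) simp
    also have "\<dots> \<le> ((1 + K) * card N') * ?n" using x by (intro mult_right_mono) auto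
    also have "\<dots> \<le> (1 + K) * 4 * Suc r * card NN"
      using mult_left_mono[OF cN', of "1 + K"] by (simp add: algebra_simps)
    finally show "\<exists>x. card {D \<in> nsets V (Suc r) - NN. l D \<noteq> x} \<le> (1 + K) * 4 * Suc r * card NN" by blast
  qed
qed

section \<open>Stability of stars\<close>

definition own :: "'a set set \<Rightarrow> 'a set \<Rightarrow> bool" where
  "own F D \<longleftrightarrow> (\<exists>!A. A \<in> F \<and> D \<subseteq> A)"

lemma own_unique: "own F D \<Longrightarrow> A \<in> F \<Longrightarrow> D \<subseteq> A \<Longrightarrow> B \<in> F \<Longrightarrow> D \<subseteq> B \<Longrightarrow> A = B"
  unfolding own_def by blast

text \<open>A second edge \<open>A1\<close> over \<open>A - {a}\<close> misses \<open>a\<close>, so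
  \<open>A \<inter> A1 = A - {a}\<close>. If \<open>B\<close> avoided this set, the three edges
  would have no common point, while \<open>A \<union> B\<close> has at most \<open>2 * k - 1\<close>
  points and \<open>A1\<close> adds just one: a cluster.\<close>

lemma not_own_meets:
  assumes F: "F \<subseteq> nsets V k" "cluster_free 3 k F" "2 \<le> k"
    and A: "A \<in> F" "a \<in> A" "\<not> own F (A - {a})" and B: "B \<in> F" "a \<in> B"
  shows "B \<inter> (A - {a}) \<noteq> {}"
proof
  assume e: "B \<inter> (A - {a}) = {}"
  obtain A1 where A1: "A1 \<in> F" "A - {a} \<subseteq> A1" "A1 \<noteq> A"
    using A unfolding own_def by blast
  have c: "finite X" "card X = k" if "X \<in> F" for X using that F(1) by (auto simp: nsets_def)
  have cAa: "card (A - {a}) = k - 1" "finite (A - {a})" using A c by auto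
  have a1: "a \<notin> A1"
  proof
    assume "a \<in> A1"
    then have "A \<subseteq> A1" using A1(2) A(2) by blast
    then show False using A1 A c by (metis card_subset_eq)
  qed
  have "A - {a} \<noteq> {}" using cAa F(3) by (metis card.empty diff_is_0_eq not_less_eq_eq numeral_2_eq_2 One_nat_def)
  then have "A \<noteq> B" using e by blast
  moreover have "A1 \<noteq> B" using a1 B by blast
  moreover have "card (A \<union> A1 \<union> B) \<le> 2 * k"
  proof -
    have "A \<union> A1 \<union> B = (A \<union> B) \<union> (A1 - (A - {a}))" using a1 A(2) by blast
    moreover have "card (A1 - (A - {a})) = k - (k - 1)"
      using A1 c cAa by (simp add: card_Diff_subset)
    moreover have "card (A \<union> B) + card (A \<inter> B) = k + k"
      using card_Un_Int[of A B] c A B by simp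
    moreover have "card (A \<inter> B) > 0" using A B c by (auto simp: card_gt_0_iff)
    ultimately show ?thesis
      using card_Un_le[of "A \<union> B" "A1 - (A - {a})"] F(3) by simp
  qed
  ultimately have "A \<inter> A1 \<inter> B \<noteq> {}"
    using cluster_free_3D[OF F(2,1), of A A1 B] A A1 B by blast
  then show False using e a1 by blast
qed

text \<open>One witness per point is enough: if \<open>A - {a}\<close> is shared for some edge
  \<open>A\<close>, it meets every edge through \<open>a\<close>, so this single
  \<open>(k - 1)\<close>-set serves as \<open>N a\<close> for all of them. Without such an edge
  \<open>N a\<close> is empty.\<close>

lemma obtain_arcs:
  assumes F: "F \<subseteq> nsets V k" "cluster_free 3 k F" "2 \<le> k"
  obtains N where "\<And>a. N a \<subseteq> V" "\<And>a. a \<notin> N a" "\<And>a. card (N a) \<le> k - 1"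
    "\<And>A a. A \<in> F \<Longrightarrow> a \<in> A \<Longrightarrow> \<not> own F (A - {a}) \<Longrightarrow> A \<inter> N a \<noteq> {}"
proof -
  have "\<exists>X. X \<subseteq> V \<and> a \<notin> X \<and> card X \<le> k - 1 \<and>
      (\<forall>A\<in>F. a \<in> A \<longrightarrow> \<not> own F (A - {a}) \<longrightarrow> A \<inter> X \<noteq> {})" for a
  proof (cases "\<exists>A\<in>F. a \<in> A \<and> \<not> own F (A - {a})")
    case True
    then obtain A where A: "A \<in> F" "a \<in> A" "\<not> own F (A - {a})" by blast
    have "A - {a} \<subseteq> V" "card (A - {a}) = k - 1" using A F(1) by (auto simp: nsets_def)
    then show ?thesis
      using not_own_meets[OF F A] by (intro exI[of _ "A - {a}"]) auto
  qed (auto intro: exI[of _ "{}"])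
  then obtain N where "\<forall>a. N a \<subseteq> V \<and> a \<notin> N a \<and> card (N a) \<le> k - 1 \<and>
      (\<forall>A\<in>F. a \<in> A \<longrightarrow> \<not> own F (A - {a}) \<longrightarrow> A \<inter> N a \<noteq> {})"
    by metis
  then show thesis using that[of N] by simp
qed

lemma card_UN_bound:
  assumes "finite I" "card I \<le> p" "\<And>i. i \<in> I \<Longrightarrow> card (A i) \<le> (q::nat)"
  shows "card (\<Union>i\<in>I. A i) \<le> p * q"
proof -
  have "card (\<Union>i\<in>I. A i) \<le> (\<Sum>i\<in>I. card (A i))" by (rule card_UN_le[OF assms(1)])
  also have "\<dots> \<le> card I * q" using sum_bounded_above[of I "\<lambda>i. card (A i)" q] assms(3) by simp
  also have "\<dots> \<le> p * q" using assms(2) by simp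
  finally show ?thesis .
qed

text \<open>Reading \<open>b \<in> N a\<close> as an arc, such a set contains a path with two arcs or two disjoint arcs.\<close>

lemma card_all_have_successor:
  assumes V: "finite V" and k: "3 \<le> k"
    and N: "\<And>a. N a \<subseteq> V" "\<And>a. a \<notin> N a" "\<And>a. card (N a) \<le> s"
  shows "card {A \<in> nsets V k. \<forall>a\<in>A. A \<inter> N a \<noteq> {}} \<le> 2 * s ^ 2 * card V ^ (k - 2)"
proof -
  let ?n = "card V"
  define Q where "Q P = {A \<in> nsets V k. P \<subseteq> A}" for P
  have fN: "finite (N a)" for a using N(1) V finite_subset by blast
  \<comment> \<open>\<open>P1\<close> collects the sets with a path \<open>a\<close>,
    \<open>b\<close>, \<open>c\<close>, and \<open>P2\<close> those with disjoint arcs from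
    \<open>a\<close> to \<open>b\<close> and from \<open>c\<close> to \<open>d\<close>. Each head of
    an arc has at most \<open>s\<close> choices instead of \<open>?n\<close>, so two arcs save a
    factor of order \<open>?n ^ 2\<close>.\<close>
  define P1 where "P1 = (\<Union>a\<in>V. \<Union>b\<in>N a. \<Union>c\<in>N b - {a}. Q {a,b,c})"
  define P2 where "P2 = (\<Union>a\<in>V. \<Union>b\<in>N a. \<Union>c\<in>V - {a,b}. \<Union>d\<in>N c - {a,b}. Q {a,b,c,d})"
  have sub: "{A \<in> nsets V k. \<forall>a\<in>A. A \<inter> N a \<noteq> {}} \<subseteq> P1 \<union> P2"
  proof
    fix A assume "A \<in> {A \<in> nsets V k. \<forall>a\<in>A. A \<inter> N a \<noteq> {}}"
    then have A: "A \<in> nsets V k" and s: "\<And>a. a \<in> A \<Longrightarrow> \<exists>b. b \<in> A \<and> b \<in> N a" by auto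
    have fA: "finite A" "card A = k" "A \<subseteq> V" using A by (auto simp: nsets_def)
    have "A \<noteq> {}" using fA k by auto
    then obtain a where a: "a \<in> A" by blast
    obtain b where b: "b \<in> A" "b \<in> N a" using s a by blast
    have "\<not> A \<subseteq> {a,b}"
    proof
      assume "A \<subseteq> {a,b}"
      then have "card A \<le> card {a,b}" by (intro card_mono) auto
      also have "\<dots> \<le> 2" by (simp add: card_insert_if)
      finally show False using fA k by simp
    qed
    then obtain c where c: "c \<in> A" "c \<noteq> a" "c \<noteq> b" by blast
    \<comment> \<open>The successor \<open>d\<close> of a third point \<open>c\<close> decides: if
      it is \<open>a\<close> or \<open>b\<close>, a path arises, otherwise a second arc disjoint
      from the first.\<close>
    obtain d where d: "d \<in> A" "d \<in> N c" using s c by blast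
    obtain e where e: "e \<in> A" "e \<in> N b" using s b by blast
    have P1I: "A \<in> P1" if "u \<in> A" "v \<in> A" "w \<in> A" "v \<in> N u" "w \<in> N v" "w \<noteq> u" for u v w
      using that A fA by (auto simp: P1_def Q_def)
    show "A \<in> P1 \<union> P2"
    proof (cases "d = a \<or> d = b")
      case True
      then show ?thesis
      proof
        assume "d = a" then show ?thesis using P1I[of c a b] c d a b by auto
      next
        assume db: "d = b"
        show ?thesis
        proof (cases "e = a")
          case True then show ?thesis using P1I[of c b a] c d db a b e by auto
        next
          case False then show ?thesis using P1I[of a b e] a b e by auto
        qed
      qed
    next
      case False
      then have "A \<in> P2" using a b c d A fA by (auto simp: P2_def Q_def)
      then show ?thesis by blast
    qed
  qed
  have "card P1 \<le> ?n * (s * (s * ?n ^ (k - 3)))"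
    unfolding P1_def
  proof (intro card_UN_bound V fN finite_Diff)
    fix a b c assume "a \<in> V" "b \<in> N a" "c \<in> N b - {a}"
    then have "card {a,b,c} = 3" using N(2) by (metis Diff_iff card_3_iff insertI1)
    then show "card (Q {a,b,c}) \<le> ?n ^ (k - 3)"
      unfolding Q_def using card_nsets_superset_le[OF V, of "{a,b,c}" k] k by simp
  next
    fix a b show "card (N b - {a}) \<le> s" using card_mono[OF fN[of b] Diff_subset[of _ "{a}"]] N(3)[of b] by simp
  qed (use N in auto)
  also have "\<dots> = s ^ 2 * ?n ^ (k - 2)"
  proof -
    have "k - 2 = Suc (k - 3)" using k by simp
    then show ?thesis by (simp add: power2_eq_square)
  qed
  finally have c1: "card P1 \<le> s ^ 2 * ?n ^ (k - 2)" .
  have c2: "card P2 \<le> s ^ 2 * ?n ^ (k - 2)"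
  proof -
    \<comment> \<open>For \<open>k = 3\<close> four distinct points do not fit into a set, and
      \<open>?n ^ (k - 4)\<close> would read 1 under truncated subtraction, which is too
      large.\<close>
    let ?q = "if k = 3 then 0 else ?n ^ (k - 4)"
    have "card P2 \<le> ?n * (s * (?n * (s * ?q)))"
      unfolding P2_def
    proof (intro card_UN_bound V fN finite_Diff)
      fix a b c d assume h: "a \<in> V" "b \<in> N a" "c \<in> V - {a,b}" "d \<in> N c - {a,b}"
      have "a \<noteq> b" using h N(2) by metis
      moreover have "c \<noteq> d" using h N(2)[of d] by auto
      ultimately have c4: "card {a,b,c,d} = 4" using h by auto
      show "card (Q {a,b,c,d}) \<le> ?q"
      proof (cases "k = 3")
        case True
        have "card {a,b,c,d} \<le> k" if "A \<in> Q {a,b,c,d}" for A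
          using that card_mono[of A "{a,b,c,d}"] by (auto simp: Q_def nsets_def)
        then have "Q {a,b,c,d} = {}" using c4 True by fastforce
        then show ?thesis by simp
      next
        case False
        then show ?thesis
          unfolding Q_def using card_nsets_superset_le[OF V, of "{a,b,c,d}" k] k c4 by simp
      qed
    next
      fix a b c show "card (N c - {a, b}) \<le> s" using card_mono[OF fN[of c] Diff_subset[of _ "{a,b}"]] N(3)[of c] by simp
    next
      fix a b show "card (V - {a,b}) \<le> ?n" using V by (intro card_mono) auto
    qed (use N in auto)
    also have "\<dots> \<le> s ^ 2 * ?n ^ (k - 2)"
    proof (cases "k = 3")
      case False
      then have "k - 2 = Suc (Suc (k - 4))" using k by simp
      then show ?thesis using False by (simp add: power2_eq_square)
    qed simp
    finally show ?thesis .
  qed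
  have "finite (P1 \<union> P2)"
    unfolding P1_def P2_def Q_def using V fN by (auto simp: finite_imp_finite_nsets)
  then have "card {A \<in> nsets V k. \<forall>a\<in>A. A \<inter> N a \<noteq> {}} \<le> card (P1 \<union> P2)"
    using sub by (intro card_mono)
  also have "\<dots> \<le> card P1 + card P2" by (rule card_Un_le)
  finally show ?thesis using c1 c2 by simp
qed

section \<open>Rigid sets and their number\<close>

text \<open>For \<open>D\<close> with \<open>rigid F D x\<close> the point \<open>x\<close> is the centre of the star that \<open>D\<close> sees; it does not
  change when one point of \<open>D\<close> is exchanged.\<close>

definition rigid :: "'a set set \<Rightarrow> 'a set \<Rightarrow> 'a \<Rightarrow> bool" where
  "rigid F D x \<longleftrightarrow> x \<notin> D \<and> insert x D \<in> F \<and>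
     (\<forall>a\<in>insert x D. own F (insert x D - {a}) \<longleftrightarrow> a = x) \<and>
     (\<forall>p\<in>D. \<exists>A\<in>F. A \<inter> insert x D = {x, p})"

lemma rigid_own: "rigid F D x \<Longrightarrow> own F D"
  unfolding rigid_def by (metis Diff_insert_absorb insertI1)

text \<open>If the centres differ, so do the edges \<open>?A\<close> and \<open>?B\<close>. An edge
  \<open>C\<close> that meets \<open>?A\<close> exactly in \<open>{x, z}\<close> then completes a
  cluster: \<open>?B\<close> contains neither \<open>x\<close> nor \<open>z\<close>, and the union
  has at most \<open>(k + 2) + (k - 2)\<close> points.\<close>

lemma rigid_exchange:
  assumes k: "3 \<le> k" and F: "F \<subseteq> nsets V k" "cluster_free 3 k F"
    and z: "z \<notin> R" "z' \<notin> R" and r: "rigid F (insert z R) x" and r': "rigid F (insert z' R) x'"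
  shows "x = x'"
proof (rule ccontr)
  assume ne: "x \<noteq> x'"
  let ?A = "insert x (insert z R)" and ?B = "insert x' (insert z' R)"
  have AF: "?A \<in> F" and BF: "?B \<in> F" using r r' by (auto simp: rigid_def)
  have xn: "x \<notin> insert z R" "x' \<notin> insert z' R" using r r' by (auto simp: rigid_def)
  have c: "finite X" "card X = k" if "X \<in> F" for X using that F(1) by (auto simp: nsets_def)
  \<comment> \<open>\<open>x\<close> is the only point of \<open>?A\<close> whose deletion leaves an
    own set, and \<open>x'\<close> has this role in \<open>?B\<close>; one edge cannot serve
    both.\<close>
  have AB: "?A \<noteq> ?B"
  proof
    assume e: "?A = ?B"
    have "own F (?B - {x'})" using r' xn unfolding rigid_def by blast
    then have "own F (?A - {x'})" and "x' \<in> ?A" using e by auto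
    moreover have "\<forall>a\<in>?A. own F (?A - {a}) \<longleftrightarrow> a = x" using r unfolding rigid_def by (elim conjE)
    ultimately show False using ne by metis
  qed
  \<comment> \<open>\<open>R\<close> lies in both edges, so the uniqueness of the edge over
    \<open>insert z R\<close> keeps \<open>z\<close> out of \<open>?B\<close>.\<close>
  have "\<not> insert z R \<subseteq> ?B"
    using own_unique[OF rigid_own[OF r] AF _ BF] AB by blast
  then have zB: "z \<notin> ?B" by blast
  have "\<not> insert z' R \<subseteq> ?A"
    using own_unique[OF rigid_own[OF r'] BF _ AF] AB by blast
  then have zA: "z' \<notin> ?A" by blast
  have finR: "finite R" and cR: "card R = k - 2"
    using c[OF AF] xn z by (auto simp: card_insert_if)
  then have "R \<noteq> {}" using k by auto
  obtain C where C: "C \<in> F" "C \<inter> ?A = {x, z}" using r unfolding rigid_def by blast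
  obtain y where "y \<in> R" using \<open>R \<noteq> {}\<close> by blast
  then have "y \<in> ?A" "y \<noteq> x" "y \<noteq> z" using xn z by auto
  then have "C \<noteq> ?A" using C(2) by blast
  moreover have "C \<noteq> ?B" using C zB by blast
  moreover have "card (?A \<union> ?B \<union> C) \<le> 2 * k"
  proof -
    have "C - ?A = C - {x, z}" "{x,z} \<subseteq> C" using C(2) by auto
    then have "card (C - ?A) = k - 2"
      using c[OF C(1)] xn by (simp add: card_Diff_subset)
    moreover have "?A \<union> ?B \<union> C = (?A \<union> {x', z'}) \<union> (C - ?A)" by blast
    moreover have "card (?A \<union> {x', z'}) \<le> k + 2"
      using card_Un_le[of ?A "{x',z'}"] c[OF AF] by (simp add: card_insert_if split: if_splits)
    ultimately show ?thesis using card_Un_le[of "?A \<union> {x', z'}" "C - ?A"] k by simp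
  qed
  ultimately have "?A \<inter> ?B \<inter> C \<noteq> {}"
    using cluster_free_3D[OF F(2,1) AF BF C(1) AB] by blast
  moreover have "?A \<inter> ?B \<inter> C \<subseteq> {x, z} \<inter> ?B" using C(2) by blast
  ultimately show False using zB xn ne zA z by blast
qed

text \<open>An own \<open>(k - 1)\<close>-set determines its edge and hence the deleted point, so no
  \<open>(k - 1)\<close>-set is counted twice.\<close>

lemma sum_own_points_le:
  assumes "finite V" "F \<subseteq> nsets V k"
  shows "(\<Sum>A\<in>F. card {a \<in> A. own F (A - {a})}) \<le> card V choose (k - 1)"
proof -
  let ?S = "SIGMA A:F. {a \<in> A. own F (A - {a})}"
  have finF: "finite F" using assms finite_imp_finite_nsets finite_subset by blast
  have "inj_on (\<lambda>(A,a). A - {a}) ?S"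
  proof (rule inj_onI, clarsimp)
    fix A a B b
    assume h: "A \<in> F" "a \<in> A" "own F (B - {b})" "B \<in> F" "b \<in> B" "A - {a} = B - {b}"
    have "A = B" by (rule own_unique[OF h(3)]) (use h in blast)+
    then show "A = B \<and> a = b" using h by blast
  qed
  moreover have "(\<lambda>(A,a). A - {a}) ` ?S \<subseteq> nsets V (k - 1)"
    using assms(2) by (auto simp: nsets_def)
  ultimately have "card ?S \<le> card (nsets V (k - 1))"
    using assms(1) by (intro card_inj_on_le) (simp_all add: finite_imp_finite_nsets)
  moreover have "card ?S = (\<Sum>A\<in>F. card {a \<in> A. own F (A - {a})})"
    using finF assms(2) by (subst card_SigmaI) (auto simp: nsets_def)
  ultimately show ?thesis by (simp add: card_nsets)
qed

text \<open>An own set determines its edge. This turns counts of \<open>(k - 1)\<close>-sets into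
  counts of edges and so saves one power of the size of the ground set.\<close>

lemma card_own_image_le:
  assumes "finite \<D>" "\<And>A. A \<in> E \<Longrightarrow> A \<in> F \<and> (\<exists>D\<in>\<D>. own F D \<and> D \<subseteq> A)"
  shows "card E \<le> card \<D>"
proof -
  have "E \<subseteq> (\<lambda>D. THE A. A \<in> F \<and> D \<subseteq> A) ` \<D>"
  proof
    fix A assume "A \<in> E"
    then obtain D where D: "A \<in> F" "D \<in> \<D>" "own F D" "D \<subseteq> A" using assms(2) by blast
    have "(THE A. A \<in> F \<and> D \<subseteq> A) = A"
      using D own_unique[OF D(3)] by (intro the_equality) auto
    then show "A \<in> (\<lambda>D. THE A. A \<in> F \<and> D \<subseteq> A) ` \<D>" using D(2) by blast
  qed
  then show ?thesis using assms(1) by (meson surj_card_le)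
qed

text \<open>The numbers of points whose deletion leaves an own set add up to at most
  \<open>card V choose (k - 1)\<close> over all edges, so not too many edges can have two or more of
  them; edges with none are few. If \<open>F\<close> is large, most edges have exactly one such
  point, and all but \<open>O(n^(k-2))\<close> of these arise from a rigid set.\<close>

lemma many_rigid:
  assumes V: "finite V" and k: "3 \<le> k" and F: "F \<subseteq> nsets V k" "cluster_free 3 k F"
  shows "card V choose (k - 1) \<le> card {D \<in> nsets V (k - 1). \<exists>x. rigid F D x}
    + 2 * ((card V choose (k - 1)) - card F) + 6 * k ^ 2 * card V ^ (k - 2)"
proof -
  let ?n = "card V" and ?R = "{D \<in> nsets V (k - 1). \<exists>x. rigid F D x}"
  have k2: "2 \<le> k" using k by simp
  obtain N where N: "\<And>a. N a \<subseteq> V" "\<And>a. a \<notin> N a" "\<And>a. card (N a) \<le> k - 1"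
    and NF: "\<And>A a. A \<in> F \<Longrightarrow> a \<in> A \<Longrightarrow> \<not> own F (A - {a}) \<Longrightarrow> A \<inter> N a \<noteq> {}"
    using obtain_arcs[OF F k2] by metis
  have fN: "finite (N a)" for a using N(1) V finite_subset by blast
  have cN: "card (N a) \<le> k" for a using N(3)[of a] by simp
  have finF: "finite F" using V F(1) finite_imp_finite_nsets finite_subset by blast
  have c: "finite X" "card X = k" "X \<subseteq> V" if "X \<in> F" for X using that F(1) by (auto simp: nsets_def)
  have fin1: "finite (nsets V j)" for j using V by (simp add: finite_imp_finite_nsets)
  \<comment> \<open>\<open>Ow A\<close> holds the points whose deletion leaves an own set.
    \<open>E0\<close> consists of the edges over rigid sets; for the edges in \<open>E1\<close> an
    own set already contains an arc, which is rare.\<close>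
  define Ow where "Ow A = {a \<in> A. own F (A - {a})}" for A
  define Bad where "Bad = {A \<in> F. Ow A = {}}"
  define F1 where "F1 = {A \<in> F. card (Ow A) = 1}"
  define E0 where "E0 = {A \<in> F. \<exists>x\<in>A. rigid F (A - {x}) x}"
  define E1 where "E1 = {A \<in> F. \<exists>x\<in>A. own F (A - {x}) \<and> (\<exists>p\<in>A - {x}. (A - {x}) \<inter> N p \<noteq> {})}"
  have cBad: "card Bad \<le> 2 * k ^ 2 * ?n ^ (k - 2)"
  proof -
    have "Bad \<subseteq> {A \<in> nsets V k. \<forall>a\<in>A. A \<inter> N a \<noteq> {}}"
      using NF F(1) by (auto simp: Bad_def Ow_def)
    then have "card Bad \<le> card {A \<in> nsets V k. \<forall>a\<in>A. A \<inter> N a \<noteq> {}}"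
      using fin1 by (intro card_mono) auto
    also have "\<dots> \<le> 2 * k ^ 2 * ?n ^ (k - 2)"
      by (rule card_all_have_successor[OF V k N(1,2) cN])
    finally show ?thesis .
  qed
  \<comment> \<open>Every edge should contribute 2: an edge with one own point falls short by 1, an
    edge with none by 2.\<close>
  have twoF: "2 * card F \<le> (?n choose (k - 1)) + card F1 + 2 * card Bad"
  proof -
    have "2 * card F = (\<Sum>A\<in>F. 2)" by simp
    also have "\<dots> \<le> (\<Sum>A\<in>F. card (Ow A) + (if A \<in> F1 then 1 else 0) + (if A \<in> Bad then 2 else 0))"
    proof (rule sum_mono)
      fix A assume A: "A \<in> F"
      have "finite (Ow A)" using c[OF A] by (simp add: Ow_def)
      then show "2 \<le> card (Ow A) + (if A \<in> F1 then 1 else 0) + (if A \<in> Bad then 2 else 0)"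
        using A by (cases "card (Ow A)" rule: nat.exhaust[case_names zero suc]; cases "card (Ow A) = 1")
          (auto simp: F1_def Bad_def)
    qed
    also have "\<dots> = (\<Sum>A\<in>F. card (Ow A)) + card F1 + 2 * card Bad"
    proof -
      have "F \<inter> F1 = F1" "F \<inter> Bad = Bad" by (auto simp: F1_def Bad_def)
      then show ?thesis using finF by (simp add: sum.distrib sum.If_cases)
    qed
    also have "(\<Sum>A\<in>F. card (Ow A)) \<le> ?n choose (k - 1)"
      unfolding Ow_def by (rule sum_own_points_le[OF V F(1)])
    finally show ?thesis by simp
  qed
  have c0: "card E0 \<le> card ?R"
  proof (rule card_own_image_le[where F = F])
    fix A assume "A \<in> E0"
    then obtain x where x: "A \<in> F" "x \<in> A" "rigid F (A - {x}) x" by (auto simp: E0_def)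
    have "A - {x} \<in> nsets V (k - 1)" using c[OF x(1)] x(2) by (auto simp: nsets_def)
    then show "A \<in> F \<and> (\<exists>D\<in>?R. own F D \<and> D \<subseteq> A)"
      using x rigid_own[OF x(3)] by (intro conjI bexI[of _ "A - {x}"]) auto
  qed (use fin1 in auto)
  have c1: "card E1 \<le> k ^ 2 * ?n ^ (k - 2)"
  proof -
    let ?D = "\<Union>p\<in>V. \<Union>q\<in>N p. {D \<in> nsets V (k - 1). {p,q} \<subseteq> D}"
    have "card E1 \<le> card ?D"
    proof (rule card_own_image_le[where F = F])
      fix A assume "A \<in> E1"
      then obtain x p q where x: "A \<in> F" "x \<in> A" "own F (A - {x})" "p \<in> A - {x}" "q \<in> A - {x}" "q \<in> N p"
        by (auto simp: E1_def)
      have "A - {x} \<in> nsets V (k - 1)" using c[OF x(1)] x(2) by (auto simp: nsets_def)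
      then have "A - {x} \<in> ?D" using x c[OF x(1)] by blast
      then show "A \<in> F \<and> (\<exists>D\<in>?D. own F D \<and> D \<subseteq> A)" using x by blast
    qed (use V fN fin1 in auto)
    also have "\<dots> \<le> ?n * (k * ?n ^ (k - 3))"
    proof (intro card_UN_bound V fN cN)
      fix p q assume "p \<in> V" "q \<in> N p"
      then have "card {p,q} = 2" using N(2)[of p] by (auto simp: card_insert_if)
      then show "card {D \<in> nsets V (k - 1). {p,q} \<subseteq> D} \<le> ?n ^ (k - 3)"
        using card_nsets_superset_le[OF V, of "{p,q}" "k - 1"] k by (simp add: numeral_3_eq_3)
    qed simp
    also have "\<dots> = k * ?n ^ (k - 2)" using k by (simp add: numeral_3_eq_3 Suc_diff_Suc numeral_2_eq_2 flip: power_Suc)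
    also have "\<dots> \<le> k ^ 2 * ?n ^ (k - 2)" by (simp add: power2_eq_square)
    finally show ?thesis .
  qed
  have c2: "card (F1 - E0 - E1) \<le> k ^ 2 * ?n ^ (k - 2)"
  proof -
    \<comment> \<open>\<open>flat p x A\<close> says that no edge cuts exactly \<open>{x, p}\<close>
      out of \<open>A\<close>. For a fixed pair, all flat edges must therefore meet one chosen flat
      edge in a further point, so \<open>N2 p x\<close> acts as a second successor set of bounded
      size.\<close>
    define flat where "flat p x A \<longleftrightarrow> A \<in> F \<and> x \<in> A \<and> p \<in> A \<and> \<not> (\<exists>C\<in>F. C \<inter> A = {x, p})" for p x A
    define N2 where "N2 p x = (if \<exists>A. flat p x A then (SOME A. flat p x A) - {x, p} else {})" for p x
    have N2: "finite (N2 p x)" "card (N2 p x) \<le> k" "x \<notin> N2 p x" "p \<notin> N2 p x"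
      "flat p x A \<Longrightarrow> A \<inter> N2 p x \<noteq> {}" for p x A
    proof -
      have "finite (N2 p x) \<and> card (N2 p x) \<le> k \<and> x \<notin> N2 p x \<and> p \<notin> N2 p x \<and>
        (flat p x A \<longrightarrow> A \<inter> N2 p x \<noteq> {})"
      proof (cases "\<exists>A. flat p x A")
        case True
        define B where "B = (SOME A. flat p x A)"
        have B: "flat p x B" unfolding B_def using True by (rule someI_ex)
        have e: "N2 p x = B - {x, p}" using True by (simp add: N2_def B_def)
        have fB: "finite B" "card B = k" using B c by (auto simp: flat_def)
        have "card (B - {x,p}) \<le> k" using card_mono[OF fB(1) Diff_subset] fB(2) by simp
        moreover have "A \<inter> (B - {x, p}) \<noteq> {}" if "flat p x A"
        proof
          assume "A \<inter> (B - {x, p}) = {}"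
          then have "A \<inter> B = {x, p}" using B that by (auto simp: flat_def)
          then show False using B that by (auto simp: flat_def)
        qed
        ultimately show ?thesis using fB by (auto simp: e)
      qed (simp add: N2_def)
      then show "finite (N2 p x)" "card (N2 p x) \<le> k" "x \<notin> N2 p x" "p \<notin> N2 p x"
        "flat p x A \<Longrightarrow> A \<inter> N2 p x \<noteq> {}" by auto
    qed
    let ?U = "\<Union>p\<in>V. \<Union>x\<in>N p. \<Union>q\<in>N2 p x. {A \<in> nsets V k. {p,x,q} \<subseteq> A}"
    have "F1 - E0 - E1 \<subseteq> ?U"
    proof
      fix A assume A: "A \<in> F1 - E0 - E1"
      then have AF: "A \<in> F" by (simp add: F1_def)
      obtain x where x: "Ow A = {x}" using A by (auto simp: F1_def card_1_singleton_iff)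
      have xA: "x \<in> A" "own F (A - {x})" using x by (auto simp: Ow_def)
      have xo: "own F (A - {a}) \<longleftrightarrow> a = x" if "a \<in> A" for a using x that by (auto simp: Ow_def)
      have iA: "insert x (A - {x}) = A" using xA by blast
      have "\<not> rigid F (A - {x}) x" using A AF xA by (auto simp: E0_def)
      then obtain p where p: "p \<in> A" "p \<noteq> x" "\<not> (\<exists>C\<in>F. C \<inter> A = {x, p})"
        unfolding rigid_def iA using AF xo by auto
      \<comment> \<open>\<open>A\<close> meets \<open>N p\<close> because deleting \<open>p\<close>
        leaves no own set, but the arc cannot end in \<open>A - {x}\<close>; so it ends in
        \<open>x\<close>.\<close>
      have "(A - {x}) \<inter> N p = {}" using A AF xA p by (auto simp: E1_def)
      moreover have "A \<inter> N p \<noteq> {}" using NF[OF AF p(1)] xo[OF p(1)] p(2) by simp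
      ultimately have xN: "x \<in> N p" by blast
      have "flat p x A" using AF xA p by (simp add: flat_def)
      then obtain q where q: "q \<in> A" "q \<in> N2 p x" using N2(5) by blast
      have "A \<in> nsets V k" "p \<in> V" using AF F(1) c[OF AF] p by auto
      then show "A \<in> ?U" using xN q p xA by blast
    qed
    then have "card (F1 - E0 - E1) \<le> card ?U"
      using V fN N2(1) fin1 by (intro card_mono) auto
    also have "\<dots> \<le> ?n * (k * (k * ?n ^ (k - 3)))"
    proof (intro card_UN_bound V fN cN N2)
      fix p x q assume "p \<in> V" "x \<in> N p" "q \<in> N2 p x"
      then have "card {p,x,q} = 3" using N(2)[of p] N2(3)[of x p] N2(4)[of p x] by (auto simp: card_insert_if)
      then show "card {A \<in> nsets V k. {p,x,q} \<subseteq> A} \<le> ?n ^ (k - 3)"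
        using card_nsets_superset_le[OF V, of "{p,x,q}" k] k by simp
    qed simp
    also have "\<dots> = k ^ 2 * ?n ^ (k - 2)"
    proof -
      have "k - 2 = Suc (k - 3)" using k by simp
      then show ?thesis by (simp add: power2_eq_square)
    qed
    finally show ?thesis .
  qed
  have "card F1 \<le> card (F1 - E0 - E1) + card (E0 \<union> E1)"
  proof -
    have fin2: "finite (F1 - E0 - E1)" "finite (E0 \<union> E1)" using finF by (auto simp: F1_def E0_def E1_def)
    have "card F1 \<le> card ((F1 - E0 - E1) \<union> (E0 \<union> E1))"
      using fin2 by (intro card_mono) auto
    then show ?thesis using card_Un_le le_trans by blast
  qed
  also have "\<dots> \<le> card (F1 - E0 - E1) + (card E0 + card E1)" by (intro add_left_mono card_Un_le)
  finally have "card F1 \<le> card ?R + 2 * (k ^ 2 * ?n ^ (k - 2))" using c0 c1 c2 by linarith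
  then show ?thesis using twoF cBad by linarith
qed

section \<open>From rigid sets to a common centre\<close>

text \<open>Each rigid \<open>(k - 1)\<close>-set is labelled by its centre, and
  \<open>rigid_exchange\<close> gives the invariance that \<open>johnson_label\<close> asks for. The
  exceptional sets are the non-rigid ones, whose number \<open>many_rigid\<close> bounds.\<close>

lemma star_center:
  assumes k: "3 \<le> k"
  shows "\<exists>K::nat. \<forall>(V::'a set) F. finite V \<and> 2 * k + 2 \<le> card V \<and> F \<subseteq> nsets V k \<and> cluster_free 3 k F
    \<longrightarrow> (\<exists>x. card {D \<in> nsets V (k - 1). x \<in> D \<or> insert x D \<notin> F}
        \<le> K * (((card V choose (k - 1)) - card F) + card V ^ (k - 2)))"
proof -
  obtain K :: nat where K: "\<forall>(V::'a set) NN (l::'a set \<Rightarrow> 'a).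
     finite V \<and> 2 * (k - 1) + 4 \<le> card V \<and> NN \<subseteq> nsets V (k - 1) \<and>
     (\<forall>R z z'. z \<notin> R \<and> z' \<notin> R \<and> insert z R \<in> nsets V (k - 1) - NN \<and> insert z' R \<in> nsets V (k - 1) - NN
        \<longrightarrow> l (insert z R) = l (insert z' R))
     \<longrightarrow> (\<exists>x. card {D \<in> nsets V (k - 1) - NN. l D \<noteq> x} \<le> K * card NN)"
    using johnson_label[of "k - 1"] by (rule exE)
  show ?thesis
  proof (intro exI[of _ "(1 + K) * (6 * k ^ 2)"] allI impI, elim conjE)
    fix V :: "'a set" and F
    assume V: "finite V" "2 * k + 2 \<le> card V" and F: "F \<subseteq> nsets V k" "cluster_free 3 k F"
    let ?N = "nsets V (k - 1)" and ?n = "card V"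
    define NN where "NN = {D \<in> ?N. \<not> (\<exists>x. rigid F D x)}"
    define l where "l D = (SOME x. rigid F D x)" for D
    have l: "rigid F D (l D)" if "D \<in> ?N - NN" for D
    proof -
      have "\<exists>x. rigid F D x" using that by (auto simp: NN_def)
      then show ?thesis unfolding l_def by (rule someI_ex)
    qed
    have "\<exists>x. card {D \<in> ?N - NN. l D \<noteq> x} \<le> K * card NN"
    proof (rule K[rule_format], intro conjI allI impI, goal_cases)
      case (4 R z z')
      then show ?case using rigid_exchange[OF k F, of z R z'] l by blast
    qed (use V k in \<open>auto simp: NN_def\<close>)
    then obtain x where x: "card {D \<in> ?N - NN. l D \<noteq> x} \<le> K * card NN" by blast
    have finN: "finite ?N" using V by (simp add: finite_imp_finite_nsets)
    have "{D \<in> ?N. x \<in> D \<or> insert x D \<notin> F} \<subseteq> NN \<union> {D \<in> ?N - NN. l D \<noteq> x}"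
      using l by (auto simp: rigid_def)
    then have "card {D \<in> ?N. x \<in> D \<or> insert x D \<notin> F} \<le> card (NN \<union> {D \<in> ?N - NN. l D \<noteq> x})"
      using finN by (intro card_mono) (auto simp: NN_def)
    also have "\<dots> \<le> card NN + K * card NN" using card_Un_le x by (meson add_left_mono le_trans)
    also have "\<dots> = (1 + K) * card NN" by simp
    also have "card NN \<le> 6 * k ^ 2 * (((?n choose (k - 1)) - card F) + ?n ^ (k - 2))"
    proof -
      have "?N - NN = {D \<in> ?N. \<exists>x. rigid F D x}" "NN \<subseteq> ?N" by (auto simp: NN_def)
      then have "card {D \<in> ?N. \<exists>x. rigid F D x} = (?n choose (k - 1)) - card NN"
        by (metis card_Diff_subset card_nsets finN finite_subset)
      moreover have "card NN \<le> ?n choose (k - 1)"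
        using card_mono[OF finN \<open>NN \<subseteq> ?N\<close>] by (simp add: card_nsets)
      ultimately have "card NN \<le> 2 * ((?n choose (k - 1)) - card F) + 6 * k ^ 2 * ?n ^ (k - 2)"
        using many_rigid[OF V(1) k F] by linarith
      also have "\<dots> \<le> 6 * k ^ 2 * ((?n choose (k - 1)) - card F) + 6 * k ^ 2 * ?n ^ (k - 2)"
      proof -
        have "1 \<le> k ^ 2" using k by simp
        then have "2 \<le> 6 * k ^ 2" by linarith
        then show ?thesis by (intro add_right_mono mult_right_mono) auto
      qed
      finally show ?thesis by (simp add: distrib_left)
    qed
    finally have "card {D \<in> ?N. x \<in> D \<or> insert x D \<notin> F}
        \<le> (1 + K) * (6 * k ^ 2) * (((?n choose (k - 1)) - card F) + ?n ^ (k - 2))"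
      by (simp only: mult.assoc mult_le_mono2)
    then show "\<exists>x. card {D \<in> ?N. x \<in> D \<or> insert x D \<notin> F}
        \<le> (1 + K) * (6 * k ^ 2) * (((?n choose (k - 1)) - card F) + ?n ^ (k - 2))"
      by (rule exI)
  qed
qed

section \<open>Traces on the blocks\<close>

text \<open>The trace condition that cluster-freeness imposes on the sets containing a common
  \<open>(k - 1 - j)\<close>-set outside the blocks.\<close>

definition spread :: "'a set set \<Rightarrow> nat \<Rightarrow> 'a set set \<Rightarrow> bool" where
  "spread M j H \<longleftrightarrow> H \<subseteq> nsets (\<Union>M) j \<and> (\<forall>T\<in>H. \<forall>B\<in>M. \<not> T \<subseteq> B) \<and>
     (\<forall>T\<in>H. \<forall>T'\<in>H. T \<noteq> T' \<longrightarrow> (\<forall>B\<in>M. T \<inter> T' \<inter> B \<noteq> {} \<or> j < card (T \<union> T' - B)))"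

lemma spreadD:
  assumes "spread M j H" "T \<in> H" "T' \<in> H" "T \<noteq> T'" "B \<in> M" "T \<inter> T' \<inter> B = {}"
    and "T \<union> T' - B \<subseteq> X" "finite X" "card X \<le> j"
  shows False
proof -
  have "card (T \<union> T' - B) \<le> j" using assms(7-9) card_mono le_trans by blast
  then show False using assms(1-6) unfolding spread_def by fastforce
qed

lemma disjnt_blocks:
  assumes "pairwise disjnt M" "B \<in> M" "C \<in> M" "u \<in> B" "u \<in> C"
  shows "B = C"
  using assms by (auto simp: pairwise_def disjnt_def)

text \<open>Every pair in \<open>H\<close> meets two blocks, and every block meets at most one pair.
  For two pairs meeting a block \<open>B\<close>, the condition fails at \<open>B\<close> itself if
  their points in \<open>B\<close> differ, and at the block of another endpoint if they share the
  point in \<open>B\<close>.\<close>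

lemma spread_2_card:
  assumes M: "finite M" "pairwise disjnt M" "\<And>B. B \<in> M \<Longrightarrow> finite B" and H: "spread M 2 H"
  shows "2 * card H \<le> card M"
proof -
  have HU: "H \<subseteq> nsets (\<Union>M) 2" and nB: "\<And>T B. T \<in> H \<Longrightarrow> B \<in> M \<Longrightarrow> \<not> T \<subseteq> B"
    using H by (auto simp: spread_def)
  have "finite (\<Union>M)" using M by auto
  then have finH: "finite H" using HU finite_imp_finite_nsets finite_subset by blast
  have shape: "\<exists>v. T = {u,v} \<and> u \<noteq> v \<and> v \<notin> B \<and> (\<exists>C\<in>M. v \<in> C \<and> u \<notin> C)"
    if t: "T \<in> H" "B \<in> M" "u \<in> T" "u \<in> B" for T B u
  proof -
    have "card T = 2" "T \<subseteq> \<Union>M" using HU t by (auto simp: nsets_def)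
    then obtain v where v: "T = {u,v}" "u \<noteq> v" using t(3) by (auto simp: card_2_iff)
    have vB: "v \<notin> B" using nB[OF t(1,2)] v t(4) by auto
    obtain C where "C \<in> M" "v \<in> C" using \<open>T \<subseteq> \<Union>M\<close> v by auto
    moreover have "u \<notin> C" using disjnt_blocks[OF M(2) t(2) \<open>C \<in> M\<close> t(4)] vB \<open>v \<in> C\<close> by blast
    ultimately show ?thesis using v vB by blast
  qed
  have two: "2 \<le> card {B \<in> M. T \<inter> B \<noteq> {}}" if T: "T \<in> H" for T
  proof -
    have "card T = 2" "T \<subseteq> \<Union>M" using HU T by (auto simp: nsets_def)
    then obtain u where "u \<in> T" by fastforce
    then obtain B where u: "u \<in> T" "u \<in> B" "B \<in> M" using \<open>T \<subseteq> \<Union>M\<close> by blast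
    obtain v C where v: "T = {u,v}" "v \<notin> B" "C \<in> M" "v \<in> C" using shape[OF T u(3,1,2)] by blast
    have "{B,C} \<subseteq> {B \<in> M. T \<inter> B \<noteq> {}}" "B \<noteq> C" using u v by auto
    then show ?thesis using M(1) card_mono[of "{B \<in> M. T \<inter> B \<noteq> {}}" "{B,C}"] by simp
  qed
  have one: "card {T \<in> H. T \<inter> B \<noteq> {}} \<le> 1" if B: "B \<in> M" for B
  proof -
    have "T = T'" if T: "T \<in> H" "T \<inter> B \<noteq> {}" and T': "T' \<in> H" "T' \<inter> B \<noteq> {}" for T T'
    proof (rule ccontr)
      assume ne: "T \<noteq> T'"
      obtain u u' where u: "u \<in> T" "u \<in> B" "u' \<in> T'" "u' \<in> B" using T T' by blast
      obtain v C where v: "T = {u,v}" "v \<notin> B" "C \<in> M" "v \<in> C" "u \<notin> C" using shape[OF T(1) B u(1,2)] by blast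
      obtain v' where v': "T' = {u',v'}" "v' \<notin> B" using shape[OF T'(1) B u(3,4)] by blast
      show False
      proof (cases "u = u'")
        case True
        then have "v \<noteq> v'" using ne v v' by auto
        then show False using True v v' u
          by (intro spreadD[OF H T(1) T'(1) ne v(3), of "{u,v'}"]) (auto simp: card_insert_if)
      next
        case False
        then show False using v v' u
          by (intro spreadD[OF H T(1) T'(1) ne B, of "{v,v'}"]) (auto simp: card_insert_if)
      qed
    qed
    then show ?thesis using finH by (auto simp: card_le_Suc0_iff_eq)
  qed
  have "2 * card H = (\<Sum>T\<in>H. 2)" by simp
  also have "\<dots> \<le> (\<Sum>T\<in>H. card {B \<in> M. T \<inter> B \<noteq> {}})" by (intro sum_mono two)
  also have "\<dots> = (\<Sum>B\<in>M. card {T \<in> H. T \<inter> B \<noteq> {}})"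
    by (rule sum_multicount_gen[OF finH M(1)]) simp
  also have "\<dots> \<le> (\<Sum>B\<in>M. 1)" by (intro sum_mono one)
  finally show ?thesis by simp
qed

text \<open>Pairwise intersecting pairs form a star or lie in a triangle; a triangle respects the
  bound as soon as \<open>card B\<close> is at least 4.\<close>

lemma card_intersecting_pairs:
  assumes B: "finite B" "4 \<le> card B" and P: "P \<subseteq> nsets B 2"
    and int: "\<And>X Y. X \<in> P \<Longrightarrow> Y \<in> P \<Longrightarrow> X \<inter> Y \<noteq> {}"
  shows "card P \<le> card B - 1"
proof (cases "\<exists>u. \<forall>X\<in>P. u \<in> X")
  case True
  then obtain u where u: "\<And>X. X \<in> P \<Longrightarrow> u \<in> X" by blast
  show ?thesis
  proof (cases "P = {}")
    case False
    then have uB: "u \<in> B" using u P by (fastforce simp: nsets_def)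
    have "P \<subseteq> (\<lambda>v. {u,v}) ` (B - {u})"
    proof
      fix X assume X: "X \<in> P"
      then have "card X = 2" "X \<subseteq> B" using P by (auto simp: nsets_def)
      then obtain v where "X = {u,v}" "v \<noteq> u" "v \<in> B" using u[OF X] by (auto simp: card_2_iff)
      then show "X \<in> (\<lambda>v. {u,v}) ` (B - {u})" by blast
    qed
    then have "card P \<le> card (B - {u})" using B by (meson finite_Diff surj_card_le)
    then show ?thesis using B uB by simp
  qed simp
next
  case False
  have c2: "card X = 2" if "X \<in> P" for X using that P by (auto simp: nsets_def)
  obtain X where X: "X \<in> P" using False by blast
  obtain a b where ab: "X = {a,b}" "a \<noteq> b" using c2[OF X] by (auto simp: card_2_iff)
  obtain Y where Y: "Y \<in> P" "a \<notin> Y" using False by blast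
  have "b \<in> Y" using int[OF X Y(1)] Y ab by blast
  then obtain c where c: "Y = {b,c}" "b \<noteq> c" using c2[OF Y(1)] by (auto simp: card_2_iff)
  obtain Z where Z: "Z \<in> P" "b \<notin> Z" using False by blast
  have "a \<in> Z" "c \<in> Z" using int[OF X Z(1)] int[OF Y(1) Z(1)] Z ab c by blast+
  have abc: "a \<noteq> c" using Y c by blast
  have "P \<subseteq> nsets {a,b,c} 2"
  proof
    fix S assume S: "S \<in> P"
    obtain p q where pq: "S = {p,q}" "p \<noteq> q" using c2[OF S] by (auto simp: card_2_iff)
    have "Z = {a,c}" using c2[OF Z(1)] \<open>a \<in> Z\<close> \<open>c \<in> Z\<close> abc by (auto simp: card_2_iff)
    then have "S \<inter> {a,b} \<noteq> {}" "S \<inter> {b,c} \<noteq> {}" "S \<inter> {a,c} \<noteq> {}"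
      using int[OF S X] int[OF S Y(1)] int[OF S Z(1)] ab c by auto
    then have "S \<subseteq> {a,b,c}" using pq ab c abc by blast
    then show "S \<in> nsets {a,b,c} 2" using c2[OF S] by (auto simp: nsets_def intro: finite_subset)
  qed
  then have "card P \<le> card (nsets {a,b,c} 2)" by (intro card_mono) (auto simp: finite_imp_finite_nsets)
  also have "\<dots> = 3" using abc ab c by (simp add: card_nsets numeral_3_eq_3 numeral_2_eq_2)
  finally show ?thesis using B by simp
qed

lemma card_3_third:
  assumes "card T = 3" "u \<in> T" "v \<in> T" "u \<noteq> v"
  obtains w where "T = {u,v,w}" "w \<noteq> u" "w \<noteq> v"
proof -
  have "card (T - {u,v}) = 1" using assms by (simp add: card_Diff_subset)
  then obtain w where "T - {u,v} = {w}" by (auto simp: card_1_singleton_iff)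
  then show thesis using assms by (intro that[of w]) blast+
qed

text \<open>For a block \<open>B\<close>, the triples with two points in \<open>B\<close> cut out
  distinct, pairwise intersecting pairs, at most \<open>k - 1\<close> in number. A transversal
  triple meets three pairs of blocks, while a pair of blocks is met by at most \<open>k\<close>
  transversals, since the point in one of the two blocks determines the triple.\<close>

lemma spread_3_card:
  assumes M: "finite M" "pairwise disjnt M" "\<And>B. B \<in> M \<Longrightarrow> finite B \<and> card B = k"
    and k: "4 \<le> k" and H: "spread M 3 H"
  shows "real (card H) \<le> real k / 3 * real (card M choose 2) + (real k - 1) * real (card M)"
proof -
  have HU: "H \<subseteq> nsets (\<Union>M) 3" and nB: "\<And>T B. T \<in> H \<Longrightarrow> B \<in> M \<Longrightarrow> \<not> T \<subseteq> B"
    using H by (auto simp: spread_def)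
  have finU: "finite (\<Union>M)" using M by auto
  have finH: "finite H" using HU finU finite_imp_finite_nsets finite_subset by blast
  have T: "card T = 3" "finite T" "T \<subseteq> \<Union>M" if "T \<in> H" for T using HU that by (auto simp: nsets_def)
  define Hd where "Hd B = {T \<in> H. card (T \<inter> B) = 2}" for B
  define Ht where "Ht = {T \<in> H. \<forall>B\<in>M. card (T \<inter> B) \<le> 1}"
  have cover: "H \<subseteq> Ht \<union> (\<Union>B\<in>M. Hd B)"
  proof
    fix X assume X: "X \<in> H"
    have "card (X \<inter> B) \<noteq> 3" if "B \<in> M" for B
    proof
      assume "card (X \<inter> B) = 3"
      then have "X \<inter> B = X" using T[OF X] by (intro card_subset_eq) auto
      then show False using nB[OF X that] by blast
    qed
    moreover have "card (X \<inter> B) \<le> 3" for B using T[OF X] card_mono[of X "X \<inter> B"] by simp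
    ultimately have "card (X \<inter> B) \<le> 1 \<or> card (X \<inter> B) = 2" if "B \<in> M" for B
      using that by (metis le_Suc_eq One_nat_def numeral_2_eq_2 numeral_3_eq_3)
    then show "X \<in> Ht \<union> (\<Union>B\<in>M. Hd B)" using X by (auto simp: Ht_def Hd_def)
  qed
  have cd: "card (Hd B) \<le> k - 1" if B: "B \<in> M" for B
  proof -
    have sh: "\<exists>v. X \<subseteq> insert v (X \<inter> B) \<and> v \<in> X \<and> v \<notin> B \<and> (\<exists>C\<in>M. v \<in> C \<and> C \<inter> B = {})" if X: "X \<in> Hd B" for X
    proof -
      have XH: "X \<in> H" and c2: "card (X \<inter> B) = 2" using X by (auto simp: Hd_def)
      have "X - B = X - X \<inter> B" by blast
      then have "card (X - B) = 1"
        using T[OF XH] c2 by (simp add: card_Diff_subset)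
      then obtain v where v: "X - B = {v}" by (auto simp: card_1_singleton_iff)
      obtain C where C: "C \<in> M" "v \<in> C" using v T[OF XH] by blast
      have "C \<inter> B = {}" using disjnt_blocks[OF M(2) B C(1)] C v by blast
      then show ?thesis using v C by blast
    qed
    \<comment> \<open>Two triples with the same pair in \<open>B\<close> but different third points
      violate the condition at the block \<open>C\<close> of one third point.\<close>
    have inj: "inj_on (\<lambda>X. X \<inter> B) (Hd B)"
    proof (rule inj_onI, rule ccontr)
      fix X Y assume X: "X \<in> Hd B" and Y: "Y \<in> Hd B" and e: "X \<inter> B = Y \<inter> B" and ne: "X \<noteq> Y"
      obtain v C where v: "X \<subseteq> insert v (X \<inter> B)" "v \<in> X" "v \<notin> B" "C \<in> M" "v \<in> C" "C \<inter> B = {}"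
        using sh[OF X] by metis
      obtain w where w: "Y \<subseteq> insert w (Y \<inter> B)" "w \<in> Y" "w \<notin> B" using sh[OF Y] by metis
      have vw: "v \<noteq> w" using ne e v w by blast
      have XY: "X \<in> H" "Y \<in> H" "card (X \<inter> B) = 2" using X Y by (auto simp: Hd_def)
      have "v \<notin> Y" using w v vw by blast
      show False
      proof (rule spreadD[OF H XY(1,2) ne v(4)])
        show "X \<inter> Y \<inter> C = {}" using v \<open>v \<notin> Y\<close> by blast
        show "X \<union> Y - C \<subseteq> insert w (X \<inter> B)" using v w e by blast
        show "finite (insert w (X \<inter> B))" using T[OF XY(1)] by simp
        show "card (insert w (X \<inter> B)) \<le> 3" using XY(3) T[OF XY(1)] by (simp add: card_insert_if)
      qed
    qed
    have "card (Hd B) = card ((\<lambda>X. X \<inter> B) ` Hd B)" using inj by (simp add: card_image)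
    also have "\<dots> \<le> card B - 1"
    proof (rule card_intersecting_pairs)
      show "finite B" "4 \<le> card B" using M(3)[OF B] k by auto
      show "(\<lambda>X. X \<inter> B) ` Hd B \<subseteq> nsets B 2" using T by (auto simp: Hd_def nsets_def)
      fix P Q assume "P \<in> (\<lambda>X. X \<inter> B) ` Hd B" "Q \<in> (\<lambda>X. X \<inter> B) ` Hd B"
      then obtain X Y where X: "X \<in> Hd B" "P = X \<inter> B" and Y: "Y \<in> Hd B" "Q = Y \<inter> B" by blast
      show "P \<inter> Q \<noteq> {}"
      proof
        assume PQ: "P \<inter> Q = {}"
        have XY: "X \<in> H" "Y \<in> H" "card P = 2" using X Y by (auto simp: Hd_def)
        have ne: "X \<noteq> Y" using PQ X Y XY(3) by auto
        obtain v where v: "X \<subseteq> insert v (X \<inter> B)" using sh[OF X(1)] by metis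
        obtain w where w: "Y \<subseteq> insert w (Y \<inter> B)" using sh[OF Y(1)] by metis
        show False
          by (rule spreadD[OF H XY(1,2) ne B, of "{v,w}"]) (use PQ X Y v w in \<open>auto simp: card_insert_if\<close>)
      qed
    qed
    finally show ?thesis using M(3)[OF B] by simp
  qed
  have ct: "3 * card Ht \<le> k * (card M choose 2)"
  proof -
    let ?P = "nsets M 2" and ?R = "\<lambda>X p. \<forall>B\<in>p. X \<inter> B \<noteq> {}"
    have finP: "finite ?P" using M(1) by (simp add: finite_imp_finite_nsets)
    have finHt: "finite Ht" using finH by (simp add: Ht_def)
    have single: "X \<inter> B = {u}" if "X \<in> Ht" "B \<in> M" "u \<in> X" "u \<in> B" for X B u
    proof -
      have "finite X" using T that(1) by (auto simp: Ht_def)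
      moreover have "card (X \<inter> B) \<le> Suc 0" using that by (auto simp: Ht_def)
      ultimately show ?thesis using that(3,4) by (auto simp: card_le_Suc0_iff_eq)
    qed
    have three: "3 \<le> card {p \<in> ?P. ?R X p}" if X: "X \<in> Ht" for X
    proof -
      have XH: "X \<in> H" using X by (simp add: Ht_def)
      obtain a b c where abc: "X = {a,b,c}" "a \<noteq> b" "b \<noteq> c" "a \<noteq> c"
        using T(1)[OF XH] by (auto simp: card_3_iff)
      obtain A B C where ABC: "A \<in> M" "B \<in> M" "C \<in> M" "a \<in> A" "b \<in> B" "c \<in> C"
        using T(3)[OF XH] abc by auto
      have "X \<inter> A = {a}" "X \<inter> B = {b}" "X \<inter> C = {c}" using single[OF X] ABC abc by auto
      then have ne: "A \<noteq> B" "B \<noteq> C" "A \<noteq> C" using abc by auto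
      have "{{A,B},{B,C},{A,C}} \<subseteq> {p \<in> ?P. ?R X p}"
        using ABC abc ne by (auto simp: nsets_def)
      moreover have "card {{A,B},{B,C},{A,C}} = 3"
        using ne by (auto simp: card_insert_if doubleton_eq_iff)
      ultimately show ?thesis using card_mono[of "{p \<in> ?P. ?R X p}" "{{A,B},{B,C},{A,C}}"] finP by simp
    qed
    have atmost: "card {X \<in> Ht. ?R X p} \<le> k" if p: "p \<in> ?P" for p
    proof -
      obtain B C where BC: "p = {B,C}" "B \<noteq> C" "B \<in> M" "C \<in> M"
        using p by (auto simp: nsets_def card_2_iff)
      \<comment> \<open>For transversals with the same point \<open>u\<close> in \<open>B\<close>,
        the condition fails at \<open>C\<close> if their points in \<open>C\<close> differ, and
        otherwise at the block of the remaining point \<open>w\<close>.\<close>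
      have "inj_on (\<lambda>X. X \<inter> B) {X \<in> Ht. ?R X p}"
      proof (rule inj_onI, rule ccontr)
        fix X Y assume X: "X \<in> {X \<in> Ht. ?R X p}" and Y: "Y \<in> {X \<in> Ht. ?R X p}"
          and e: "X \<inter> B = Y \<inter> B" and ne: "X \<noteq> Y"
        have XY: "X \<in> H" "Y \<in> H" "X \<in> Ht" "Y \<in> Ht" using X Y by (auto simp: Ht_def)
        obtain u v v' where u: "u \<in> X" "u \<in> B" and v: "v \<in> X" "v \<in> C" and v': "v' \<in> Y" "v' \<in> C"
        proof -
          have "X \<inter> B \<noteq> {}" "X \<inter> C \<noteq> {}" "Y \<inter> C \<noteq> {}" using X Y BC(1) by auto
          then show thesis using that by blast
        qed
        have uY: "u \<in> Y" using e u by blast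
        have "B \<inter> C = {}" using disjnt_blocks[OF M(2) BC(3,4)] BC(2) by blast
        then have uv: "u \<noteq> v" "u \<noteq> v'" "v \<notin> B" "u \<notin> C" using u v v' by auto
        obtain w where w: "X = {u,v,w}" "w \<noteq> u" "w \<noteq> v"
          using card_3_third[OF T(1)[OF XY(1)] u(1) v(1) uv(1)] by metis
        obtain w' where w': "Y = {u,v',w'}" "w' \<noteq> u" "w' \<noteq> v'"
          using card_3_third[OF T(1)[OF XY(2)] uY v'(1) uv(2)] by metis
        have XC: "X \<inter> C = {v}" "Y \<inter> C = {v'}" using single XY v v' BC by auto
        show False
        proof (cases "v = v'")
          case True
          obtain D where D: "D \<in> M" "w \<in> D" using T(3)[OF XY(1)] w by auto
          have XD: "X \<inter> D = {w}" using single[OF XY(3) D(1) _ D(2)] w by auto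
          have "w \<noteq> w'" using True ne w w' by auto
          then have wY: "w \<notin> Y" using w w' True by auto
          show False
          proof (rule spreadD[OF H XY(1,2) ne D(1), of "{u,v,w'}"])
            show "X \<inter> Y \<inter> D = {}" using XD wY by auto
            show "X \<union> Y - D \<subseteq> {u,v,w'}" unfolding w(1) w'(1) using True D(2) by auto
            show "card {u,v,w'} \<le> 3" by (simp add: card_insert_if)
          qed simp
        next
          case False
          show False
          proof (rule spreadD[OF H XY(1,2) ne BC(4), of "{u,w,w'}"])
            show "X \<inter> Y \<inter> C = {}" using XC False by auto
            show "X \<union> Y - C \<subseteq> {u,w,w'}" unfolding w(1) w'(1) using v(2) v'(2) by auto
            show "card {u,w,w'} \<le> 3" by (simp add: card_insert_if)
          qed simp
        qed
      qed
      moreover have "(\<lambda>X. X \<inter> B) ` {X \<in> Ht. ?R X p} \<subseteq> nsets B 1"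
      proof
        fix Z assume "Z \<in> (\<lambda>X. X \<inter> B) ` {X \<in> Ht. ?R X p}"
        then obtain X where X: "X \<in> Ht" "Z = X \<inter> B" "X \<inter> B \<noteq> {}" using BC(1) by auto
        then obtain u where "u \<in> X" "u \<in> B" by blast
        then have "Z = {u}" using single[OF X(1) BC(3)] X(2) by simp
        then show "Z \<in> nsets B 1" using \<open>u \<in> B\<close> by (simp add: nsets_def)
      qed
      ultimately have "card {X \<in> Ht. ?R X p} \<le> card (nsets B 1)"
        using M(3)[OF BC(3)] by (intro card_inj_on_le) (simp_all add: finite_imp_finite_nsets)
      then show ?thesis using M(3)[OF BC(3)] by (simp add: card_nsets)
    qed
    have "3 * card Ht = (\<Sum>X\<in>Ht. 3)" by simp
    also have "\<dots> \<le> (\<Sum>X\<in>Ht. card {p \<in> ?P. ?R X p})" by (intro sum_mono three)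
    also have "\<dots> = (\<Sum>p\<in>?P. card {X \<in> Ht. ?R X p})"
      by (rule sum_multicount_gen[OF finHt finP]) simp
    also have "\<dots> \<le> (\<Sum>p\<in>?P. k)" by (intro sum_mono atmost)
    also have "\<dots> = k * (card M choose 2)" by (simp add: card_nsets)
    finally show ?thesis .
  qed
  have "card H \<le> card (Ht \<union> (\<Union>B\<in>M. Hd B))"
    using cover finH M(1) by (intro card_mono) (auto simp: Ht_def Hd_def)
  also have "\<dots> \<le> card Ht + card (\<Union>B\<in>M. Hd B)" by (rule card_Un_le)
  also have "\<dots> \<le> card Ht + card M * (k - 1)"
    by (intro add_left_mono card_UN_bound M(1) cd) simp
  finally have "real (card H) \<le> real (card Ht + card M * (k - 1))" by (rule of_nat_mono)
  then have "real (card H) \<le> real (card Ht) + real (card M) * (real k - 1)"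
    using k by (simp add: of_nat_diff)
  moreover have "3 * real (card Ht) \<le> real k * real (card M choose 2)"
    using ct by (metis of_nat_le_iff of_nat_mult of_nat_numeral)
  ultimately show ?thesis by (simp add: field_simps)
qed

section \<open>Lower bound\<close>

lemma card_trace_class:
  assumes "finite W" "finite U" "T \<subseteq> U" "x \<notin> U" "x \<notin> W" "U \<inter> W = {}"
  shows "card {A \<in> nsets (insert x (U \<union> W)) k. x \<in> A \<and> A \<inter> U = T}
    = binom (card W) (int k - 1 - int (card T))"
proof (cases "card T + 1 \<le> k")
  case True
  have finT: "finite T" using assms finite_subset by blast
  have "bij_betw (\<lambda>S. insert x (T \<union> S)) (nsets W (k - 1 - card T))
      {A \<in> nsets (insert x (U \<union> W)) k. x \<in> A \<and> A \<inter> U = T}"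
  proof (rule bij_betw_byWitness[where f' = "\<lambda>A. A \<inter> W"])
    show "\<forall>S\<in>nsets W (k - 1 - card T). insert x (T \<union> S) \<inter> W = S"
      using assms by (auto simp: nsets_def)
    show "\<forall>A\<in>{A \<in> nsets (insert x (U \<union> W)) k. x \<in> A \<and> A \<inter> U = T}. insert x (T \<union> A \<inter> W) = A"
      using assms by (auto simp: nsets_def)
    show "(\<lambda>S. insert x (T \<union> S)) ` nsets W (k - 1 - card T)
        \<subseteq> {A \<in> nsets (insert x (U \<union> W)) k. x \<in> A \<and> A \<inter> U = T}"
    proof (rule image_subsetI)
      fix S assume "S \<in> nsets W (k - 1 - card T)"
      then have S: "S \<subseteq> W" "finite S" "card S = k - 1 - card T" by (auto simp: nsets_def)
      have "T \<inter> S = {}" "x \<notin> T \<union> S" using S assms by auto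
      then have "card (insert x (T \<union> S)) = k"
        using S finT True by (simp add: card_Un_disjoint)
      then show "insert x (T \<union> S) \<in> {A \<in> nsets (insert x (U \<union> W)) k. x \<in> A \<and> A \<inter> U = T}"
        using S finT assms by (auto simp: nsets_def)
    qed
    show "(\<lambda>A. A \<inter> W) ` {A \<in> nsets (insert x (U \<union> W)) k. x \<in> A \<and> A \<inter> U = T}
        \<subseteq> nsets W (k - 1 - card T)"
    proof (rule image_subsetI, clarify)
      fix A assume A: "A \<in> nsets (insert x (U \<union> W)) k" "x \<in> A" "T = A \<inter> U"
      have fA: "finite A" "card A = k" "A \<subseteq> insert x (U \<union> W)" using A by (auto simp: nsets_def)
      have "A \<inter> W = A - insert x (A \<inter> U)" using fA assms by auto
      moreover have "card (insert x (A \<inter> U)) = Suc (card (A \<inter> U))" using fA assms by simp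
      moreover have "insert x (A \<inter> U) \<subseteq> A" using A by blast
      ultimately have "card (A \<inter> W) = k - Suc (card (A \<inter> U))"
        using fA by (simp add: card_Diff_subset)
      then show "A \<inter> W \<in> nsets W (k - 1 - card (A \<inter> U))" using fA by (simp add: nsets_def)
    qed
  qed
  from bij_betw_same_card[OF this]
  have "card {A \<in> nsets (insert x (U \<union> W)) k. x \<in> A \<and> A \<inter> U = T} = card W choose (k - 1 - card T)"
    by (simp only: card_nsets)
  moreover have "nat (int k - 1 - int (card T)) = k - 1 - card T" by simp
  ultimately show ?thesis using True by (simp add: binom_def)
next
  case False
  have "card (insert x (A \<inter> U)) \<le> card A" if "finite A" "x \<in> A" for A
    using that by (intro card_mono) auto
  then have e: "{A \<in> nsets (insert x (U \<union> W)) k. x \<in> A \<and> A \<inter> U = T} = {}"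
    using False assms by (fastforce simp: nsets_def)
  show ?thesis unfolding e using False by (simp add: binom_def)
qed

text \<open>The points of \<open>A\<close> lost to \<open>B\<close> are outnumbered by those that
  \<open>A'\<close> adds outside \<open>A\<close> and \<open>B\<close>. Intersecting with
  \<open>U\<close> allows the latter to be counted on traces alone.\<close>

lemma union_gt:
  assumes fin: "finite A" "finite A'" and k: "k \<le> card A"
    and "card (A \<inter> B) < card ((A' - A - B) \<inter> U)"
  shows "k < card ((A \<union> A') - B)"
proof -
  have "(A \<union> A') - B = (A - B) \<union> (A' - A - B)" by blast
  then have "card ((A \<union> A') - B) = card (A - B) + card (A' - A - B)"
  proof -
    have "(A - B) \<inter> (A' - A - B) = {}" by blast
    then show ?thesis
      using card_Un_disjoint[of "A - B" "A' - A - B"] fin \<open>(A \<union> A') - B = (A - B) \<union> (A' - A - B)\<close> by simp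
  qed
  moreover have "card A = card (A - B) + card (A \<inter> B)"
    using card_Int_Diff[OF fin(1), of B] by simp
  moreover have "card ((A' - A - B) \<inter> U) \<le> card (A' - A - B)" using fin by (intro card_mono) auto
  ultimately show ?thesis using assms by linarith
qed

text \<open>Some member of a cluster misses \<open>x\<close> and so is a block \<open>B\<close>. A
  second block would fill \<open>2 * k\<close> points together with \<open>B\<close> and leave no
  room for the third member. Hence the other two members contain \<open>x\<close>, and the condition
  on traces makes their union exceed \<open>k\<close> points outside \<open>B\<close>.\<close>

lemma trace_family_cluster_free:
  assumes k: "1 \<le> k" and M: "pairwise disjnt M" "\<And>B. B \<in> M \<Longrightarrow> finite B \<and> card B = k"
    and x: "x \<notin> \<Union>M"
    and TT: "\<And>T T' B. \<lbrakk>T \<in> TT; T' \<in> TT; B \<in> M; T \<inter> B \<noteq> {}; T \<inter> T' \<inter> B = {}\<rbrakk> \<Longrightarrow>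
       card (T \<inter> B) < card (T' - T - B) \<or> card (T' \<inter> B) < card (T - T' - B)"
  shows "cluster_free 3 k (M \<union> {A \<in> nsets V k. x \<in> A \<and> A \<inter> \<Union>M \<in> TT})"
  unfolding cluster_free_def
proof (intro notI, elim exE conjE)
  fix \<C> assume sub: "\<C> \<subseteq> M \<union> {A \<in> nsets V k. x \<in> A \<and> A \<inter> \<Union>M \<in> TT}" and cl: "is_cluster 3 k \<C>"
  have c: "finite A" "card A = k" if "A \<in> \<C>" for A using cl that by (auto simp: is_cluster_def)
  have "card \<C> = 3" "\<Inter>\<C> = {}" using cl by (auto simp: is_cluster_def)
  then obtain B where B: "B \<in> \<C>" "x \<notin> B" by blast
  then have BM: "B \<in> M" using sub by auto
  have "card (\<C> - {B}) = 2" using \<open>card \<C> = 3\<close> B by simp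
  then obtain A A' where "\<C> - {B} = {A, A'}" "A \<noteq> A'" by (auto simp: card_2_iff)
  then have e: "\<C> = {B, A, A'}" "A \<noteq> B" "A' \<noteq> B" "A \<noteq> A'" using B by auto
  have un: "card (A \<union> A' \<union> B) \<le> 2 * k" and int: "A \<inter> A' \<inter> B = {}"
    using cl e(1) by (auto simp: is_cluster_def Un_ac Int_ac)
  \<comment> \<open>The last premise lets the same argument serve for \<open>A\<close> and for
    \<open>A'\<close>.\<close>
  have noM: "A1 \<notin> M" if A1: "A1 \<in> \<C>" "A2 \<in> \<C>" "A1 \<noteq> B" "A2 \<noteq> A1" "A2 \<noteq> B" "A \<union> A' \<union> B = A1 \<union> A2 \<union> B" for A1 A2
  proof
    assume A1M: "A1 \<in> M"
    have "A1 \<inter> B = {}" using M(1) A1M BM A1(3) by (auto simp: pairwise_def disjnt_def)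
    then have "card (A1 \<union> B) = 2 * k" using c A1 B by (simp add: card_Un_disjoint)
    then have "A1 \<union> B = A1 \<union> A2 \<union> B"
      using un A1(6) c A1 B by (intro card_seteq) auto
    then have A2: "A2 \<subseteq> A1 \<union> B" by blast
    have "A2 \<noteq> {}" using c(2)[OF A1(2)] k by auto
    show False
    proof (cases "A2 \<in> M")
      case True
      have "A2 \<inter> A1 = {}" "A2 \<inter> B = {}" using True M(1) A1M BM A1 by (auto simp: pairwise_def disjnt_def)
      then show False using A2 \<open>A2 \<noteq> {}\<close> by blast
    next
      case False
      then have "x \<in> A2" using sub A1 by auto
      then show False using A2 x A1M BM by blast
    qed
  qed
  have AM: "A \<notin> M" "A' \<notin> M" using noM[of A A'] noM[of A' A] e by (auto simp: Un_ac)
  then have xA: "x \<in> A" "x \<in> A'" and T: "A \<inter> \<Union>M \<in> TT" "A' \<inter> \<Union>M \<in> TT" using sub e(1) by auto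
  have fin: "finite A" "card A = k" "finite A'" "card A' = k" "finite B" "card B = k" using c e(1) by auto
  have split: "card (A \<union> A' \<union> B) = card ((A \<union> A') - B) + k"
  proof -
    have "A \<union> A' \<union> B = ((A \<union> A') - B) \<union> B" by blast
    then show ?thesis using fin by (metis Diff_disjoint card_Un_disjoint finite_Diff finite_Un inf_commute)
  qed
  have hit: "k < card ((A1 \<union> A2) - B)"
    if "finite A1" "card A1 = k" "finite A2" "card A2 = k" "A1 \<inter> \<Union>M \<in> TT" "A2 \<inter> \<Union>M \<in> TT"
      "A1 \<inter> B \<noteq> {}" "A1 \<inter> A2 \<inter> B = {}" for A1 A2
  proof -
    let ?U = "\<Union>M"
    have BU: "B \<subseteq> ?U" using BM by blast
    have e1: "(A1 \<inter> ?U) \<inter> B = A1 \<inter> B" "(A2 \<inter> ?U) \<inter> B = A2 \<inter> B"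
      "(A2 \<inter> ?U) - (A1 \<inter> ?U) - B = (A2 - A1 - B) \<inter> ?U"
      "(A1 \<inter> ?U) - (A2 \<inter> ?U) - B = (A1 - A2 - B) \<inter> ?U"
      using BU by blast+
    have "(A1 \<inter> ?U) \<inter> (A2 \<inter> ?U) \<inter> B = {}" using that(8) by blast
    then have "card (A1 \<inter> B) < card ((A2 - A1 - B) \<inter> ?U) \<or> card (A2 \<inter> B) < card ((A1 - A2 - B) \<inter> ?U)"
      using TT[OF that(5,6) BM] that(7) unfolding e1 by blast
    then show ?thesis
    proof
      assume "card (A1 \<inter> B) < card ((A2 - A1 - B) \<inter> ?U)"
      then show ?thesis by (intro union_gt) (use that in auto)
    next
      assume "card (A2 \<inter> B) < card ((A1 - A2 - B) \<inter> ?U)"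
      then have "k < card ((A2 \<union> A1) - B)" by (intro union_gt) (use that in auto)
      then show ?thesis by (simp only: Un_commute)
    qed
  qed
  \<comment> \<open>If both miss \<open>B\<close>, being distinct \<open>k\<close>-sets is enough;
    otherwise one of them meets \<open>B\<close> and the trace condition applies.\<close>
  have "k < card ((A \<union> A') - B)"
  proof (cases "A \<inter> B = {} \<and> A' \<inter> B = {}")
    case True
    then have "(A \<union> A') - B = A \<union> A'" by blast
    moreover have "\<not> A' \<subseteq> A" using fin e(4) card_subset_eq by metis
    then have "card A < card (A \<union> A')" using fin by (intro psubset_card_mono) auto
    ultimately show ?thesis using fin by simp
  next
    case False
    then consider "A \<inter> B \<noteq> {}" | "A' \<inter> B \<noteq> {}" by blast
    then show ?thesis
    proof cases
      case 1
      show ?thesis by (rule hit[OF fin(1-4) T 1 int])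
    next
      case 2
      have "A' \<inter> A \<inter> B = {}" using int by blast
      from hit[OF fin(3,4,1,2) T(2,1) 2 this] show ?thesis by (simp only: Un_commute)
    qed
  qed
  then show False using un split by simp
qed

text \<open>Edges through \<open>x\<close> are counted by trace. The edge that enlarges the matching
  beyond the blocks consists of \<open>x\<close> and \<open>k - 1\<close> points of
  \<open>W\<close>; this is the purpose of \<open>{} \<in> TT\<close> and of the bound on
  \<open>card W\<close>.\<close>

lemma max_cluster_free_ge_traces:
  assumes k: "1 \<le> k" and M: "finite M" "pairwise disjnt M" "\<And>B. B \<in> M \<Longrightarrow> finite B \<and> card B = k"
    and x: "x \<notin> \<Union>M" "x \<notin> W" and W: "finite W" "\<Union>M \<inter> W = {}" "k \<le> card W + 1"
    and TT: "TT \<subseteq> Pow (\<Union>M)" "{} \<in> TT"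
    and cond: "\<And>T T' B. \<lbrakk>T \<in> TT; T' \<in> TT; B \<in> M; T \<inter> B \<noteq> {}; T \<inter> T' \<inter> B = {}\<rbrakk> \<Longrightarrow>
       card (T \<inter> B) < card (T' - T - B) \<or> card (T' \<inter> B) < card (T - T' - B)"
  shows "card M + (\<Sum>T\<in>TT. binom (card W) (int k - 1 - int (card T)))
    \<le> max_cluster_free (card M * k + card W + 1) k 3 (int (card M))"
proof -
  let ?U = "\<Union>M"
  let ?V = "insert x (?U \<union> W)"
  let ?C = "\<lambda>T. {A \<in> nsets ?V k. x \<in> A \<and> A \<inter> ?U = T}"
  let ?X = "{A \<in> nsets ?V k. x \<in> A \<and> A \<inter> ?U \<in> TT}"
  have finU: "finite ?U" using M by auto
  have cU: "card ?U = card M * k"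
    using card_Union_disjoint[OF M(2)] M(3) by simp
  have cV: "card ?V = card M * k + card W + 1"
    using cU finU W x by (simp add: card_Un_disjoint)
  have finV: "finite ?V" using finU W by simp
  have finT: "finite TT" using TT finU by (meson finite_Pow_iff finite_subset)
  have finN: "finite (nsets ?V k)" using finV by (simp add: finite_imp_finite_nsets)
  have cX: "card ?X = (\<Sum>T\<in>TT. binom (card W) (int k - 1 - int (card T)))"
  proof -
    have "?X = (\<Union>T\<in>TT. ?C T)" by blast
    then have "card ?X = (\<Sum>T\<in>TT. card (?C T))"
      using finT finN by (simp only:) (intro card_UN_disjoint, auto)
    also have "\<dots> = (\<Sum>T\<in>TT. binom (card W) (int k - 1 - int (card T)))"
      using TT by (intro sum.cong card_trace_class refl W finU x) auto
    finally show ?thesis .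
  qed
  have cf: "cluster_free 3 k (M \<union> ?X)"
    by (rule trace_family_cluster_free[OF k M(2,3) x(1) cond])
  have sub: "M \<union> ?X \<subseteq> nsets ?V k" using M(3) by (auto simp: nsets_def)
  have dis: "M \<inter> ?X = {}" using x by auto
  have finX: "finite ?X" using finN by simp
  have "0 < card (nsets W (k - 1))" using W by (simp add: card_nsets zero_less_binomial_iff)
  then have "nsets W (k - 1) \<noteq> {}" unfolding card_gt_0_iff by (rule conjunct1)
  then obtain S where "S \<in> nsets W (k - 1)" by blast
  then have S: "S \<subseteq> W" "finite S" "card S = k - 1" by (auto simp: nsets_def)
  let ?A = "insert x S"
  have A: "?A \<in> ?X"
  proof -
    have "x \<notin> S" using S(1) x(2) by blast
    then have "card ?A = k" using S k by simp
    moreover have "?A \<inter> ?U = {}" using S(1) x(1) W(2) by blast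
    ultimately show ?thesis using S TT(2) by (auto simp: nsets_def)
  qed
  have "pairwise disjnt (insert ?A M)"
  proof -
    have "disjnt ?A B" if "B \<in> M" for B
      using that S(1) x(1) W(2) unfolding disjnt_def by blast
    then show ?thesis using M(2) by (simp add: pairwise_insert disjnt_sym)
  qed
  moreover have "?A \<notin> M" using A dis by blast
  then have "int (card M) + 1 \<le> int (card (insert ?A M))" using M(1) by simp
  ultimately have "card (M \<union> ?X) \<le> max_cluster_free (card ?V) k 3 (int (card M))"
    using A by (intro max_cluster_free_ge[OF finV sub cf, of "insert ?A M"]) auto
  then show ?thesis
    unfolding cV using M(1) finX dis cX by (simp add: card_Un_disjoint)
qed

lemma sum_traces:
  fixes g :: "nat \<Rightarrow> nat"
  assumes "finite P" "finite Q" "\<And>T. T \<in> P \<Longrightarrow> card T = 2" "\<And>T. T \<in> Q \<Longrightarrow> card T = 3"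
  shows "(\<Sum>T\<in>insert {} (P \<union> Q). g (card T)) = g 0 + card P * g 2 + card Q * g 3"
proof -
  have "P \<inter> Q = {}" using assms by fastforce
  moreover have "{} \<notin> P \<union> Q" using assms(3,4) by fastforce
  ultimately show ?thesis using assms by (simp add: sum.union_disjoint)
qed

section \<open>Triple systems in which no two triples share two points\<close>

text \<open>Two triples sharing two points are a tight path with two edges, so an extremal system
  for the tight path has pairwise intersections of size at most 1, the only property used later
  on.\<close>

lemma turan_tight_attained:
  obtains E where "E \<subseteq> nsets {1..n} 3" "card E = turan_number 3 n (tight_path 3 2)"
    "\<And>e e'. e \<in> E \<Longrightarrow> e' \<in> E \<Longrightarrow> e \<noteq> e' \<Longrightarrow> card (e \<inter> e') \<le> 1"
proof -
  let ?H = "tight_path 3 2"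
  let ?S = "{card E | E. E \<subseteq> nsets {1..n} 3 \<and> \<not> contains_copy E ?H}"
  have H: "?H = {{1..<4}, {2..<5}}"
  proof -
    have "{i. 1 \<le> i \<and> i \<le> (2::nat)} = {1, 2}" by auto
    then show ?thesis by (auto simp: tight_path_def setcompr_eq_image)
  qed
  have "?S \<subseteq> card ` Pow (nsets {1..n} 3)" by auto
  then have "finite ?S" by (rule finite_subset) (simp add: finite_imp_finite_nsets)
  moreover have "card {} \<in> ?S"
    by (intro CollectI exI[of _ "{}"]) (auto simp: contains_copy_def H)
  ultimately have "Max ?S \<in> ?S" by (intro Max_in) auto
  then obtain E where E: "E \<subseteq> nsets {1..n} 3" "\<not> contains_copy E ?H" "card E = Max ?S" by auto
  have "card (e \<inter> e') \<le> 1" if e: "e \<in> E" "e' \<in> E" "e \<noteq> e'" for e e'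
  proof (rule ccontr)
    assume "\<not> card (e \<inter> e') \<le> 1"
    have c: "card e = 3" "finite e" "card e' = 3" "finite e'" using e E(1) by (auto simp: nsets_def)
    have "card (e \<inter> e') \<noteq> 3"
      using c e(3) by (metis card_subset_eq inf_le1 inf_le2)
    moreover have "card (e \<inter> e') \<le> 3" using c card_mono[of e "e \<inter> e'"] by simp
    ultimately have "card (e \<inter> e') = 2" using \<open>\<not> card (e \<inter> e') \<le> 1\<close> by simp
    then obtain b d where bd: "e \<inter> e' = {b,d}" "b \<noteq> d" by (auto simp: card_2_iff)
    have "card (e - {b,d}) = 1" "card (e' - {b,d}) = 1"
    proof -
      have "{b,d} \<subseteq> e" "{b,d} \<subseteq> e'" "card {b,d} = 2" using bd by auto
      then show "card (e - {b,d}) = 1" "card (e' - {b,d}) = 1"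
        using c by (simp_all add: card_Diff_subset)
    qed
    then obtain a a' where a: "e - {b,d} = {a}" "e' - {b,d} = {a'}" by (auto simp: card_1_singleton_iff)
    have ee: "e = {a,b,d}" "e' = {b,d,a'}" using a bd(1) by blast+
    have ne: "a \<noteq> b" "a \<noteq> d" "a' \<noteq> b" "a' \<noteq> d" using a by auto
    have "a \<noteq> a'"
    proof
      assume "a = a'"
      then show False using ee e(3) by auto
    qed
    \<comment> \<open>The copy of the tight path runs through \<open>a\<close>, \<open>b\<close>,
      \<open>d\<close>, \<open>a'\<close>, with the shared pair in the middle.\<close>
    define f where "f = (\<lambda>i::nat. if i = 1 then a else if i = 2 then b else if i = 3 then d else a')"
    have i: "{1..<4} = {1,2,3::nat}" "{2..<5} = {2,3,4::nat}" by auto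
    have "inj_on f (\<Union>?H)"
      unfolding H i using ne bd(2) \<open>a \<noteq> a'\<close> by (auto simp: inj_on_def f_def)
    moreover have "f ` {1,2,3} = e" "f ` {2,3,4} = e'" unfolding ee by (simp_all add: f_def insert_commute)
    then have "\<forall>h\<in>?H. f ` h \<in> E"
      unfolding H i using e(1,2) by simp
    ultimately show False using E(2) unfolding contains_copy_def by blast
  qed
  then show thesis using that[of E] E by (simp add: turan_number_def)
qed

text \<open>No pair of points lies in two triples, and each triple contains three pairs. The bound
  serves to compare \<open>c\<^sub>1\<close> with \<open>c\<^sub>2\<close>.\<close>

lemma three_card_partial_triple_system:
  assumes E: "E \<subseteq> nsets V 3" "finite V" and int: "\<And>e e'. e \<in> E \<Longrightarrow> e' \<in> E \<Longrightarrow> e \<noteq> e' \<Longrightarrow> card (e \<inter> e') \<le> 1"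
  shows "3 * card E \<le> card V choose 2"
proof -
  have finE: "finite E" using E finite_imp_finite_nsets finite_subset by blast
  have "card (\<Union>e\<in>E. nsets e 2) = (\<Sum>e\<in>E. card (nsets e 2))"
  proof (rule card_UN_disjoint[OF finE])
    show "\<forall>e\<in>E. finite (nsets e 2)" using E by (auto simp: nsets_def)
    show "\<forall>e\<in>E. \<forall>e'\<in>E. e \<noteq> e' \<longrightarrow> nsets e 2 \<inter> nsets e' 2 = {}"
    proof (intro ballI impI, rule ccontr)
      fix e e' assume e: "e \<in> E" "e' \<in> E" "e \<noteq> e'" "nsets e 2 \<inter> nsets e' 2 \<noteq> {}"
      then obtain p where "p \<subseteq> e \<inter> e'" "card p = 2" by (auto simp: nsets_def)
      moreover have "finite (e \<inter> e')" using e E by (auto simp: nsets_def)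
      ultimately have "2 \<le> card (e \<inter> e')" by (metis card_mono)
      then show False using int[OF e(1-3)] by simp
    qed
  qed
  also have "\<dots> = (\<Sum>e\<in>E. 3)"
  proof (rule sum.cong)
    fix e assume "e \<in> E"
    then have "card e = 3" using E by (auto simp: nsets_def)
    then show "card (nsets e 2) = 3" by (simp add: card_nsets choose_two)
  qed simp
  finally have "3 * card E = card (\<Union>e\<in>E. nsets e 2)" by simp
  also have "\<dots> \<le> card (nsets V 2)"
    using E by (intro card_mono) (auto simp: nsets_def finite_imp_finite_nsets[unfolded nsets_def])
  finally show ?thesis by (simp add: card_nsets)
qed

section \<open>The two constructions\<close>

context
  fixes k \<nu> m :: nat
  assumes k: "3 \<le> k" and m: "k \<le> m + 1"
begin

text \<open>Common frame of both constructions, a point being given by its block and its position in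
  the block. The hypothesis \<open>out\<close> settles the comparison with the empty trace, so
  \<open>cond\<close> only concerns pairs and triples.\<close>

lemma lower_bound_aux:
  assumes P: "finite P" "\<And>T. T \<in> P \<Longrightarrow> card T = 2" and Q: "finite Q" "\<And>T. T \<in> Q \<Longrightarrow> card T = 3"
    and sub: "P \<union> Q \<subseteq> Pow ({1..\<nu>} \<times> {..<k})"
    and cond: "\<And>T T' j. \<lbrakk>T \<in> P \<union> Q; T' \<in> P \<union> Q; T \<inter> ({j} \<times> {..<k}) \<noteq> {}; T \<inter> T' \<inter> ({j} \<times> {..<k}) = {}\<rbrakk> \<Longrightarrow>
       card (T \<inter> ({j} \<times> {..<k})) < card (T' - T - {j} \<times> {..<k}) \<or>
       card (T' \<inter> ({j} \<times> {..<k})) < card (T - T' - {j} \<times> {..<k})"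
    and out: "\<And>T j. T \<in> P \<union> Q \<Longrightarrow> \<not> T \<subseteq> {j} \<times> {..<k}"
  shows "binom m (int k - 1) + card P * binom m (int k - 3) + card Q * binom m (int k - 4) + \<nu>
    \<le> max_cluster_free (k * \<nu> + m + 1) k 3 (int \<nu>)"
proof -
  \<comment> \<open>First coordinate 0 is kept for the centre and the \<open>m\<close> outer points,
    so the blocks with numbers \<open>1..\<nu>\<close> avoid them.\<close>
  let ?M = "(\<lambda>j. {j} \<times> {..<k}) ` {1..\<nu>}"
  let ?x = "(0::nat, 0::nat)" and ?W = "{0::nat} \<times> {1..m}"
  have U: "\<Union>?M = {1..\<nu>} \<times> {..<k}" by auto
  have "inj_on (\<lambda>j. {j} \<times> {..<k}) {1..\<nu>}"
  proof (rule inj_onI)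
    fix i j assume e: "{i} \<times> {..<k} = {j} \<times> {..<k}"
    have "(i, 0) \<in> {i} \<times> {..<k}" using k by simp
    then show "i = j" unfolding e by simp
  qed
  then have cM: "card ?M = \<nu>" by (simp add: card_image)
  have cW: "card ?W = m" by (simp add: card_cartesian_product)
  have "card ?M + (\<Sum>T\<in>insert {} (P \<union> Q). binom (card ?W) (int k - 1 - int (card T)))
    \<le> max_cluster_free (card ?M * k + card ?W + 1) k 3 (int (card ?M))"
  proof (rule max_cluster_free_ge_traces[where x = ?x])
    fix T T' B assume h: "T \<in> insert {} (P \<union> Q)" "T' \<in> insert {} (P \<union> Q)" "B \<in> ?M" "T \<inter> B \<noteq> {}" "T \<inter> T' \<inter> B = {}"
    then obtain j where j: "B = {j} \<times> {..<k}" by blast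
    have T: "T \<in> P \<union> Q" using h by auto
    show "card (T \<inter> B) < card (T' - T - B) \<or> card (T' \<inter> B) < card (T - T' - B)"
    proof (cases "T' = {}")
      case True
      have "finite T" using T sub by (meson PowD finite_SigmaI finite_atLeastAtMost finite_lessThan finite_subset subsetD)
      moreover have "T - B \<noteq> {}" using out[OF T] j by blast
      ultimately show ?thesis using True by (simp add: card_gt_0_iff)
    next
      case False
      then show ?thesis using cond[OF T, of T' j] h j by auto
    qed
  qed (use k m sub in \<open>auto simp: U pairwise_def disjnt_def card_cartesian_product\<close>)
  then have "\<nu> + (\<Sum>T\<in>insert {} (P \<union> Q). binom m (int k - 1 - int (card T)))
    \<le> max_cluster_free (k * \<nu> + m + 1) k 3 (int \<nu>)"
    unfolding cM cW by (simp add: mult.commute)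
  moreover have "(\<Sum>T\<in>insert {} (P \<union> Q). binom m (int k - 1 - int (card T)))
      = binom m (int k - 1) + card P * binom m (int k - 3) + card Q * binom m (int k - 4)"
    using sum_traces[OF P(1) Q(1) P(2) Q(2), of "\<lambda>t. binom m (int k - 1 - int t)"] by simp
  ultimately show ?thesis by simp
qed

text \<open>Blocks are paired up, \<open>pr i\<close> being the distinguished pair of the \<open>i\<close>-th pair of blocks.\<close>

abbreviation pr :: "nat \<Rightarrow> (nat \<times> nat) set" where
  "pr i \<equiv> {(2 * i + 1, 0), (2 * i + 2, 0)}"

lemma pr_inj: "pr i = pr i' \<Longrightarrow> i = i'"
  by (auto simp: doubleton_eq_iff)

text \<open>Each \<open>pr i\<close> has \<open>2 * (k - 1)\<close> extensions by a point of its two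
  blocks. Traces over the same \<open>pr i\<close> share a point in both blocks, so the condition
  only matters between different \<open>i\<close>; then \<open>T'\<close> misses the block, and
  \<open>T\<close> has a point outside it.\<close>

lemma lower_bound_pairs:
  "binom m (int k - 1) + (\<nu> div 2) * binom m (int k - 3)
     + 2 * (k - 1) * (\<nu> div 2) * binom m (int k - 4) + \<nu>
   \<le> max_cluster_free (k * \<nu> + m + 1) k 3 (int \<nu>)"
proof -
  let ?I = "{..<\<nu> div 2}"
  let ?D = "SIGMA i:?I. {2 * i + 1, 2 * i + 2} \<times> {1..<k}"
  let ?P = "pr ` ?I" and ?Q = "(\<lambda>(i,w). insert w (pr i)) ` ?D"
  have shape: "\<exists>i\<in>?I. pr i \<subseteq> T \<and> T \<subseteq> {2 * i + 1, 2 * i + 2} \<times> {..<k}" if "T \<in> ?P \<union> ?Q" for T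
    using that k by fastforce
  have inj: "inj_on (\<lambda>(i,w). insert w (pr i)) ?D"
  proof (rule inj_onI)
    fix p q assume pq: "p \<in> ?D" "q \<in> ?D" "(case p of (i,w) \<Rightarrow> insert w (pr i)) = (case q of (i,w) \<Rightarrow> insert w (pr i))"
    obtain i a b where p: "p = (i, a, b)" by (metis surj_pair)
    obtain i' a' b' where q: "q = (i', a', b')" by (metis surj_pair)
    have h: "0 < b" "0 < b'" and e: "insert (a, b) (pr i) = insert (a', b') (pr i')"
      using pq p q by auto
    \<comment> \<open>Position 0 is reserved for the distinguished pairs, so the added point can be
      read off as the one with positive position.\<close>
    have "insert (a, b) (pr i) \<inter> {p. snd p = 0} = pr i" "insert (a', b') (pr i') \<inter> {p. snd p = 0} = pr i'"
      using h by auto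
    then have "i = i'" using e pr_inj by metis
    moreover have "insert (a, b) (pr i) - {p. snd p = 0} = {(a,b)}" "insert (a', b') (pr i') - {p. snd p = 0} = {(a',b')}"
      using h by auto
    then have "(a,b) = (a',b')" using e by (metis singleton_inject)
    ultimately show "p = q" using p q by simp
  qed
  have cP: "card ?P = \<nu> div 2" using pr_inj by (subst card_image) (auto simp: inj_on_def)
  have cQ: "card ?Q = 2 * (k - 1) * (\<nu> div 2)"
    using inj by (simp add: card_image card_cartesian_product)
  have "binom m (int k - 1) + card ?P * binom m (int k - 3) + card ?Q * binom m (int k - 4) + \<nu>
    \<le> max_cluster_free (k * \<nu> + m + 1) k 3 (int \<nu>)"
  proof (rule lower_bound_aux)
    show "finite ?P" "finite ?Q" by auto
    show "card T = 2" if "T \<in> ?P" for T using that by auto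
    show "card T = 3" if "T \<in> ?Q" for T using that by (auto simp: card_insert_if)
    show "?P \<union> ?Q \<subseteq> Pow ({1..\<nu>} \<times> {..<k})"
    proof
      fix T assume T: "T \<in> ?P \<union> ?Q"
      from shape[OF T] obtain i where i: "i < \<nu> div 2" "T \<subseteq> {2 * i + 1, 2 * i + 2} \<times> {..<k}" by blast
      have "{2 * i + 1, 2 * i + 2} \<subseteq> {1..\<nu>}" using i(1) by auto
      then show "T \<in> Pow ({1..\<nu>} \<times> {..<k})" using i(2) by auto
    qed
    show "\<not> T \<subseteq> {j} \<times> {..<k}" if T: "T \<in> ?P \<union> ?Q" for T j
    proof
      assume "T \<subseteq> {j} \<times> {..<k}"
      moreover obtain i where "pr i \<subseteq> T" using shape[OF T] by blast
      ultimately have "pr i \<subseteq> {j} \<times> {..<k}" by (rule subset_trans[rotated])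
      then show False by auto
    qed
    fix T T' j
    assume T: "T \<in> ?P \<union> ?Q" "T' \<in> ?P \<union> ?Q" and h: "T \<inter> ({j} \<times> {..<k}) \<noteq> {}" "T \<inter> T' \<inter> ({j} \<times> {..<k}) = {}"
    obtain i where i: "pr i \<subseteq> T" "T \<subseteq> {2 * i + 1, 2 * i + 2} \<times> {..<k}" using shape[OF T(1)] by blast
    obtain i' where i': "pr i' \<subseteq> T'" "T' \<subseteq> {2 * i' + 1, 2 * i' + 2} \<times> {..<k}" using shape[OF T(2)] by blast
    have j: "j = 2 * i + 1 \<or> j = 2 * i + 2" using h(1) i(2) by auto
    then have "(j, 0) \<in> T" "(j, 0) \<in> {j} \<times> {..<k}" using i(1) k by auto
    then have "(j, 0) \<notin> T'" using h(2) by blast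
    then have "i \<noteq> i'" using i'(1) j by auto
    then have dis: "{2 * i + 1, 2 * i + 2} \<inter> {2 * i' + 1, 2 * i' + 2} = {}" by auto
    then have "T' \<inter> ({j} \<times> {..<k}) = {}" using i'(2) j by auto
    moreover have "T - T' - {j} \<times> {..<k} \<noteq> {}"
    proof -
      define j' where "j' = (if j = 2 * i + 1 then 2 * i + 2 else 2 * i + 1)"
      have "(j', 0) \<in> T" "j' \<noteq> j" "j' \<in> {2 * i + 1, 2 * i + 2}" using i(1) j by (auto simp: j'_def)
      moreover have "(j', 0) \<notin> T'" using i'(2) dis \<open>j' \<in> _\<close> by blast
      ultimately show ?thesis by blast
    qed
    moreover have "finite T" using i(2) by (rule finite_subset) simp
    ultimately show "card (T \<inter> ({j} \<times> {..<k})) < card (T' - T - {j} \<times> {..<k}) \<or>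
       card (T' \<inter> ({j} \<times> {..<k})) < card (T - T' - {j} \<times> {..<k})"
      by (simp add: card_gt_0_iff)
  qed
  then show ?thesis unfolding cP cQ .
qed

text \<open>Each triple of block numbers is copied to the positions \<open>1..k-1\<close>; position
  0 carries the pairs. Against a disjoint trace a triple keeps two points outside the block, more
  than the one point that a trace can have inside. Two triples that meet have the same position and
  share only one block number, which leaves the needed point.\<close>

lemma lower_bound_triples:
  "binom m (int k - 1) + (\<nu> div 2) * binom m (int k - 3)
     + (k - 1) * turan_number 3 \<nu> (tight_path 3 2) * binom m (int k - 4) + \<nu>
   \<le> max_cluster_free (k * \<nu> + m + 1) k 3 (int \<nu>)"
proof -
  obtain E where E: "E \<subseteq> nsets {1..\<nu>} 3" "card E = turan_number 3 \<nu> (tight_path 3 2)"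
    and EE: "\<And>e e'. e \<in> E \<Longrightarrow> e' \<in> E \<Longrightarrow> e \<noteq> e' \<Longrightarrow> card (e \<inter> e') \<le> 1"
    using turan_tight_attained by metis
  have e3: "finite e" "card e = 3" "e \<subseteq> {1..\<nu>}" if "e \<in> E" for e using E(1) that by (auto simp: nsets_def)
  have finE: "finite E" using E(1) by (rule finite_subset) (simp add: finite_imp_finite_nsets)
  let ?I = "{..<\<nu> div 2}"
  let ?f = "\<lambda>(e,a). e \<times> {a::nat}"
  let ?P = "pr ` ?I" and ?Q = "?f ` (E \<times> {1..<k})"
  have inj: "inj_on ?f (E \<times> {1..<k})"
  proof (rule inj_onI, clarify)
    fix e a e' a' assume h: "e \<in> E" "e' \<in> E" "e \<times> {a} = e' \<times> {a'}"
    have "e \<noteq> {}" using e3[OF h(1)] by auto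
    then show "e = e' \<and> a = a'" using h(3) by (auto simp: times_eq_iff)
  qed
  have cP: "card ?P = \<nu> div 2" using pr_inj by (subst card_image) (auto simp: inj_on_def)
  have cQ: "card ?Q = (k - 1) * turan_number 3 \<nu> (tight_path 3 2)"
    using inj E(2) by (simp add: card_image card_cartesian_product)
  have fib: "(e \<times> {a}) - {j} \<times> {..<k} = (e - {j}) \<times> {a}" "(e \<times> {a}) \<inter> {j} \<times> {..<k} = (e \<inter> {j}) \<times> {a}"
    if "a < k" for e j a using that by auto
  have "binom m (int k - 1) + card ?P * binom m (int k - 3) + card ?Q * binom m (int k - 4) + \<nu>
    \<le> max_cluster_free (k * \<nu> + m + 1) k 3 (int \<nu>)"
  proof (rule lower_bound_aux)
    show "finite ?P" "finite ?Q" using finE by auto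
    show "card T = 2" if "T \<in> ?P" for T using that by auto
    show "card T = 3" if "T \<in> ?Q" for T using that e3 by (auto simp: card_cartesian_product)
    have "?P \<subseteq> Pow ({1..\<nu>} \<times> {..<k})" using k by auto
    moreover have "?Q \<subseteq> Pow ({1..\<nu>} \<times> {..<k})" using e3 by auto
    ultimately show "?P \<union> ?Q \<subseteq> Pow ({1..\<nu>} \<times> {..<k})" by simp
    have big: "2 \<le> card (e - {j})" if "e \<in> E" for e j
      using e3[OF that] by (simp add: card_Diff_singleton_if)
    show out: "\<not> T \<subseteq> {j} \<times> {..<k}" if T: "T \<in> ?P \<union> ?Q" for T j
    proof (cases "T \<in> ?P")
      case False
      then obtain e a where e: "e \<in> E" "T = e \<times> {a}" using T by auto
      show ?thesis
      proof
        assume "T \<subseteq> {j} \<times> {..<k}"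
        then have "e - {j} = {}" using e(2) by auto
        then show False using big[OF e(1), of j] by (metis card.empty not_numeral_le_zero)
      qed
    next
      case True
      then obtain i where "T = pr i" by blast
      then show ?thesis by simp
    qed
    fix T T' and j :: nat
    let ?B = "{j} \<times> {..<k}"
    assume T: "T \<in> ?P \<union> ?Q" "T' \<in> ?P \<union> ?Q" and h: "T \<inter> ?B \<noteq> {}" "T \<inter> T' \<inter> ?B = {}"
    have one: "card (X \<inter> ?B) \<le> 1" if "X \<in> ?P \<union> ?Q" for X
    proof -
      have "\<exists>a. X \<inter> ?B \<subseteq> {(j,a)}" using that by auto
      then show ?thesis by (metis card_mono card.empty card_insert_disjoint finite.intros empty_iff One_nat_def)
    qed
    have finP: "finite X" if "X \<in> ?P \<union> ?Q" for X using that e3 by auto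
    show "card (T \<inter> ?B) < card (T' - T - ?B) \<or> card (T' \<inter> ?B) < card (T - T' - ?B)"
    proof (cases "T \<in> ?P")
      case True
      then obtain i where i: "T = pr i" by blast
      have ji: "j = 2 * i + 1 \<or> j = 2 * i + 2" using h(1) i by auto
      have jT: "(j,0) \<in> T" "(j,0) \<in> ?B" using ji i k by auto
      show ?thesis
      proof (cases "T' \<in> ?P")
        case True
        then obtain i' where i': "T' = pr i'" by blast
        have "i \<noteq> i'" using h(2) i i' jT by auto
        then have dis: "T \<inter> T' = {}" using i i' by auto
        have "(j,0) \<notin> T'" using h(2) jT by blast
        then have "T' \<inter> ?B = {}" using i' by auto
        moreover have "T - T' - ?B \<noteq> {}" using dis out[OF T(1), of j] by blast
        ultimately show ?thesis using finP[OF T(1)] by (simp add: card_gt_0_iff)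
      next
        case False
        then obtain e a where e: "e \<in> E" "a \<in> {1..<k}" "T' = e \<times> {a}" using T(2) by auto
        have "T' - T - ?B = (e - {j}) \<times> {a}" using i e by auto
        then have "2 \<le> card (T' - T - ?B)" using big[OF e(1), of j] by (simp add: card_cartesian_product)
        then show ?thesis using one[OF T(1)] by linarith
      qed
    next
      case False
      then obtain e a where e: "e \<in> E" "a \<in> {1..<k}" "T = e \<times> {a}" using T(1) by auto
      have TB: "T - ?B = (e - {j}) \<times> {a}" using e by auto
      show ?thesis
      proof (cases "T \<inter> T' = {}")
        case True
        then have "T - T' - ?B = (e - {j}) \<times> {a}" using TB by blast
        then have "2 \<le> card (T - T' - ?B)" using big[OF e(1), of j] by (simp add: card_cartesian_product)
        then show ?thesis using one[OF T(2)] by linarith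
      next
        case False
        have "T' \<notin> ?P" using False e by auto
        then obtain e' a' where e': "e' \<in> E" "T' = e' \<times> {a'}" using T(2) by auto
        then have aa: "a' = a" using False e by auto
        have je: "j \<in> e" using h(1) e by auto
        then have je': "j \<notin> e'" using h(2) e e' aa by auto
        then have "e \<noteq> e'" using je by blast
        then have "card (e \<inter> e') \<le> 1" using EE e e' by blast
        \<comment> \<open>Of the three block numbers in \<open>e\<close>, one is \<open>j\<close>
          and at most one lies in \<open>e'\<close>; a third remains.\<close>
        have "card (e - e' - {j}) > 0"
        proof -
          have "e - e' = e - (e \<inter> e')" by blast
          then have "card (e - e') \<ge> 2"
            using \<open>card (e \<inter> e') \<le> 1\<close> e3[OF e(1)] by (simp add: card_Diff_subset)
          then show ?thesis using je je' e3[OF e(1)] by (simp add: card_Diff_singleton_if)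
        qed
        moreover have "T - T' - ?B = (e - e' - {j}) \<times> {a}" using e e' aa by auto
        moreover have "T' \<inter> ?B = {}" using e' je' by auto
        ultimately show ?thesis by (simp add: card_cartesian_product)
      qed
    qed
  qed
  then show ?thesis unfolding cP cQ .
qed

end

section \<open>Upper bound\<close>

lemma covered_triple_meets:
  assumes "F \<subseteq> nsets V k" "cluster_free 3 k F" "A \<in> F" "A' \<in> F" "B \<in> F"
    and "A \<noteq> A'" "A \<noteq> B" "A' \<noteq> B" "A \<subseteq> A' \<union> B"
  shows "A \<inter> A' \<inter> B \<noteq> {}"
proof -
  have "A \<union> A' \<union> B = A' \<union> B" using assms(9) by blast
  moreover have "card A' = k" "card B = k" using assms(1,4,5) by (auto simp: nsets_def)
  ultimately have "card (A \<union> A' \<union> B) \<le> 2 * k" using card_Un_le[of A' B] by simp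
  then show ?thesis using cluster_free_3D[OF assms(2,1,3,4,5,6,7,8)] by blast
qed

definition missing :: "'a set set \<Rightarrow> nat \<Rightarrow> 'a \<Rightarrow> 'a set \<Rightarrow> 'a set set" where
  "missing F k x W = {R \<in> nsets W (k - 1). insert x R \<notin> F}"

lemma finite_missing: "finite W \<Longrightarrow> finite (missing F k x W)"
  by (simp add: missing_def finite_imp_finite_nsets)

text \<open>For a \<open>(k - 2)\<close>-set \<open>S\<close> in \<open>W - B\<close>, either
  \<open>insert w S\<close> is missing or \<open>insert x (insert w S)\<close> is an edge. In the
  second case this edge is covered by \<open>B\<close> and \<open>insert x (insert u S)\<close> for
  every other \<open>u\<close>, without a common point of the three, so every such
  \<open>insert u S\<close> is missing. The factor \<open>card W + 1 - k\<close> is the number of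
  these \<open>u\<close>.\<close>

lemma missing_through_point:
  assumes k: "2 \<le> k" and F: "F \<subseteq> nsets V k" "cluster_free 3 k F"
    and W: "finite W" "x \<notin> W" and B: "B \<in> F" "x \<notin> B" "w \<in> B" "w \<in> W"
  shows "(card W + 1 - k) * ((card W - k) choose (k - 2))
    \<le> (card W + 1 - k) * card {R \<in> missing F k x W. w \<in> R} + (k - 1) * card (missing F k x W)"
proof -
  let ?N = "nsets (W - B) (k - 2)" and ?m = "missing F k x W"
  define E where "E = {S \<in> ?N. insert x (insert w S) \<in> F}"
  have finN: "finite ?N" using W by (simp add: finite_imp_finite_nsets)
  have finB: "finite B" "card B = k" using B F(1) by (auto simp: nsets_def)
  have finE: "finite E" using finN by (simp add: E_def)
  have kk: "Suc (k - 2) = k - 1" using k by simp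
  have S: "finite S" "card S = k - 2" "S \<subseteq> W" "S \<inter> B = {}" "w \<notin> S" "x \<notin> S" if "S \<in> ?N" for S
    using that B W by (auto simp: nsets_def)
  have "(card W - k) choose (k - 2) \<le> card ?N"
  proof -
    have "card W - k \<le> card (W - B)" using diff_card_le_card_Diff[OF finB(1), of W] finB by simp
    then show ?thesis by (simp add: card_nsets binomial_right_mono)
  qed
  also have "card ?N = card (?N - E) + card E"
  proof -
    have "E \<subseteq> ?N" by (auto simp: E_def)
    then show ?thesis using card_Diff_subset[OF finE, of ?N] card_mono[OF finN, of E] by simp
  qed
  also have "card (?N - E) \<le> card {R \<in> ?m. w \<in> R}"
  proof (rule card_inj_on_le)
    show "inj_on (insert w) (?N - E)"
    proof (rule inj_onI)
      fix S S' assume "S \<in> ?N - E" "S' \<in> ?N - E" "insert w S = insert w S'"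
      moreover have "w \<notin> S" "w \<notin> S'" using S(5)[of S] S(5)[of S'] calculation by auto
      ultimately show "S = S'" by (simp add: insert_ident)
    qed
    show "insert w ` (?N - E) \<subseteq> {R \<in> ?m. w \<in> R}"
    proof (rule image_subsetI)
      fix S assume "S \<in> ?N - E"
      then have SN: "S \<in> ?N" and "insert x (insert w S) \<notin> F" by (auto simp: E_def)
      moreover have "insert w S \<in> nsets W (k - 1)"
        using S[OF SN] B(4) kk by (simp add: nsets_def)
      ultimately show "insert w S \<in> {R \<in> ?m. w \<in> R}" by (simp add: missing_def)
    qed
    show "finite {R \<in> ?m. w \<in> R}" using finite_missing[OF W(1)] by simp
  qed
  finally have 1: "(card W - k) choose (k - 2) \<le> card {R \<in> ?m. w \<in> R} + card E" by simp
  have 2: "card E * (card W + 1 - k) \<le> (k - 1) * card ?m"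
  proof -
    have cR: "card (W - insert w S) = card W + 1 - k" if "S \<in> E" for S
    proof -
      have SN: "S \<in> ?N" using that by (simp add: E_def)
      have "insert w S \<subseteq> W" using S[OF SN] B by simp
      then have "card (W - insert w S) = card W - Suc (k - 2)"
        using S[OF SN] by (simp add: card_Diff_subset)
      then show ?thesis using kk k by simp
    qed
    have "card E * (card W + 1 - k) = (\<Sum>S\<in>E. card (W - insert w S))" using cR by simp
    also have "\<dots> = card (SIGMA S:E. W - insert w S)"
      using finE W by (simp add: card_SigmaI)
    \<comment> \<open>Recording \<open>u\<close> along with \<open>insert u S\<close> makes the map
      injective; each missing set then occurs at most \<open>k - 1\<close> times.\<close>
    also have "\<dots> \<le> card (SIGMA R:?m. R)"
    proof (rule card_inj_on_le)
      show "inj_on (\<lambda>(S,u). (insert u S, u)) (SIGMA S:E. W - insert w S)"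
        by (auto simp: inj_on_def dest: insert_ident[THEN iffD1, rotated 2])
      show "(\<lambda>(S,u). (insert u S, u)) ` (SIGMA S:E. W - insert w S) \<subseteq> (SIGMA R:?m. R)"
      proof (rule image_subsetI)
        fix p assume "p \<in> (SIGMA S:E. W - insert w S)"
        then obtain S u where p: "p = (S, u)" and SE: "S \<in> E" and u: "u \<in> W" "u \<notin> insert w S" by blast
        have SN: "S \<in> ?N" and AF: "insert x (insert w S) \<in> F" using SE by (auto simp: E_def)
        have "insert x (insert u S) \<notin> F"
        proof
          assume A'F: "insert x (insert u S) \<in> F"
          have "w \<notin> insert x (insert u S)" using u S[OF SN] B W by auto
          then have "insert x (insert w S) \<inter> insert x (insert u S) \<inter> B \<noteq> {}"
            using covered_triple_meets[OF F AF A'F B(1)] B by blast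
          then show False using S[OF SN] B u \<open>w \<notin> insert x (insert u S)\<close> by auto
        qed
        moreover have "insert u S \<in> nsets W (k - 1)" using S[OF SN] u kk by (simp add: nsets_def)
        ultimately show "(case p of (S, u) \<Rightarrow> (insert u S, u)) \<in> (SIGMA R:?m. R)"
          by (simp add: p missing_def)
      qed
      show "finite (SIGMA R:?m. R)"
        using finite_missing[OF W(1)] by (auto simp: missing_def nsets_def)
    qed
    also have "\<dots> = (\<Sum>R\<in>?m. card R)"
      using finite_missing[OF W(1)] by (subst card_SigmaI) (auto simp: missing_def nsets_def)
    also have "\<dots> = (\<Sum>R\<in>?m. k - 1)" by (rule sum.cong) (auto simp: missing_def nsets_def)
    finally show ?thesis by (simp add: mult.commute)
  qed
  have "(card W + 1 - k) * ((card W - k) choose (k - 2))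
    \<le> (card W + 1 - k) * (card {R \<in> ?m. w \<in> R} + card E)"
    using 1 by (rule mult_le_mono2)
  also have "\<dots> = (card W + 1 - k) * card {R \<in> ?m. w \<in> R} + card E * (card W + 1 - k)"
    by (simp add: algebra_simps)
  finally show ?thesis using 2 by linarith
qed

lemma choose_ge_linear: "1 \<le> j \<Longrightarrow> j \<le> n \<Longrightarrow> n + 1 - j \<le> n choose j"
proof (induction n)
  case (Suc n)
  obtain i where j: "j = Suc i" using Suc.prems by (cases j) auto
  show ?case
  proof (cases "j \<le> n")
    case True
    then have "n + 1 - j \<le> n choose j" using Suc by simp
    moreover have "n choose i \<noteq> 0" using True j by simp
    moreover have "Suc n choose j = (n choose i) + (n choose j)" by (simp add: j)
    ultimately show ?thesis using True by arith
  next
    case False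
    then have "j = Suc n" using Suc.prems by simp
    then show ?thesis by simp
  qed
qed simp

text \<open>The bound on \<open>card S\<close> forces \<open>T\<close> to be nonempty. For such
  \<open>S\<close> the traces on the blocks are not \<open>spread\<close>, so these sets have to be
  counted separately.\<close>

definition inner_trace :: "'a set set \<Rightarrow> nat \<Rightarrow> 'a \<Rightarrow> 'a set set \<Rightarrow> 'a set \<Rightarrow> 'a set set" where
  "inner_trace F k x M W = {S. S \<subseteq> W \<and> card S + 2 \<le> k \<and>
     (\<exists>B\<in>M. \<exists>T\<subseteq>B. card T + card S + 1 = k \<and> insert x (S \<union> T) \<in> F)}"

text \<open>Let \<open>S\<close> extend by \<open>T\<close> inside a block \<open>B\<close>.
  Replacing \<open>T\<close> by any \<open>Q\<close> of the same size in \<open>W - S\<close> gives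
  a missing set, because the edge with \<open>T\<close> is covered by \<open>B\<close> and the set
  with \<open>Q\<close>, without a common point. Thus \<open>S\<close> lies in at least
  \<open>card W + 2 - k\<close> missing sets, and a missing set has at most
  \<open>2 ^ (k - 1)\<close> subsets.\<close>

lemma card_inner_trace:
  assumes k: "2 \<le> k" "k \<le> card W + 1" and F: "F \<subseteq> nsets V k" "cluster_free 3 k F"
    and W: "finite W" "x \<notin> W" and M: "M \<subseteq> F" "x \<notin> \<Union>M" "\<Union>M \<inter> W = {}"
  shows "card (inner_trace F k x M W) * (card W + 2 - k) \<le> 2 ^ (k - 1) * card (missing F k x W)"
proof -
  let ?I = "inner_trace F k x M W" and ?m = "missing F k x W"
  have finI: "finite ?I" using W by (auto simp: inner_trace_def intro: finite_subset[of _ "Pow W"])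
  have finm: "finite ?m" by (rule finite_missing[OF W(1)])
  have many: "card W + 2 - k \<le> card {R \<in> ?m. S \<subseteq> R}" if SI: "S \<in> ?I" for S
  proof -
    obtain B T where S: "S \<subseteq> W" "card S + 2 \<le> k" and B: "B \<in> M" "T \<subseteq> B"
      and T: "card T + card S + 1 = k" "insert x (S \<union> T) \<in> F"
      using SI by (auto simp: inner_trace_def)
    have finS: "finite S" using S W finite_subset by blast
    have "T \<noteq> {}" using T S by auto
    have TW: "T \<inter> W = {}" "B \<inter> W = {}" "x \<notin> B" using B M by blast+
    let ?Q = "nsets (W - S) (card T)"
    have miss: "S \<union> Q \<in> ?m" if Q: "Q \<in> ?Q" for Q
    proof -
      have Q': "Q \<subseteq> W - S" "finite Q" "card Q = card T" using Q by (auto simp: nsets_def)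
      have "card (S \<union> Q) = card S + card T" using Q' finS by (subst card_Un_disjoint) auto
      then have "S \<union> Q \<in> nsets W (k - 1)" using Q' S finS T(1) by (auto simp: nsets_def)
      moreover have "insert x (S \<union> Q) \<notin> F"
      proof
        assume A'F: "insert x (S \<union> Q) \<in> F"
        have "T \<inter> insert x (S \<union> Q) = {}" using TW B Q' S by blast
        then have "insert x (S \<union> T) \<noteq> insert x (S \<union> Q)" using \<open>T \<noteq> {}\<close> by blast
        moreover have "insert x (S \<union> T) \<subseteq> insert x (S \<union> Q) \<union> B" using B by blast
        moreover have "B \<in> F" "insert x (S \<union> T) \<noteq> B" "insert x (S \<union> Q) \<noteq> B" using B M by auto
        ultimately have "insert x (S \<union> T) \<inter> insert x (S \<union> Q) \<inter> B \<noteq> {}"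
          by (intro covered_triple_meets[OF F T(2) A'F])
        moreover have "(S \<union> Q) \<inter> B = {}" using S Q' TW by blast
        ultimately show False using TW(3) by blast
      qed
      ultimately show ?thesis by (simp add: missing_def)
    qed
    have "card W + 2 - k \<le> card (W - S) + 1 - card T"
      using S(1) finS T(1) k W(1) by (simp add: card_Diff_subset card_mono)
    also have "\<dots> \<le> card (W - S) choose card T"
    proof (rule choose_ge_linear)
      show "1 \<le> card T" using T S by linarith
      show "card T \<le> card (W - S)"
        using S(1) finS T(1) k W(1) by (simp add: card_Diff_subset)
    qed
    also have "\<dots> = card ?Q" by (simp add: card_nsets)
    also have "\<dots> \<le> card {R \<in> ?m. S \<subseteq> R}"
    proof (rule card_inj_on_le)
      show "inj_on ((\<union>) S) ?Q" by (auto simp: inj_on_def nsets_def)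
      show "(\<union>) S ` ?Q \<subseteq> {R \<in> ?m. S \<subseteq> R}" using miss by auto
    qed (use finm in simp)
    finally show ?thesis .
  qed
  have "card ?I * (card W + 2 - k) = (\<Sum>S\<in>?I. card W + 2 - k)" by simp
  also have "\<dots> \<le> (\<Sum>S\<in>?I. card {R \<in> ?m. S \<subseteq> R})" by (intro sum_mono many)
  also have "\<dots> = (\<Sum>R\<in>?m. card {S \<in> ?I. S \<subseteq> R})"
    by (rule sum_multicount_gen[OF finI finm]) simp
  also have "\<dots> \<le> (\<Sum>R\<in>?m. 2 ^ (k - 1))"
  proof (rule sum_mono)
    fix R assume "R \<in> ?m"
    then have R: "finite R" "card R = k - 1" by (auto simp: missing_def nsets_def)
    have "card {S \<in> ?I. S \<subseteq> R} \<le> card (Pow R)" using R by (intro card_mono) auto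
    then show "card {S \<in> ?I. S \<subseteq> R} \<le> 2 ^ (k - 1)" using R by (simp add: card_Pow)
  qed
  finally show ?thesis by (simp add: mult.commute)
qed

section \<open>Counting the edges through the centre\<close>

definition traces :: "'a set set \<Rightarrow> nat \<Rightarrow> 'a \<Rightarrow> 'a set \<Rightarrow> 'a set \<Rightarrow> 'a set set" where
  "traces F k x U S = {T \<in> nsets U (k - 1 - card S). insert x (S \<union> T) \<in> F}"

text \<open>Besides \<open>T \<union> T' - B\<close>, the block \<open>B\<close> and the two edges
  over \<open>S\<close> span at most \<open>k + 1 + card S\<close> points. If
  \<open>T \<union> T' - B\<close> has at most \<open>k - 1 - card S\<close> points and
  \<open>T \<inter> T' \<inter> B\<close> is empty, they form a cluster.\<close>

lemma spread_traces:
  assumes F: "F \<subseteq> nsets V k" "cluster_free 3 k F" and W: "finite W" "x \<notin> W"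
    and M: "M \<subseteq> F" "x \<notin> \<Union>M" "\<Union>M \<inter> W = {}"
    and S: "S \<subseteq> W" "card S + 2 \<le> k" "S \<notin> inner_trace F k x M W"
  shows "spread M (k - 1 - card S) (traces F k x (\<Union>M) S)"
  unfolding spread_def
proof (intro conjI ballI impI)
  let ?H = "traces F k x (\<Union>M) S"
  have finS: "finite S" using S W finite_subset by blast
  show "?H \<subseteq> nsets (\<Union>M) (k - 1 - card S)" by (auto simp: traces_def)
  fix T assume T: "T \<in> ?H"
  then have TU: "T \<subseteq> \<Union>M" "finite T" "card T + card S + 1 = k" "insert x (S \<union> T) \<in> F"
    using S(2) by (auto simp: traces_def nsets_def)
  show "\<not> T \<subseteq> B" if "B \<in> M" for B using S TU that by (auto simp: inner_trace_def)
  fix T' B assume T': "T' \<in> ?H" and ne: "T \<noteq> T'" and B: "B \<in> M"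
  have TU': "T' \<subseteq> \<Union>M" "finite T'" "card T' + card S + 1 = k" "insert x (S \<union> T') \<in> F"
    using T' S(2) by (auto simp: traces_def nsets_def)
  show "T \<inter> T' \<inter> B \<noteq> {} \<or> k - 1 - card S < card (T \<union> T' - B)"
  proof (rule ccontr)
    assume "\<not> ?thesis"
    then have e: "T \<inter> T' \<inter> B = {}" and le: "card (T \<union> T' - B) \<le> k - 1 - card S" by auto
    let ?A = "insert x (S \<union> T)" and ?A' = "insert x (S \<union> T')"
    have BF: "B \<in> F" "x \<notin> B" using B M by auto
    have cB: "card B = k" "finite B" using BF F(1) by (auto simp: nsets_def)
    have xT: "x \<notin> T" "x \<notin> T'" "S \<inter> T = {}" "S \<inter> T' = {}" "S \<inter> B = {}"
      using TU TU' M S B by blast+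
    have "?A \<noteq> ?A'"
    proof
      assume "?A = ?A'"
      then have "?A - insert x S = ?A' - insert x S" by simp
      moreover have "?A - insert x S = T" "?A' - insert x S = T'" using xT by auto
      ultimately show False using ne by simp
    qed
    moreover have "?A \<noteq> B" "?A' \<noteq> B" using BF by auto
    moreover have "card (?A \<union> ?A' \<union> B) \<le> 2 * k"
    proof -
      have "?A \<union> ?A' \<union> B = (B \<union> insert x S) \<union> (T \<union> T' - B)" by blast
      then have "card (?A \<union> ?A' \<union> B) \<le> card B + card (insert x S) + card (T \<union> T' - B)"
        using card_Un_le[of "B \<union> insert x S" "T \<union> T' - B"] card_Un_le[of B "insert x S"] by simp
      moreover have "card (insert x S) \<le> Suc (card S)" by (simp add: card_insert_if finS)
      ultimately show ?thesis using cB le S(2) by linarith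
    qed
    ultimately have "?A \<inter> ?A' \<inter> B \<noteq> {}"
      using cluster_free_3D[OF F(2,1) TU(4) TU'(4) BF(1)] by blast
    then show False using e xT BF(2) by blast
  qed
qed

text \<open>Edges through \<open>x\<close> are sorted by their trace \<open>S\<close> on
  \<open>W\<close>. If \<open>card S = k - 1\<close>, only sets that are not missing contribute,
  once each; smaller \<open>S\<close> contribute at most the cap, except that members of
  \<open>I\<close> get the trivial bound \<open>2 ^ card U\<close>.\<close>

lemma card_star_le:
  fixes cap :: "nat \<Rightarrow> real"
  assumes k: "1 \<le> k" and F: "F \<subseteq> nsets (insert x (U \<union> W)) k"
    and fin: "finite U" "finite W" and dis: "x \<notin> U" "x \<notin> W" "U \<inter> W = {}"
    and I: "finite I" and cap: "\<And>S. \<lbrakk>S \<subseteq> W; card S + 2 \<le> k; S \<notin> I\<rbrakk> \<Longrightarrow>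
      real (card (traces F k x U S)) \<le> cap (k - 1 - card S)"
    and cap0: "\<And>j. 0 \<le> cap j"
  shows "real (card {A \<in> F. x \<in> A}) \<le> real (card W choose (k - 1)) - real (card (missing F k x W))
    + 2 ^ card U * real (card I) + (\<Sum>i<k - 1. cap (k - 1 - i) * real (card W choose i))"
proof -
  let ?H = "traces F k x U"
  let ?N = "\<lambda>i. nsets W i"
  have finN: "finite (?N i)" for i using fin by (simp add: finite_imp_finite_nsets)
  have finH: "finite (?H S)" for S using fin by (simp add: traces_def finite_imp_finite_nsets)
  have cov: "{A \<in> F. x \<in> A} \<subseteq> (\<Union>i\<in>{..k - 1}. \<Union>S\<in>?N i. (\<lambda>T. insert x (S \<union> T)) ` ?H S)"
  proof
    fix A assume "A \<in> {A \<in> F. x \<in> A}"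
    then have A: "A \<in> F" "x \<in> A" by auto
    have fA: "finite A" "card A = k" "A \<subseteq> insert x (U \<union> W)" using A F by (auto simp: nsets_def)
    let ?S = "A \<inter> W" and ?T = "A \<inter> U"
    have eq: "A = insert x (?S \<union> ?T)" using A fA by blast
    have "card A = Suc (card (?S \<union> ?T))" using fA dis by (subst eq) (subst card_insert_disjoint, auto)
    also have "card (?S \<union> ?T) = card ?S + card ?T" using fA dis by (intro card_Un_disjoint) auto
    finally have c: "card ?T = k - 1 - card ?S" "card ?S \<le> k - 1" using fA by auto
    have "?T \<in> ?H ?S" using c fA A(1) eq by (simp add: traces_def nsets_def)
    moreover have "?S \<in> ?N (card ?S)" using fA by (simp add: nsets_def)
    ultimately show "A \<in> (\<Union>i\<in>{..k - 1}. \<Union>S\<in>?N i. (\<lambda>T. insert x (S \<union> T)) ` ?H S)"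
      using eq c(2) by (intro UN_I[of "card ?S"] UN_I[of ?S] image_eqI[of _ _ ?T]) auto
  qed
  have "card {A \<in> F. x \<in> A} \<le> card (\<Union>i\<in>{..k - 1}. \<Union>S\<in>?N i. (\<lambda>T. insert x (S \<union> T)) ` ?H S)"
    using cov finN finH by (intro card_mono) auto
  also have "\<dots> \<le> (\<Sum>i\<le>k - 1. card (\<Union>S\<in>?N i. (\<lambda>T. insert x (S \<union> T)) ` ?H S))"
    by (intro card_UN_le) simp
  also have "\<dots> \<le> (\<Sum>i\<le>k - 1. \<Sum>S\<in>?N i. card (?H S))"
  proof (rule sum_mono)
    fix i
    have "card (\<Union>S\<in>?N i. (\<lambda>T. insert x (S \<union> T)) ` ?H S) \<le> (\<Sum>S\<in>?N i. card ((\<lambda>T. insert x (S \<union> T)) ` ?H S))"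
      by (rule card_UN_le[OF finN])
    also have "\<dots> \<le> (\<Sum>S\<in>?N i. card (?H S))" by (intro sum_mono card_image_le finH)
    finally show "card (\<Union>S\<in>?N i. (\<lambda>T. insert x (S \<union> T)) ` ?H S) \<le> (\<Sum>S\<in>?N i. card (?H S))" .
  qed
  also have "\<dots> = (\<Sum>i<k - 1. \<Sum>S\<in>?N i. card (?H S)) + (\<Sum>S\<in>?N (k - 1). card (?H S))"
    by (simp add: lessThan_Suc_atMost[symmetric])
  finally have "real (card {A \<in> F. x \<in> A})
    \<le> real ((\<Sum>i<k - 1. \<Sum>S\<in>?N i. card (?H S)) + (\<Sum>S\<in>?N (k - 1). card (?H S)))"
    by (rule of_nat_mono)
  then have main: "real (card {A \<in> F. x \<in> A})
    \<le> (\<Sum>i<k - 1. \<Sum>S\<in>?N i. real (card (?H S))) + real (\<Sum>S\<in>?N (k - 1). card (?H S))"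
    by simp
  have top: "(\<Sum>S\<in>?N (k - 1). card (?H S)) + card (missing F k x W) \<le> card W choose (k - 1)"
  proof -
    have "card (?H S) \<le> (if S \<in> missing F k x W then 0 else 1)" if S: "S \<in> ?N (k - 1)" for S
    proof -
      have "k - 1 - card S = 0" using S by (simp add: nsets_def)
      then have "?H S \<subseteq> {T. T = {} \<and> insert x S \<in> F}" by (auto simp: traces_def nsets_def)
      then have "?H S \<subseteq> (if insert x S \<in> F then {{}} else {})" by auto
      from card_mono[OF _ this] show ?thesis using S by (auto simp: missing_def)
    qed
    then have "(\<Sum>S\<in>?N (k - 1). card (?H S)) \<le> (\<Sum>S\<in>?N (k - 1). if S \<in> missing F k x W then 0 else 1)"
      by (rule sum_mono)
    also have "\<dots> = card (?N (k - 1) - missing F k x W)"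
      using finN by (simp add: sum.If_cases Diff_eq)
    also have "\<dots> = card (?N (k - 1)) - card (missing F k x W)"
      by (intro card_Diff_subset finite_missing fin) (auto simp: missing_def)
    finally have "(\<Sum>S\<in>?N (k - 1). card (?H S)) \<le> card (?N (k - 1)) - card (missing F k x W)" .
    moreover have "card (missing F k x W) \<le> card (?N (k - 1))"
      using finN by (intro card_mono) (auto simp: missing_def)
    ultimately show ?thesis by (simp add: card_nsets)
  qed
  have low: "(\<Sum>i<k - 1. \<Sum>S\<in>?N i. real (card (?H S)))
    \<le> (\<Sum>i<k - 1. cap (k - 1 - i) * real (card W choose i)) + 2 ^ card U * real (card I)"
  proof -
    have HU: "card (?H S) \<le> 2 ^ card U" for S
    proof -
      have "card (?H S) \<le> card (Pow U)" using fin by (intro card_mono) (auto simp: traces_def nsets_def)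
      then show ?thesis using fin by (simp add: card_Pow)
    qed
    have "(\<Sum>i<k - 1. \<Sum>S\<in>?N i. real (card (?H S)))
      \<le> (\<Sum>i<k - 1. \<Sum>S\<in>?N i. cap (k - 1 - i) + (if S \<in> I then 2 ^ card U else 0))"
    proof (intro sum_mono)
      fix i S assume i: "i \<in> {..<k - 1}" and S: "S \<in> ?N i"
      have S': "S \<subseteq> W" "card S = i" "card S + 2 \<le> k" using S i by (auto simp: nsets_def)
      show "real (card (?H S)) \<le> cap (k - 1 - i) + (if S \<in> I then 2 ^ card U else 0)"
      proof (cases "S \<in> I")
        case True
        have "real (card (?H S)) \<le> real (2 ^ card U)" by (rule of_nat_mono[OF HU])
        then have "real (card (?H S)) \<le> cap (k - 1 - i) + 2 ^ card U" 
          using cap0[of "k - 1 - i"] by (simp only: of_nat_power of_nat_numeral)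
        then show ?thesis using True by (simp only: if_True)
      next
        case False
        then show ?thesis using cap[OF S'(1,3)] S'(2) by simp
      qed
    qed
    also have "\<dots> = (\<Sum>i<k - 1. cap (k - 1 - i) * real (card W choose i)) + 2 ^ card U * real (\<Sum>i<k - 1. card (?N i \<inter> I))"
      using finN by (simp add: sum.distrib sum.If_cases card_nsets sum_distrib_left mult.commute)
    also have "(\<Sum>i<k - 1. card (?N i \<inter> I)) \<le> card I"
    proof -
      have "(\<Sum>i<k - 1. card (?N i \<inter> I)) = card (\<Union>i<k - 1. ?N i \<inter> I)"
        using finN by (intro card_UN_disjoint[symmetric]) (auto simp: nsets_def)
      also have "\<dots> \<le> card I" using I by (intro card_mono) auto
      finally show ?thesis .
    qed
    finally show ?thesis by simp
  qed
  have "real (\<Sum>S\<in>?N (k - 1). card (?H S)) + real (card (missing F k x W)) \<le> real (card W choose (k - 1))"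
    using top by (metis of_nat_add of_nat_le_iff)
  then show ?thesis using main low by linarith
qed

section \<open>Estimates for binomial coefficients\<close>

lemma choose_Suc_le_shift:
  "s \<le> n \<Longrightarrow> n choose Suc j \<le> ((n - s) choose Suc j) + s * n ^ j"
proof (induction s)
  case (Suc s)
  have e: "n - s = Suc (n - Suc s)" using Suc.prems by simp
  have "(n - s) choose Suc j = ((n - Suc s) choose j) + ((n - Suc s) choose Suc j)"
    unfolding e by simp
  moreover have "(n - Suc s) choose j \<le> n ^ j"
  proof (cases "j \<le> n - Suc s")
    case True
    then have "(n - Suc s) choose j \<le> (n - Suc s) ^ j" by (rule binomial_le_pow)
    also have "\<dots> \<le> n ^ j" by (intro power_mono) auto
    finally show ?thesis .
  qed (simp add: binomial_eq_0)
  ultimately show ?case using Suc by simp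
qed simp

lemma choose_shift_ge:
  assumes "2 * s \<le> n" "s + j \<le> n" "1 \<le> j"
  shows "(real n / (2 * real j)) ^ j \<le> real ((n - s) choose j)"
proof -
  have "real n / (2 * real j) \<le> real (n - s) / real j"
    using assms by (simp add: field_simps of_nat_diff)
  then have "(real n / (2 * real j)) ^ j \<le> (real (n - s) / real j) ^ j"
    by (intro power_mono) auto
  also have "\<dots> \<le> real ((n - s) choose j)"
    using assms by (intro binomial_ge_n_over_k_pow_k) simp
  finally show ?thesis .
qed

text \<open>Source of the error term: binomials with lower index below \<open>k - 4\<close> are
  smaller by a factor of order \<open>m\<close>. For \<open>k < 5\<close> the sum is empty under
  truncated subtraction.\<close>

lemma sum_low_binomials_le:
  assumes "1 \<le> m" "k \<le> m"
  shows "(\<Sum>i<k - 4. real (m choose i)) \<le> real (k ^ Suc k) / real m * real (binom m (int k - 4))"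
proof (cases "5 \<le> k")
  case True
  define q where "q = k - 4"
  have q: "1 \<le> q" "q \<le> k" "q \<le> m" using True assms by (auto simp: q_def)
  have b: "binom m (int k - 4) = m choose q"
    using True by (simp add: binom_def q_def nat_diff_distrib)
  have "(\<Sum>i<q. real (m choose i)) \<le> (\<Sum>i<q. real m ^ (q - 1))"
  proof (rule sum_mono)
    fix i assume i: "i \<in> {..<q}"
    have "m choose i \<le> m ^ i" using i q by (intro binomial_le_pow) auto
    also have "\<dots> \<le> m ^ (q - 1)" using i assms by (intro power_increasing) auto
    finally show "real (m choose i) \<le> real m ^ (q - 1)" by (metis of_nat_le_iff of_nat_power)
  qed
  also have "\<dots> = real q * (real m ^ q / real m)"
    using q assms by (simp add: power_diff)
  also have "\<dots> = real q / real m * (real q ^ q * (real m / real q) ^ q)"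
    using q by (simp add: power_divide)
  also have "\<dots> \<le> real q / real m * (real q ^ q * real (m choose q))"
    using q by (intro mult_left_mono binomial_ge_n_over_k_pow_k) auto
  also have "\<dots> = real (q ^ Suc q) / real m * real (m choose q)" by simp
  also have "\<dots> \<le> real (k ^ Suc k) / real m * real (m choose q)"
  proof (intro mult_right_mono divide_right_mono)
    have "q ^ Suc q \<le> k ^ Suc q" using q by (intro power_mono) auto
    also have "\<dots> \<le> k ^ Suc k" using q by (intro power_increasing) auto
    finally show "real (q ^ Suc q) \<le> real (k ^ Suc k)" by (rule of_nat_mono)
  qed auto
  finally show ?thesis unfolding b q_def .
qed simp

section \<open>Caps for the number of traces\<close>

text \<open>A one-point trace lies inside a block, hence the value 0 away from
  \<open>inner_trace\<close>. Sizes 2 and 3 get the bounds for spread families; for larger sizes the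
  number of subsets of a set with \<open>k * \<nu>\<close> points is enough, as those terms are of
  lower order.\<close>

definition trace_cap :: "nat \<Rightarrow> nat \<Rightarrow> nat \<Rightarrow> real" where
  "trace_cap k \<nu> j = (if j = 1 then 0 else if j = 2 then real (\<nu> div 2)
     else if j = 3 then real k / 3 * real (\<nu> choose 2) + (real k - 1) * real \<nu>
     else 2 ^ (k * \<nu>))"

lemma sum_trace_cap_le:
  assumes "3 \<le> k"
  shows "(\<Sum>i<k - 1. trace_cap k \<nu> (k - 1 - i) * real (m choose i))
    \<le> real (\<nu> div 2) * real (binom m (int k - 3))
      + (real k / 3 * real (\<nu> choose 2) + (real k - 1) * real \<nu>) * real (binom m (int k - 4))
      + 2 ^ (k * \<nu>) * (\<Sum>i<k - 4. real (m choose i))"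
proof (cases "k = 3")
  \<comment> \<open>For \<open>k = 3\<close> the index \<open>int k - 4\<close> is negative and its
    binomial is 0; traces of size 3 have no room.\<close>
  case True
  then show ?thesis by (simp add: trace_cap_def binom_def numeral_2_eq_2)
next
  case False
  define q where "q = k - 4"
  have k: "k = Suc (Suc (Suc (Suc q)))" using assms False by (simp add: q_def)
  have b: "binom m (int k - 3) = m choose Suc q" "binom m (int k - 4) = m choose q"
    by (simp_all add: k binom_def nat_add_distrib)
  have "(\<Sum>i<k - 1. trace_cap k \<nu> (k - 1 - i) * real (m choose i))
    = (\<Sum>i<q. trace_cap k \<nu> (k - 1 - i) * real (m choose i))
      + trace_cap k \<nu> 3 * real (m choose q) + trace_cap k \<nu> 2 * real (m choose Suc q)
      + trace_cap k \<nu> 1 * real (m choose Suc (Suc q))"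
  proof -
    have "k - 1 = Suc (Suc (Suc q))" using k by simp
    then show ?thesis by (simp add: numeral_3_eq_3 numeral_2_eq_2)
  qed
  also have "(\<Sum>i<q. trace_cap k \<nu> (k - 1 - i) * real (m choose i)) = (\<Sum>i<q. 2 ^ (k * \<nu>) * real (m choose i))"
    by (rule sum.cong) (auto simp: trace_cap_def k)
  also have "\<dots> = 2 ^ (k * \<nu>) * (\<Sum>i<k - 4. real (m choose i))"
    by (simp add: sum_distrib_left q_def)
  finally show ?thesis unfolding b by (simp add: trace_cap_def)
qed

lemma traces_le_cap:
  assumes k: "3 \<le> k" and F: "F \<subseteq> nsets V k" "cluster_free 3 k F" and W: "finite W" "x \<notin> W"
    and M: "M \<subseteq> F" "x \<notin> \<Union>M" "\<Union>M \<inter> W = {}" "finite M" "pairwise disjnt M"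
    and S: "S \<subseteq> W" "card S + 2 \<le> k" "S \<notin> inner_trace F k x M W"
  shows "real (card (traces F k x (\<Union>M) S)) \<le> trace_cap k (card M) (k - 1 - card S)"
proof -
  let ?H = "traces F k x (\<Union>M) S" and ?j = "k - 1 - card S"
  have sp: "spread M ?j ?H" by (rule spread_traces[OF F W M(1-3) S])
  have MB: "finite B \<and> card B = k" if "B \<in> M" for B using that M(1) F(1) by (auto simp: nsets_def)
  have cU: "card (\<Union>M) = k * card M"
    using card_Union_disjoint[OF M(5)] MB by simp
  have finU: "finite (\<Union>M)" using M(4) MB by auto
  consider "?j = 1" | "?j = 2" | "?j = 3" | "?j \<noteq> 1" "?j \<noteq> 2" "?j \<noteq> 3" by blast
  then show ?thesis
  proof cases
    case 1
    have "?H = {}"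
    proof (rule ccontr)
      assume "?H \<noteq> {}"
      then obtain T where T: "T \<in> ?H" by blast
      then have "T \<subseteq> \<Union>M" "card T = 1" using 1 by (auto simp: traces_def nsets_def)
      then obtain u where "T = {u}" "u \<in> \<Union>M" by (auto simp: card_1_singleton_iff)
      then show False using sp T by (auto simp: spread_def)
    qed
    then show ?thesis using 1 by (simp add: trace_cap_def)
  next
    case 2
    have "2 * card ?H \<le> card M"
      using spread_2_card[OF M(4,5)] MB sp 2 by simp
    then have "card ?H \<le> card M div 2" by simp
    then show ?thesis unfolding 2 by (simp add: trace_cap_def)
  next
    case 3
    then have "4 \<le> k" using S by linarith
    then show ?thesis
      using spread_3_card[OF M(4,5) MB] sp 3 by (simp add: trace_cap_def)
  next
    case 4
    have "card ?H \<le> card (Pow (\<Union>M))"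
      using finU by (intro card_mono) (auto simp: traces_def nsets_def)
    also have "\<dots> = 2 ^ (k * card M)" using finU cU by (simp add: card_Pow)
    finally have "real (card ?H) \<le> real (2 ^ (k * card M))" by (rule of_nat_mono)
    then show ?thesis using 4 by (simp add: trace_cap_def)
  qed
qed

text \<open>For large \<open>W\<close> the sets in \<open>inner_trace\<close> cost at most half of
  the missing sets. The other half stays on the left as credit against the edges avoiding
  \<open>x\<close>.\<close>

lemma star_part_le:
  assumes k: "3 \<le> k" and F: "F \<subseteq> nsets (insert x (\<Union>M \<union> W)) k" "cluster_free 3 k F"
    and W: "finite W" "x \<notin> W" "2 ^ (k + k * card M) + k \<le> card W"
    and M: "M \<subseteq> F" "x \<notin> \<Union>M" "\<Union>M \<inter> W = {}" "finite M" "pairwise disjnt M"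
  shows "real (card {A \<in> F. x \<in> A}) + real (card (missing F k x W)) / 2 \<le> real (card W choose (k - 1))
    + real (card M div 2) * real (binom (card W) (int k - 3))
    + (real k / 3 * real (card M choose 2) + (real k - 1) * real (card M)) * real (binom (card W) (int k - 4))
    + 2 ^ (k * card M) * (\<Sum>i<k - 4. real (card W choose i))"
proof -
  let ?I = "inner_trace F k x M W" and ?m = "missing F k x W"
  have MB: "finite B \<and> card B = k" if "B \<in> M" for B using that M(1) F(1) by (auto simp: nsets_def)
  have cU: "card (\<Union>M) = k * card M"
    using card_Union_disjoint[OF M(5)] MB by simp
  have finU: "finite (\<Union>M)" using M(4) MB by auto
  have finI: "finite ?I" using W by (auto simp: inner_trace_def intro: finite_subset[of _ "Pow W"])
  have cap0: "0 \<le> trace_cap k (card M) j" for j using k by (simp add: trace_cap_def)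
  have "real (card {A \<in> F. x \<in> A}) \<le> real (card W choose (k - 1)) - real (card ?m)
    + 2 ^ card (\<Union>M) * real (card ?I) + (\<Sum>i<k - 1. trace_cap k (card M) (k - 1 - i) * real (card W choose i))"
    by (rule card_star_le[OF _ F(1) finU W(1) M(2) W(2) M(3) finI traces_le_cap[OF k F W(1,2) M] cap0])
      (use k in auto)
  moreover have "2 ^ card (\<Union>M) * real (card ?I) \<le> real (card ?m) / 2"
  proof -
    have "k \<le> card W + 1" using W by simp
    then have "card ?I * (card W + 2 - k) \<le> 2 ^ (k - 1) * card ?m"
      using card_inner_trace[OF _ _ F W(1,2) M(1-3)] k by simp
    moreover have "card ?I * (2 * 2 ^ (k - 1) * 2 ^ (k * card M)) \<le> card ?I * (card W + 2 - k)"
    proof (rule mult_le_mono2)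
      have "2 * 2 ^ (k - 1) = (2::nat) ^ k" using k by (simp flip: power_Suc)
      then show "2 * 2 ^ (k - 1) * 2 ^ (k * card M) \<le> card W + 2 - k"
        using W(3) by (simp add: power_add)
    qed
    ultimately have "card ?I * (2 * 2 ^ (k - 1) * 2 ^ (k * card M)) \<le> 2 ^ (k - 1) * card ?m"
      by (meson le_trans)
    then have "2 ^ (k - 1) * (card ?I * (2 * 2 ^ (k * card M))) \<le> 2 ^ (k - 1) * card ?m"
      by (simp only: mult_ac)
    then have "card ?I * (2 * 2 ^ (k * card M)) \<le> card ?m" by simp
    then have "real (card ?I * (2 * 2 ^ (k * card M))) \<le> real (card ?m)" by (rule of_nat_mono)
    moreover have "real (card ?I * (2 * 2 ^ (k * card M))) = 2 * (2 ^ (k * card M) * real (card ?I))" by simp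
    ultimately show ?thesis unfolding cU by linarith
  qed
  ultimately show ?thesis using sum_trace_cap_le[OF k, of "card M" "card W"] by linarith
qed

section \<open>Edges avoiding the centre\<close>

text \<open>Sum \<open>missing_through_point\<close> over \<open>Y\<close>; a missing set is counted
  through at most \<open>k - 1\<close> of its points.\<close>

lemma support_bound:
  assumes k: "3 \<le> k" and F: "F \<subseteq> nsets V k" "cluster_free 3 k F" and W: "finite W" "x \<notin> W"
    and Y: "finite Y" "\<And>w. w \<in> Y \<Longrightarrow> w \<in> W \<and> (\<exists>B\<in>F. x \<notin> B \<and> w \<in> B)"
  shows "card Y * ((card W + 1 - k) * ((card W - k) choose (k - 2)))
    \<le> (card W + 1 - k + card Y) * ((k - 1) * card (missing F k x W))"
proof -
  let ?m = "missing F k x W" and ?a = "card W + 1 - k"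
  have "(\<Sum>w\<in>Y. card {R \<in> ?m. w \<in> R}) = (\<Sum>R\<in>?m. card {w \<in> Y. w \<in> R})"
    by (rule sum_multicount_gen[OF Y(1) finite_missing[OF W(1)]]) simp
  also have "(\<Sum>R\<in>?m. card {w \<in> Y. w \<in> R}) \<le> (\<Sum>R\<in>?m. k - 1)"
  proof (rule sum_mono)
    fix R assume "R \<in> ?m"
    then have "finite R" "card R = k - 1" by (auto simp: missing_def nsets_def)
    then show "card {w \<in> Y. w \<in> R} \<le> k - 1" using card_mono[of R "{w \<in> Y. w \<in> R}"] by auto
  qed
  also have "\<dots> = (k - 1) * card ?m" by simp
  finally have points: "(\<Sum>w\<in>Y. card {R \<in> ?m. w \<in> R}) \<le> (k - 1) * card ?m" .
  have "card Y * (?a * ((card W - k) choose (k - 2))) = (\<Sum>w\<in>Y. ?a * ((card W - k) choose (k - 2)))" by simp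
  also have "\<dots> \<le> (\<Sum>w\<in>Y. ?a * card {R \<in> ?m. w \<in> R} + (k - 1) * card ?m)"
  proof (rule sum_mono)
    fix w assume "w \<in> Y"
    then obtain B where "w \<in> W" "B \<in> F" "x \<notin> B" "w \<in> B" using Y(2) by blast
    then show "?a * ((card W - k) choose (k - 2)) \<le> ?a * card {R \<in> ?m. w \<in> R} + (k - 1) * card ?m"
      using k by (intro missing_through_point[OF _ F W, of B]) auto
  qed
  also have "\<dots> = ?a * (\<Sum>w\<in>Y. card {R \<in> ?m. w \<in> R}) + card Y * ((k - 1) * card ?m)"
    by (simp add: sum.distrib sum_distrib_left)
  also have "\<dots> \<le> ?a * ((k - 1) * card ?m) + card Y * ((k - 1) * card ?m)"
    by (intro add_right_mono mult_le_mono2 points)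
  also have "\<dots> = (?a + card Y) * ((k - 1) * card ?m)" by (rule add_mult_distrib[symmetric])
  finally show ?thesis .
qed

text \<open>Solves the inequality of \<open>support_bound\<close> for \<open>y\<close>, after
  division by a power of \<open>n\<close>: half of the left side absorbs
  \<open>y * q\<close>.\<close>

lemma real_support_bound:
  fixes y d a q :: real
  assumes "0 < d" "0 < a" "0 \<le> y" "2 * q \<le> d * a" "y * (d * a) \<le> (d + y) * q"
  shows "y \<le> 2 * q / a"
proof -
  have "y * (2 * q) \<le> y * (d * a)" using assms by (intro mult_left_mono) auto
  then have "y * (d * a) \<le> 2 * (d * q)" using assms(5) by (simp add: algebra_simps)
  then have "d * (y * a) \<le> d * (2 * q)" by (simp add: algebra_simps)
  then have "y * a \<le> 2 * q" using assms(1) by simp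
  then show ?thesis using assms(2) by (simp add: field_simps)
qed

section \<open>Assembly of the upper bound\<close>

text \<open>The edges avoiding the centre either all lie inside the blocks, where the extremal
  number on \<open>k * \<nu>\<close> points bounds them, or are outweighed by the half of the
  missing sets left over in \<open>star_part_le\<close>.\<close>

lemma upper_bound:
  fixes k \<nu> :: nat
  assumes k: "3 \<le> k"
  shows "\<exists>K::real. \<forall>\<^sub>F n in sequentially. \<forall>F M.
    F \<subseteq> nsets {1..n} k \<and> cluster_free 3 k F \<and> M \<subseteq> F \<and> pairwise disjnt M \<and> \<nu> + 1 \<le> card M \<longrightarrow>
    real (card F) \<le> real (binom (n - k * \<nu> - 1) (int k - 1))
      + real (\<nu> div 2) * real (binom (n - k * \<nu> - 1) (int k - 3))
      + (real k / 3 * real (\<nu> choose 2) + (real k - 1) * real \<nu> + K / real (n - k * \<nu> - 1))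
          * real (binom (n - k * \<nu> - 1) (int k - 4))
      + real (max_cluster_free (k * \<nu>) k 3 (int \<nu> - 1))"
proof -
  obtain K0 :: nat where K0: "\<forall>(V::nat set) F. finite V \<and> 2 * k + 2 \<le> card V \<and> F \<subseteq> nsets V k \<and> cluster_free 3 k F
    \<longrightarrow> (\<exists>x. card {D \<in> nsets V (k - 1). x \<in> D \<or> insert x D \<notin> F}
        \<le> K0 * (((card V choose (k - 1)) - card F) + card V ^ (k - 2)))"
    using star_center[OF k] by (rule exE)
  \<comment> \<open>\<open>C1\<close> bounds the deviation from a star in units of
    \<open>n ^ (k - 2)\<close>: the deficit of \<open>F\<close> contributes
    \<open>k * \<nu> + 1\<close>, the error term of \<open>star_center\<close> one more.
    \<open>a\<close> is the constant in the lower bound for a shifted binomial, and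
    \<open>Y0\<close> will bound the number of points on edges avoiding the centre.\<close>
  define C1 where "C1 = K0 * (k * \<nu> + 2)"
  define a :: real where "a = 1 / (2 * real (k - 2)) ^ (k - 2)"
  define Y0 where "Y0 = nat \<lceil>2 * real ((k - 1) * C1) / a\<rceil>"
  define K :: real where "K = 2 ^ (k * \<nu>) * real (k ^ Suc k)"
  define N0 where "N0 = 2 * k + k * \<nu> + 2 + C1 * (k - 1) ^ (k - 1) + 2 ^ (k + k * \<nu>) + Y0 + 4 * 2 ^ Y0"
  have a0: "0 < a" using k by (simp add: a_def)
  have Y0: "2 * real ((k - 1) * C1) / a \<le> real Y0" unfolding Y0_def by linarith
  show ?thesis
  proof (rule exI[of _ K], unfold eventually_sequentially, intro exI[of _ N0] allI impI, elim conjE)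
    fix n F M
    assume n: "N0 \<le> n" and F: "F \<subseteq> nsets {1..n} k" "cluster_free 3 k F"
      and M: "M \<subseteq> F" "pairwise disjnt M" "\<nu> + 1 \<le> card M"
    define m where "m = n - k * \<nu> - 1"
    let ?c2 = "real k / 3 * real (\<nu> choose 2) + (real k - 1) * real \<nu>"
    let ?M3 = "max_cluster_free (k * \<nu>) k 3 (int \<nu> - 1)"
    have nm: "n = m + k * \<nu> + 1" using n by (simp add: N0_def m_def)
    have n1: "2 * k + 2 \<le> n" "C1 * (k - 1) ^ (k - 1) < n" "k + Y0 \<le> n" "k < n"
      and m1: "2 ^ (k + k * \<nu>) + k \<le> m" "2 * k + 4 * 2 ^ Y0 \<le> m + 1"
      using n nm k unfolding N0_def by linarith+
    have b1: "binom m (int k - 1) = m choose (k - 1)"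
      using k by (simp add: binom_def nat_diff_distrib)
    have c20: "0 \<le> ?c2" using k by simp
    have K00: "0 \<le> K / real m" by (simp add: K_def)
    have lowsum: "2 ^ (k * \<nu>) * (\<Sum>i<k - 4. real (m choose i)) \<le> K / real m * real (binom m (int k - 4))"
    proof -
      have "(\<Sum>i<k - 4. real (m choose i)) \<le> real (k ^ Suc k) / real m * real (binom m (int k - 4))"
        using m1 k by (intro sum_low_binomials_le) linarith+
      then have "2 ^ (k * \<nu>) * (\<Sum>i<k - 4. real (m choose i))
        \<le> 2 ^ (k * \<nu>) * (real (k ^ Suc k) / real m * real (binom m (int k - 4)))"
        by (intro mult_left_mono) auto
      then show ?thesis by (simp add: K_def)
    qed
    have "real (card F) \<le> real (binom m (int k - 1)) + real (\<nu> div 2) * real (binom m (int k - 3))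
      + (?c2 + K / real m) * real (binom m (int k - 4)) + real ?M3"
    \<comment> \<open>Below the size of the star on \<open>m\<close> further points nothing is left
      to prove; otherwise the deficit of \<open>F\<close> is at most of order
      \<open>n ^ (k - 2)\<close>.\<close>
    proof (cases "card F < m choose (k - 1)")
      case True
      then have "real (card F) \<le> real (binom m (int k - 1))" by (simp add: b1)
      moreover have "0 \<le> (?c2 + K / real m) * real (binom m (int k - 4))"
        by (intro mult_nonneg_nonneg add_nonneg_nonneg c20 K00 of_nat_0_le_iff)
      ultimately show ?thesis by (smt (verit) mult_nonneg_nonneg of_nat_0_le_iff)
    next
      case False
      let ?V = "{1..n}"
      obtain x where x: "card {D \<in> nsets ?V (k - 1). x \<in> D \<or> insert x D \<notin> F}
        \<le> K0 * (((n choose (k - 1)) - card F) + n ^ (k - 2))"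
        using K0[rule_format, of ?V F] F n1 by auto
      let ?L = "{D \<in> nsets ?V (k - 1). x \<in> D \<or> insert x D \<notin> F}"
      have cL: "card ?L \<le> C1 * n ^ (k - 2)"
      proof -
        have "n choose Suc (k - 2) \<le> ((n - (k * \<nu> + 1)) choose Suc (k - 2)) + (k * \<nu> + 1) * n ^ (k - 2)"
          using nm by (intro choose_Suc_le_shift) simp
        moreover have "Suc (k - 2) = k - 1" "n - (k * \<nu> + 1) = m" using k nm by simp_all
        ultimately have "n choose (k - 1) \<le> (m choose (k - 1)) + (k * \<nu> + 1) * n ^ (k - 2)" by (simp only:)
        then have "(n choose (k - 1)) - card F \<le> (k * \<nu> + 1) * n ^ (k - 2)"
          unfolding le_diff_conv using False by linarith
        then have "K0 * (((n choose (k - 1)) - card F) + n ^ (k - 2)) \<le> K0 * ((k * \<nu> + 1) * n ^ (k - 2) + n ^ (k - 2))"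
          by (intro mult_le_mono2 add_right_mono)
        then show ?thesis using x by (simp add: C1_def algebra_simps)
      qed
      have finN: "finite (nsets ?V j)" for j by (simp add: finite_imp_finite_nsets)
      have finF: "finite F" using F(1) finN finite_subset by blast
      have MB: "finite B" "card B = k" "B \<subseteq> ?V" if "B \<in> F" for B using that F(1) by (auto simp: nsets_def)
      \<comment> \<open>\<open>star_center\<close> may return a point outside the ground set; then
        every \<open>(k - 1)\<close>-set would count as a deviation, too many for large
        \<open>n\<close>.\<close>
      have xV: "x \<in> ?V"
      proof (rule ccontr)
        assume "x \<notin> ?V"
        then have "?L = nsets ?V (k - 1)" using F(1) by (auto simp: nsets_def)
        then have "n choose (k - 1) \<le> C1 * n ^ (k - 2)" using cL by (simp add: card_nsets)
        moreover have "(real n / real (k - 1)) ^ (k - 1) \<le> real (n choose (k - 1))"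
          using n1 by (intro binomial_ge_n_over_k_pow_k) simp
        ultimately have "(real n / real (k - 1)) ^ (k - 1) \<le> real (C1 * n ^ (k - 2))"
          by (meson of_nat_mono order_trans)
        then have "real n ^ (k - 1) \<le> real C1 * real n ^ (k - 2) * real (k - 1) ^ (k - 1)"
          using k by (simp add: power_divide field_simps)
        moreover have "real n ^ (k - 1) = real n * real n ^ (k - 2)"
          using k by (simp flip: power_Suc add: Suc_diff_le numeral_2_eq_2 Suc_diff_Suc)
        ultimately have "real n ^ (k - 2) * real n \<le> real n ^ (k - 2) * (real C1 * real (k - 1) ^ (k - 1))"
          by (simp add: mult_ac)
        moreover have "0 < real n ^ (k - 2)" using n1 by simp
        ultimately have "real n \<le> real C1 * real (k - 1) ^ (k - 1)" by (simp only: mult_le_cancel_left_pos)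
        then have "real n \<le> real (C1 * (k - 1) ^ (k - 1))" by simp
        then show False using n1(2) by (simp only: of_nat_le_iff)
      qed
      define G where "G = {A \<in> F. x \<notin> A}"
      \<comment> \<open>At most one member of a matching contains \<open>x\<close>, so at least
        \<open>\<nu>\<close> members are left to serve as blocks.\<close>
      have "\<exists>M'. M' \<subseteq> M \<and> M' \<subseteq> G \<and> card M' = \<nu>"
      proof -
        have finM: "finite M" using M(1) finF finite_subset by blast
        have one: "card {B \<in> M. x \<in> B} \<le> 1"
          using M(2) finM by (auto simp: card_le_Suc0_iff_eq pairwise_def disjnt_def)
        have "{B \<in> M. x \<notin> B} = M - {B \<in> M. x \<in> B}" by blast
        then have "card {B \<in> M. x \<notin> B} = card M - card {B \<in> M. x \<in> B}"
          using finM by (simp add: card_Diff_subset)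
        then have "\<nu> \<le> card {B \<in> M. x \<notin> B}" using one M(3) by linarith
        then obtain M' where "M' \<subseteq> {B \<in> M. x \<notin> B}" "card M' = \<nu>"
          by (metis obtain_subset_with_card_n)
        then show ?thesis using M(1) unfolding G_def by blast
      qed
      then obtain M' where M': "M' \<subseteq> M" "M' \<subseteq> G" and cM': "card M' = \<nu>" by blast
      have finG: "finite G" using finF by (simp add: G_def)
      have M'F: "M' \<subseteq> F" "x \<notin> \<Union>M'" "finite M'" "pairwise disjnt M'"
        using M' M finite_subset[OF M'(2) finG] by (auto simp: G_def intro: pairwise_subset)
      let ?U = "\<Union>M'"
      define W where "W = ?V - insert x ?U"
      have UV: "?U \<subseteq> ?V" using M'F(1) MB by blast
      have finU: "finite ?U" using UV finite_subset by blast
      have cU: "card ?U = k * \<nu>"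
        using card_Union_disjoint[OF M'F(4)] MB M'F(1) cM' by (simp add: subset_iff)
      have W: "finite W" "x \<notin> W" "?U \<inter> W = {}" "insert x (?U \<union> W) = ?V"
        using UV xV by (auto simp: W_def)
      have cW: "card W = m"
        unfolding W_def using UV xV finU M'F(2) cU nm by (subst card_Diff_subset) auto
      let ?m = "missing F k x"
      have missV: "card (?m (?V - {x})) \<le> C1 * n ^ (k - 2)"
      proof -
        have "?m (?V - {x}) \<subseteq> ?L" by (auto simp: missing_def nsets_def)
        then have "card (?m (?V - {x})) \<le> card ?L" using finN by (intro card_mono) auto
        then show ?thesis using cL by simp
      qed
      have GV: "\<Union>G \<subseteq> ?V - {x}" using MB by (auto simp: G_def)
      then have finY: "finite (\<Union>G)" by (rule finite_subset) simp
      \<comment> \<open>The support estimate is run on all of \<open>?V - {x}\<close> rather than on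
        \<open>W\<close>, since edges avoiding \<open>x\<close> may also use points of the
        blocks.\<close>
      have cY: "card (\<Union>G) \<le> Y0"
      proof -
        let ?y = "card (\<Union>G)" and ?q = "(k - 1) * C1"
        have cV: "card (?V - {x}) = n - 1" using xV by simp
        have "?y * ((n - k) * ((n - (k + 1)) choose (k - 2))) \<le> (n - k + ?y) * ((k - 1) * card (?m (?V - {x})))"
        proof -
          have "n - 1 + 1 - k = n - k" "n - 1 - k = n - (k + 1)" using n1 by auto
          moreover have "w \<in> ?V - {x} \<and> (\<exists>B\<in>F. x \<notin> B \<and> w \<in> B)" if "w \<in> \<Union>G" for w
            using that GV unfolding G_def by blast
          ultimately show ?thesis
            using support_bound[OF k F, of "?V - {x}" x "\<Union>G"] finY cV by simp
        qed
        also have "\<dots> \<le> (n - k + ?y) * ((k - 1) * (C1 * n ^ (k - 2)))"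
          by (intro mult_le_mono2 missV)
        finally have nat: "?y * ((n - k) * ((n - (k + 1)) choose (k - 2))) \<le> (n - k + ?y) * (?q * n ^ (k - 2))"
          by (simp only: mult.assoc)
        have "a * real n ^ (k - 2) = (real n / (2 * real (k - 2))) ^ (k - 2)"
          by (simp add: a_def power_divide)
        also have "\<dots> \<le> real ((n - (k + 1)) choose (k - 2))"
          using n1 k by (intro choose_shift_ge) auto
        finally have ch: "a * real n ^ (k - 2) \<le> real ((n - (k + 1)) choose (k - 2))" .
        let ?d = "real (n - k)" and ?P = "real n ^ (k - 2)"
        have "real ?y * (?d * (a * ?P)) \<le> real ?y * (?d * real ((n - (k + 1)) choose (k - 2)))"
          by (intro mult_left_mono ch) auto
        also have "\<dots> = real (?y * ((n - k) * ((n - (k + 1)) choose (k - 2))))" by simp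
        also have "\<dots> \<le> real ((n - k + ?y) * (?q * n ^ (k - 2)))" by (rule of_nat_mono[OF nat])
        also have "\<dots> = (?d + real ?y) * (real ?q * ?P)" by simp
        finally have "?P * (real ?y * (?d * a)) \<le> ?P * ((?d + real ?y) * real ?q)"
          by (simp only: mult_ac)
        moreover have "0 < ?P" using n1 by simp
        ultimately have ineq: "real ?y * (?d * a) \<le> (?d + real ?y) * real ?q"
          by (simp only: mult_le_cancel_left_pos)
        have "2 * real ?q \<le> ?d * a"
        proof -
          have "2 * real ?q / a \<le> ?d" using Y0 n1(3) by linarith
          then show ?thesis using a0 by (simp add: field_simps)
        qed
        then have "real ?y \<le> 2 * real ?q / a"
          using real_support_bound[OF _ a0 _ _ ineq] n1(4) by simp
        then show ?thesis using Y0 by linarith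
      qed
      have cG: "card G \<le> 2 ^ Y0"
      proof -
        have "card G \<le> card (Pow (\<Union>G))" using finY by (intro card_mono) auto
        also have "\<dots> \<le> 2 ^ Y0" using finY cY by (simp add: card_Pow power_increasing)
        finally show ?thesis .
      qed
      have star: "real (card {A \<in> F. x \<in> A}) + real (card (?m W)) / 2 \<le> real (m choose (k - 1))
        + real (\<nu> div 2) * real (binom m (int k - 3)) + ?c2 * real (binom m (int k - 4))
        + 2 ^ (k * \<nu>) * (\<Sum>i<k - 4. real (m choose i))"
        using star_part_le[OF k _ F(2) W(1,2) _ M'F(1,2) W(3) M'F(3,4)] F(1) W(4) m1(1) cM' cW by simp
      have "F = {A \<in> F. x \<in> A} \<union> G" by (auto simp: G_def)
      then have "card F \<le> card {A \<in> F. x \<in> A} + card G" by (metis card_Un_le)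
      moreover have "real (card G) \<le> real ?M3 + real (card (?m W)) / 2"
      proof (cases "\<Union>G \<subseteq> ?U")
        case True
        \<comment> \<open>\<open>G\<close> contains the \<open>\<nu>\<close> blocks, so it competes
          for the extremal number on \<open>k * \<nu>\<close> points with parameter
          \<open>int \<nu> - 1\<close>, which is -1 when \<open>\<nu> = 0\<close>.\<close>
        then have GU: "G \<subseteq> nsets ?U k" using MB by (auto simp: G_def nsets_def)
        have "cluster_free 3 k G" using F(2) by (auto simp: cluster_free_def G_def)
        from max_cluster_free_ge[OF finU GU this M'(2) M'F(4), of "int \<nu> - 1"]
        have "card G \<le> ?M3" using cU cM' by simp
        then show ?thesis by simp
      next
        case False
        then obtain B w where B: "B \<in> F" "x \<notin> B" "w \<in> B" "w \<notin> ?U" by (auto simp: G_def)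
        then have "w \<in> ?V" "w \<noteq> x" using MB(3)[OF B(1)] by auto
        then have wW: "w \<in> W" using B(4) by (simp add: W_def)
        \<comment> \<open>Linear growth of this binomial suffices, because \<open>card G\<close> is
          at most the constant \<open>2 ^ Y0\<close>.\<close>
        let ?c = "(m - k) choose (k - 2)" and ?l = "card (?m W)"
        have "(m + 1 - k) * ?c \<le> (m + 1 - k) * card {R \<in> ?m W. w \<in> R} + (k - 1) * ?l"
          using missing_through_point[OF _ F W(1,2) B(1-3) wW] k cW by simp
        also have "card {R \<in> ?m W. w \<in> R} \<le> ?l" using finite_missing[OF W(1)] by (intro card_mono) auto
        finally have 1: "(m + 1 - k) * ?c \<le> (m + 1 - k) * ?l + (k - 1) * ?l" by simp
        have "m + 1 - k + (k - 1) = m" using m1 k by linarith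
        then have 1: "(m + 1 - k) * ?c \<le> m * ?l" using 1 by (metis add_mult_distrib)
        have "4 * 2 ^ Y0 \<le> m - k + 1 - (k - 2)" using m1(2) k by linarith
        also have "\<dots> \<le> ?c" using m1(2) k by (intro choose_ge_linear) linarith+
        finally have "(m + 1 - k) * (4 * 2 ^ Y0) \<le> (m + 1 - k) * ?c" by (rule mult_le_mono2)
        moreover have "m * (2 * 2 ^ Y0) \<le> (m + 1 - k) * (4 * 2 ^ Y0)"
        proof -
          have "m \<le> (m + 1 - k) * 2" using m1(2) k by linarith
          then have "m * (2 * 2 ^ Y0) \<le> (m + 1 - k) * 2 * (2 * 2 ^ Y0)" by (rule mult_le_mono1)
          then show ?thesis by (simp add: mult.assoc)
        qed
        ultimately have "m * (2 * 2 ^ Y0) \<le> m * ?l" using 1 by (meson le_trans)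
        then have "2 * 2 ^ Y0 \<le> ?l" using m1(1) k by simp
        then have "2 * card G \<le> ?l" using cG by linarith
        then show ?thesis by simp
      qed
      ultimately have "real (card F) \<le> real (m choose (k - 1))
        + real (\<nu> div 2) * real (binom m (int k - 3)) + ?c2 * real (binom m (int k - 4))
        + K / real m * real (binom m (int k - 4)) + real ?M3"
        using star lowsum by linarith
      then show ?thesis unfolding b1 by (simp only: distrib_right add.assoc)
    qed
    then show "real (card F) \<le> real (binom (n - k * \<nu> - 1) (int k - 1))
      + real (\<nu> div 2) * real (binom (n - k * \<nu> - 1) (int k - 3))
      + (?c2 + K / real (n - k * \<nu> - 1)) * real (binom (n - k * \<nu> - 1) (int k - 4)) + real ?M3"
      unfolding m_def .
  qed
qed

section \<open>Attainment and the final constants\<close>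

text \<open>Consecutive intervals of length \<open>k\<close> show that the maximum runs over a
  nonempty set of families and hence is attained.\<close>

lemma exists_matching_family:
  assumes k: "1 \<le> k" and n: "k * (\<nu> + 1) \<le> n"
  obtains F :: "nat set set" where "F \<subseteq> nsets {1..n} k" "cluster_free 3 k F" "pairwise disjnt F" "card F = \<nu> + 1"
proof -
  define b where "b i = {i * k + 1..i * k + k}" for i
  let ?M = "b ` {..\<nu>}"
  have dis: "disjnt (b i) (b j)" if "i < j" for i j
  proof -
    have "(i + 1) * k \<le> j * k" using that by (intro mult_le_mono1) simp
    then show ?thesis by (auto simp: b_def disjnt_def)
  qed
  have dis': "disjnt (b i) (b j)" if "i \<noteq> j" for i j
    using that dis[of i j] dis[of j i] by (auto simp: neq_iff disjnt_sym)
  have ne: "b i \<noteq> {}" for i using k by (simp add: b_def)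
  have pd: "pairwise disjnt ?M" by (rule pairwise_imageI) (rule dis')
  have "inj_on b {..\<nu>}"
  proof (rule inj_onI, rule ccontr)
    fix i j assume "b i = b j" "i \<noteq> j"
    then show False using dis'[of i j] ne[of j] by (simp add: disjnt_def)
  qed
  then have card: "card ?M = \<nu> + 1" by (simp add: card_image)
  have fin: "finite B \<and> card B = k" if "B \<in> ?M" for B using that by (auto simp: b_def)
  have sub: "?M \<subseteq> nsets {1..n} k"
  proof (rule image_subsetI)
    fix i assume "i \<in> {..\<nu>}"
    then have "(i + 1) * k \<le> (\<nu> + 1) * k" by (intro mult_le_mono1) simp
    then have "(i + 1) * k \<le> n" using n unfolding mult.commute[of k] by (rule le_trans)
    then have "i * k + k \<le> n" by simp
    then show "b i \<in> nsets {1..n} k" by (auto simp: b_def nsets_def)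
  qed
  \<comment> \<open>With an empty family of traces the criterion is about the blocks alone; 0 is a
    point outside all of them.\<close>
  have "cluster_free 3 k (?M \<union> {A \<in> nsets {} k. 0 \<in> A \<and> A \<inter> \<Union>?M \<in> {}})"
    by (rule trace_family_cluster_free[OF k pd fin]) (auto simp: b_def)
  then have "cluster_free 3 k ?M" by simp
  then show thesis using that sub pd card by blast
qed

theorem theorem1p6:
  fixes k \<nu> :: nat
  assumes "k \<ge> 3"
  shows "\<exists>c\<^sub>1 c\<^sub>2 M\<^sub>3 :: real.
    max ((real k - 1) * real (turan_number 3 \<nu> (tight_path 3 2)))
        (2 * (real k - 1) * of_int \<lfloor>real \<nu> / 2\<rfloor>) \<le> c\<^sub>1 \<and>
    c\<^sub>1 \<le> c\<^sub>2 \<and>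
    c\<^sub>2 \<le> real k / 3 * real (\<nu> choose 2) + (real k - 1) * real \<nu> \<and>
    M\<^sub>3 \<le> real (max_cluster_free (k * \<nu>) k 3 (int \<nu> - 1)) \<and>
    (\<forall>n \<ge> k * (\<nu> + 1).
       real (max_cluster_free n k 3 (int \<nu>)) \<ge>
         real (binom (n - k * \<nu> - 1) (int k - 1))
         + of_int \<lfloor>real \<nu> / 2\<rfloor> * real (binom (n - k * \<nu> - 1) (int k - 3))
         + c\<^sub>1 * real (binom (n - k * \<nu> - 1) (int k - 4))
         + real \<nu>) \<and>
    (\<exists>\<epsilon> :: nat \<Rightarrow> real. \<epsilon> \<longlonglongrightarrow> 0 \<and>
       (\<forall>\<^sub>F n in sequentially.
          real (max_cluster_free n k 3 (int \<nu>)) \<le>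
            real (binom (n - k * \<nu> - 1) (int k - 1))
            + of_int \<lfloor>real \<nu> / 2\<rfloor> * real (binom (n - k * \<nu> - 1) (int k - 3))
            + (c\<^sub>2 + \<epsilon> n) * real (binom (n - k * \<nu> - 1) (int k - 4))
            + M\<^sub>3))"
proof -
  let ?t = "turan_number 3 \<nu> (tight_path 3 2)"
  let ?c1 = "max ((real k - 1) * real ?t) (2 * (real k - 1) * real (\<nu> div 2))"
  let ?c2 = "real k / 3 * real (\<nu> choose 2) + (real k - 1) * real \<nu>"
  let ?M3 = "real (max_cluster_free (k * \<nu>) k 3 (int \<nu> - 1))"
  let ?m = "\<lambda>n. n - k * \<nu> - 1"
  have fl: "of_int \<lfloor>real \<nu> / 2\<rfloor> = real (\<nu> div 2)"
    using floor_divide_of_nat_eq[of \<nu> 2, where 'a = real] by simp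
  \<comment> \<open>The first candidate is at most the binomial term, by
    \<open>3 * ?t \<le> \<nu> choose 2\<close>; the second is at most the linear term, by
    \<open>2 * (\<nu> div 2) \<le> \<nu>\<close>.\<close>
  have c12: "?c1 \<le> ?c2"
  proof -
    obtain E where "E \<subseteq> nsets {1..\<nu>} 3" "card E = ?t"
      "\<And>e e'. e \<in> E \<Longrightarrow> e' \<in> E \<Longrightarrow> e \<noteq> e' \<Longrightarrow> card (e \<inter> e') \<le> 1"
      using turan_tight_attained by metis
    then have "3 * ?t \<le> \<nu> choose 2"
      using three_card_partial_triple_system[of E "{1..\<nu>}"] by simp
    then have "real (3 * ?t) \<le> real (\<nu> choose 2)" by (rule of_nat_mono)
    then have "real k * (3 * real ?t) \<le> real k * real (\<nu> choose 2)" by (intro mult_left_mono) auto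
    then have "(real k - 1) * real ?t \<le> real k / 3 * real (\<nu> choose 2)" by (simp add: algebra_simps)
    moreover have "0 \<le> (real k - 1) * real \<nu>" "0 \<le> real k / 3 * real (\<nu> choose 2)" using assms by auto
    moreover have "(real k - 1) * (2 * real (\<nu> div 2)) \<le> (real k - 1) * real \<nu>"
      using assms by (intro mult_left_mono) linarith+
    moreover have "2 * (real k - 1) * real (\<nu> div 2) = (real k - 1) * (2 * real (\<nu> div 2))" by simp
    ultimately show ?thesis by (intro max.boundedI) linarith+
  qed
  have lower: "real (binom (?m n) (int k - 1)) + real (\<nu> div 2) * real (binom (?m n) (int k - 3))
      + ?c1 * real (binom (?m n) (int k - 4)) + real \<nu> \<le> real (max_cluster_free n k 3 (int \<nu>))"
    if n: "k * (\<nu> + 1) \<le> n" for n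
  proof -
    have m: "k \<le> ?m n + 1" "k * \<nu> + ?m n + 1 = n" using n assms by (simp_all add: algebra_simps)
    have "real (binom (?m n) (int k - 1)) + real (\<nu> div 2) * real (binom (?m n) (int k - 3))
      + (real k - 1) * real ?t * real (binom (?m n) (int k - 4)) + real \<nu> \<le> real (max_cluster_free n k 3 (int \<nu>))"
      using of_nat_mono[OF lower_bound_triples[OF assms m(1), of \<nu>], where 'a = real] m(2) assms
      by (simp add: of_nat_diff)
    moreover have "real (binom (?m n) (int k - 1)) + real (\<nu> div 2) * real (binom (?m n) (int k - 3))
      + 2 * (real k - 1) * real (\<nu> div 2) * real (binom (?m n) (int k - 4)) + real \<nu> \<le> real (max_cluster_free n k 3 (int \<nu>))"
      using of_nat_mono[OF lower_bound_pairs[OF assms m(1), of \<nu>], where 'a = real] m(2) assms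
      by (simp add: of_nat_diff)
    ultimately show ?thesis by (simp only: max_def split: if_split) blast
  qed
  obtain K where K: "\<forall>\<^sub>F n in sequentially. \<forall>F M.
    F \<subseteq> nsets {1..n} k \<and> cluster_free 3 k F \<and> M \<subseteq> F \<and> pairwise disjnt M \<and> \<nu> + 1 \<le> card M \<longrightarrow>
    real (card F) \<le> real (binom (?m n) (int k - 1)) + real (\<nu> div 2) * real (binom (?m n) (int k - 3))
      + (?c2 + K / real (?m n)) * real (binom (?m n) (int k - 4)) + ?M3"
    using upper_bound[OF assms] by (rule exE)
  \<comment> \<open>Shifted by \<open>k * \<nu> + 1\<close>, the sequence is
    \<open>K / n\<close>.\<close>
  have lim: "(\<lambda>n. K / real (?m n)) \<longlonglongrightarrow> 0"
    by (rule LIMSEQ_offset[of _ "k * \<nu> + 1"]) (simp add: lim_const_over_n)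
  have upper: "\<forall>\<^sub>F n in sequentially. real (max_cluster_free n k 3 (int \<nu>)) \<le>
      real (binom (?m n) (int k - 1)) + real (\<nu> div 2) * real (binom (?m n) (int k - 3))
      + (?c2 + K / real (?m n)) * real (binom (?m n) (int k - 4)) + ?M3"
    using K eventually_ge_at_top[of "k * (\<nu> + 1)"]
  proof eventually_elim
    case (elim n)
    obtain F where F: "F \<subseteq> nsets {1..n} k" "cluster_free 3 k F" "pairwise disjnt F" "card F = \<nu> + 1"
    proof -
      have "1 \<le> k" using assms by simp
      then show thesis using that exists_matching_family[OF _ elim(2)] by blast
    qed
    obtain G M' where "G \<subseteq> nsets {1..n} k" "cluster_free 3 k G" "M' \<subseteq> G" "pairwise disjnt M'"
      "\<nu> + 1 \<le> card M'" "card G = max_cluster_free n k 3 (int \<nu>)"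
    proof -
      have "finite {1..n}" "\<nu> + 1 \<le> card F" using F(4) by simp_all
      from max_cluster_free_attained[OF this(1) F(1,2) subset_refl F(3) this(2)]
      show thesis using that unfolding card_atLeastAtMost diff_Suc_1 by metis
    qed
    then show ?case using elim(1) by metis
  qed
  show ?thesis
    unfolding fl
    by (intro exI[of _ ?c1] exI[of _ ?c2] exI[of _ ?M3] exI[of _ "\<lambda>n. K / real (?m n)"] conjI c12 lim upper
        order_refl allI impI lower)
qed

end
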